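(* Let $(H,\alpha)$ be a monoidal Hom-Hopf algebra over a field $k$ with bijective antipode $S$, let $(A,\beta)$ be a right $(H,\alpha)$-Hom-comodule algebra, and let $B=A^{coH}$. If the map $\mathrm{can}:A\otimes_BA\to A\otimes H$, $\mathrm{can}(a\otimes b)=\beta^{-1}(a)b_{(0)}\otimes\alpha(b_{(1)})$, is surjective, and if there exists a total integral $\varphi:(H,\alpha)\to(A,\beta)$, then the adjoint pair $(F,G)$, with $F=-\otimes_BA:\widetilde{\mathcal H}(\mathcal M_B)\to\widetilde{\mathcal H}(\mathcal M_A^H)$ and $G=(-)^{coH}:\widetilde{\mathcal H}(\mathcal M_A^H)\to\widetilde{\mathcal H}(\mathcal M_B)$, is a pair of inverse equivalences.
   Context: Fix a field $k$; all spaces, maps and tensor products are over $k$. $\widetilde{\mathcal H}(\mathcal M_k)$ has objects $(M,\mu)$ with $M$ a vector space and $\mu$ a linear automorphism of $M$; morphisms $f:(M,\mu)\to(N,\nu)$ are linear maps with $\nu f=f\mu$. A monoidal Hom-algebra $(A,\beta)$ is a vector space with bilinear multiplication, $1_A\in A$ and a linear automorphism $\beta$ such that $\beta(a)(bc)=(ab)\beta(c)$, $a1_A=1_Aa=\beta(a)$, $\beta(ab)=\beta(a)\beta(b)$, $\beta(1_A)=1_A$. A monoidal Hom-coalgebra $(C,\gamma)$ has linear maps $\Delta(c)=c_1\otimes c_2$ and $\varepsilon$, and a linear automorphism $\gamma$, with $\gamma^{-1}(c_1)\otimes\Delta(c_2)=\Delta(c_1)\otimes\gamma^{-1}(c_2)$,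 $c_1\varepsilon(c_2)=\gamma^{-1}(c)=\varepsilon(c_1)c_2$, $\Delta\gamma=(\gamma\otimes\gamma)\Delta$, $\varepsilon\gamma=\varepsilon$. A monoidal Hom-Hopf algebra $(H,\alpha)$ is both a monoidal Hom-algebra and a monoidal Hom-coalgebra (same $\alpha$) with $\Delta,\varepsilon$ multiplicative and unital (componentwise product on $H\otimes H$), and with a linear map $S:H\to H$ (antipode), $S\alpha=\alpha S$, $S(h_1)h_2=\varepsilon(h)1_H=h_1S(h_2)$. A right $(A,\beta)$-Hom-module is $(M,\mu)$ with a bilinear action satisfying $(m\cdot a)\cdot\beta(b)=\mu(m)\cdot(ab)$, $m\cdot1_A=\mu(m)$, $\mu(m\cdot a)=\mu(m)\cdot\beta(a)$; left Hom-modules are defined symmetrically. A right $(H,\alpha)$-Hom-comodule is $(M,\mu)$ with linear $\rho(m)=m_{(0)}\otimes m_{(1)}\in M\otimes H$ satisfying $\mu^{-1}(m_{(0)})\otimes\Delta(m_{(1)})=m_{(0)(0)}\otimes(m_{(0)(1)}\otimes\alpha^{-1}(m_{(1)}))$, $m_{(0)}\varepsilon(m_{(1)})=\mu^{-1}(m)$, $\rho\mu=(\mu\otimes\alpha)\rho$; $H$ is one via $\Delta$. Its coinvariants are $M^{coH}=\{m:\rho(m)=\mu^{-1}(m)\otimes1_H\}$. Morphisms are (co)linear maps commuting with the automorphisms. A right $(H,\alpha)$-Hom-comodule algebra $(A,\beta)$ is a monoidal Hom-algebra and right $(H,\alpha)$-Hom-comodule (same $\beta$) with $\rho_A(ab)=\rho_A(a)\rho_A(b)$,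 $\rho_A(1_A)=1_A\otimes1_H$. Then $B=A^{coH}$ is a monoidal Hom-algebra with automorphism $\beta|_B$. A total integral is a right $(H,\alpha)$-Hom-comodule map $\varphi:(H,\alpha)\to(A,\beta)$ with $\varphi(1_H)=1_A$. $\widetilde{\mathcal H}(\mathcal M_B)$ is the category of right $(B,\beta|_B)$-Hom-modules. $\widetilde{\mathcal H}(\mathcal M_A^H)$ is the category of right $(H,A)$-Hom-Hopf modules, i.e. right $(A,\beta)$-Hom-modules and right $(H,\alpha)$-Hom-comodules $(M,\mu)$ with $\rho(m\cdot a)=m_{(0)}\cdot a_{(0)}\otimes m_{(1)}a_{(1)}$; morphisms are both $A$-linear and $H$-colinear. For a right $(B,\beta|_B)$-Hom-module $(M,\mu)$ and a left one $(N,\nu)$, $M\otimes_BN$ is the quotient of $M\otimes N$ by the span of all $m\cdot b\otimes\nu(n)-\mu(m)\otimes b\cdot n$, with automorphism $\mu\otimes\nu$. $F(M)=M\otimes_BA$ has action $(m\otimes a)\cdot b=\mu(m)\otimes a\beta^{-1}(b)$ and coaction $m\otimes a\mapsto(\mu^{-1}(m)\otimes a_{(0)})\otimes\alpha(a_{(1)})$. $G(N)=N^{coH}$ is a right $(B,\beta|_B)$-Hom-module by restriction. $F$ is left adjoint to $G$, with unit $\eta_M(m)=\mu^{-1}(m)\otimes1_A$ and counit $\epsilon_N(n\otimes a)=n\cdot a$; "pair of inverse equivalences" means all $\eta_M$ and $\epsilon_N$ are isomorphisms. *)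

theory Defs
  imports "HOL-Algebra.Module" "HOL-Algebra.AbelCoset"
begin

text \<open>
  A vector space over the field \<open>R\<close> is a module in the sense of \<^locale>\<open>module\<close>. The \<open>mult\<close> and
  \<open>one\<close> fields of the record are used only for objects that are algebras; on all other spaces
  they carry no information and are never mentioned.
\<close>

section \<open>Linear and bilinear maps\<close>

definition linear_on ::
  "('k, 'r) ring_scheme \<Rightarrow> ('k, 'm, 'x) module_scheme \<Rightarrow> ('k, 'n, 'y) module_scheme
    \<Rightarrow> ('m \<Rightarrow> 'n) \<Rightarrow> bool" where
  "linear_on R M N f \<longleftrightarrow>
     f \<in> carrier M \<rightarrow> carrier N \<and>
     (\<forall>x\<in>carrier M. \<forall>y\<in>carrier M. f (x \<oplus>\<^bsub>M\<^esub> y) = f x \<oplus>\<^bsub>N\<^esub> f y) \<and>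
     (\<forall>r\<in>carrier R. \<forall>x\<in>carrier M. f (r \<odot>\<^bsub>M\<^esub> x) = r \<odot>\<^bsub>N\<^esub> f x)"

definition bilinear_on ::
  "('k, 'r) ring_scheme \<Rightarrow> ('k, 'm, 'x) module_scheme \<Rightarrow> ('k, 'n, 'y) module_scheme
    \<Rightarrow> ('k, 'p, 'z) module_scheme \<Rightarrow> ('m \<Rightarrow> 'n \<Rightarrow> 'p) \<Rightarrow> bool" where
  "bilinear_on R M N P f \<longleftrightarrow>
     (\<forall>x\<in>carrier M. linear_on R N P (f x)) \<and>
     (\<forall>y\<in>carrier N. linear_on R M P (\<lambda>x. f x y))"

definition scalar_space :: "('k, 'r) ring_scheme \<Rightarrow> ('k, 'k) module" where
  "scalar_space R =
     \<lparr>carrier = carrier R, mult = mult R, one = one R, zero = zero R, add = add R,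
      smult = mult R\<rparr>"

section \<open>Quotients and tensor products\<close>

definition span_of ::
  "('k, 'r) ring_scheme \<Rightarrow> ('k, 'm, 'x) module_scheme \<Rightarrow> 'm set \<Rightarrow> 'm set" where
  "span_of R M X = \<Inter>{K. submodule K R M \<and> X \<subseteq> K}"

definition quotient_space ::
  "('k, 'm, 'x) module_scheme \<Rightarrow> 'm set \<Rightarrow> ('k, 'm set) module" where
  "quotient_space M K =
     \<lparr>carrier = a_rcosets\<^bsub>M\<^esub> K, mult = undefined, one = undefined, zero = K,
      add = (\<lambda>X Y. X <+>\<^bsub>M\<^esub> Y), smult = (\<lambda>r X. \<Union>x\<in>X. K +>\<^bsub>M\<^esub> (r \<odot>\<^bsub>M\<^esub> x))\<rparr>"

definition free_space :: "('k, 'r) ring_scheme \<Rightarrow> 'i set \<Rightarrow> ('k, 'i \<Rightarrow> 'k) module" where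
  "free_space R X =
     \<lparr>carrier = {p. (\<forall>i. p i \<in> carrier R) \<and> finite {i. p i \<noteq> \<zero>\<^bsub>R\<^esub>} \<and> {i. p i \<noteq> \<zero>\<^bsub>R\<^esub>} \<subseteq> X},
      mult = undefined, one = undefined, zero = (\<lambda>i. \<zero>\<^bsub>R\<^esub>),
      add = (\<lambda>p q i. p i \<oplus>\<^bsub>R\<^esub> q i), smult = (\<lambda>r p i. r \<otimes>\<^bsub>R\<^esub> p i)\<rparr>"

definition free_gen :: "('k, 'r) ring_scheme \<Rightarrow> 'i \<Rightarrow> 'i \<Rightarrow> 'k" where
  "free_gen R i = (\<lambda>j. if j = i then \<one>\<^bsub>R\<^esub> else \<zero>\<^bsub>R\<^esub>)"

definition tensor_rels ::
  "('k, 'r) ring_scheme \<Rightarrow> ('k, 'm, 'x) module_scheme \<Rightarrow> ('k, 'n, 'y) module_scheme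
    \<Rightarrow> ('m \<times> 'n \<Rightarrow> 'k) set" where
  "tensor_rels R M N =
     (let W = free_space R (carrier M \<times> carrier N); d = (\<lambda>m n. free_gen R (m, n)) in
        {d (x \<oplus>\<^bsub>M\<^esub> y) n \<ominus>\<^bsub>W\<^esub> (d x n \<oplus>\<^bsub>W\<^esub> d y n) | x y n.
            x \<in> carrier M \<and> y \<in> carrier M \<and> n \<in> carrier N} \<union>
        {d m (x \<oplus>\<^bsub>N\<^esub> y) \<ominus>\<^bsub>W\<^esub> (d m x \<oplus>\<^bsub>W\<^esub> d m y) | m x y.
            m \<in> carrier M \<and> x \<in> carrier N \<and> y \<in> carrier N} \<union>
        {d (r \<odot>\<^bsub>M\<^esub> m) n \<ominus>\<^bsub>W\<^esub> (r \<odot>\<^bsub>W\<^esub> d m n) | r m n.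
            r \<in> carrier R \<and> m \<in> carrier M \<and> n \<in> carrier N} \<union>
        {d m (r \<odot>\<^bsub>N\<^esub> n) \<ominus>\<^bsub>W\<^esub> (r \<odot>\<^bsub>W\<^esub> d m n) | r m n.
            r \<in> carrier R \<and> m \<in> carrier M \<and> n \<in> carrier N})"

definition tensor_ker ::
  "('k, 'r) ring_scheme \<Rightarrow> ('k, 'm, 'x) module_scheme \<Rightarrow> ('k, 'n, 'y) module_scheme
    \<Rightarrow> ('m \<times> 'n \<Rightarrow> 'k) set" where
  "tensor_ker R M N = span_of R (free_space R (carrier M \<times> carrier N)) (tensor_rels R M N)"

definition tensor ::
  "('k, 'r) ring_scheme \<Rightarrow> ('k, 'm, 'x) module_scheme \<Rightarrow> ('k, 'n, 'y) module_scheme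
    \<Rightarrow> ('k, ('m \<times> 'n \<Rightarrow> 'k) set) module" where
  "tensor R M N = quotient_space (free_space R (carrier M \<times> carrier N)) (tensor_ker R M N)"

definition tens ::
  "('k, 'r) ring_scheme \<Rightarrow> ('k, 'm, 'x) module_scheme \<Rightarrow> ('k, 'n, 'y) module_scheme
    \<Rightarrow> 'm \<Rightarrow> 'n \<Rightarrow> ('m \<times> 'n \<Rightarrow> 'k) set" where
  "tens R M N m n =
     tensor_ker R M N +>\<^bsub>free_space R (carrier M \<times> carrier N)\<^esub> free_gen R (m, n)"

text \<open>
  \<open>tlift R M N P f\<close> is the linear map \<open>M \<otimes> N \<rightarrow> P\<close> induced by a bilinear \<open>f\<close>, i.e. the map
  \<open>m \<otimes> n \<mapsto> f m n\<close>, computed on a representative. Applied to a coproduct or a coaction it renders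
  Sweedler notation: \<open>tlift R C C P f (comul C c)\<close> is \<open>f c\<^sub>1 c\<^sub>2\<close> with the sum suppressed. For a
  map that is not bilinear the value depends on the chosen representative.
\<close>

definition tlift ::
  "('k, 'r) ring_scheme \<Rightarrow> ('k, 'm, 'x) module_scheme \<Rightarrow> ('k, 'n, 'y) module_scheme
    \<Rightarrow> ('k, 'p, 'z) module_scheme \<Rightarrow> ('m \<Rightarrow> 'n \<Rightarrow> 'p) \<Rightarrow> ('m \<times> 'n \<Rightarrow> 'k) set \<Rightarrow> 'p" where
  "tlift R M N P f t =
     (let p = (SOME p. p \<in> t) in
        \<Oplus>\<^bsub>P\<^esub>i\<in>{i. p i \<noteq> \<zero>\<^bsub>R\<^esub>}. p i \<odot>\<^bsub>P\<^esub> f (fst i) (snd i))"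

definition tensor_mult ::
  "('k, 'r) ring_scheme \<Rightarrow> ('k, 'm, 'x) module_scheme \<Rightarrow> ('k, 'n, 'y) module_scheme
    \<Rightarrow> ('m \<times> 'n \<Rightarrow> 'k) set \<Rightarrow> ('m \<times> 'n \<Rightarrow> 'k) set \<Rightarrow> ('m \<times> 'n \<Rightarrow> 'k) set" where
  "tensor_mult R M N s t =
     tlift R M N (tensor R M N)
       (\<lambda>m n. tlift R M N (tensor R M N)
          (\<lambda>m' n'. tens R M N (m \<otimes>\<^bsub>M\<^esub> m') (n \<otimes>\<^bsub>N\<^esub> n')) t) s"

section \<open>Monoidal Hom-structures\<close>

record ('k, 'm) hom_space = "('k, 'm) module" +
  twist :: "'m \<Rightarrow> 'm"

definition twist_inv :: "('k, 'm, 'x) hom_space_scheme \<Rightarrow> 'm \<Rightarrow> 'm" where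
  "twist_inv M = inv_into (carrier M) (twist M)"

definition is_hom_space ::
  "('k, 'r) ring_scheme \<Rightarrow> ('k, 'm, 'x) hom_space_scheme \<Rightarrow> bool" where
  "is_hom_space R M \<longleftrightarrow>
     module R M \<and> linear_on R M M (twist M) \<and> bij_betw (twist M) (carrier M) (carrier M)"

definition hom_morphism ::
  "('k, 'r) ring_scheme \<Rightarrow> ('k, 'm, 'x) hom_space_scheme \<Rightarrow> ('k, 'n, 'y) hom_space_scheme
    \<Rightarrow> ('m \<Rightarrow> 'n) \<Rightarrow> bool" where
  "hom_morphism R M N f \<longleftrightarrow>
     linear_on R M N f \<and> (\<forall>m\<in>carrier M. twist N (f m) = f (twist M m))"

definition hom_algebra ::
  "('k, 'r) ring_scheme \<Rightarrow> ('k, 'a, 'x) hom_space_scheme \<Rightarrow> bool" where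
  "hom_algebra R A \<longleftrightarrow>
     is_hom_space R A \<and>
     bilinear_on R A A A (mult A) \<and> \<one>\<^bsub>A\<^esub> \<in> carrier A \<and>
     (\<forall>a\<in>carrier A. \<forall>b\<in>carrier A. \<forall>c\<in>carrier A.
        twist A a \<otimes>\<^bsub>A\<^esub> (b \<otimes>\<^bsub>A\<^esub> c) = (a \<otimes>\<^bsub>A\<^esub> b) \<otimes>\<^bsub>A\<^esub> twist A c) \<and>
     (\<forall>a\<in>carrier A. a \<otimes>\<^bsub>A\<^esub> \<one>\<^bsub>A\<^esub> = twist A a \<and> \<one>\<^bsub>A\<^esub> \<otimes>\<^bsub>A\<^esub> a = twist A a) \<and>
     (\<forall>a\<in>carrier A. \<forall>b\<in>carrier A. twist A (a \<otimes>\<^bsub>A\<^esub> b) = twist A a \<otimes>\<^bsub>A\<^esub> twist A b) \<and>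
     twist A \<one>\<^bsub>A\<^esub> = \<one>\<^bsub>A\<^esub>"

record ('k, 'c) hom_coalg = "('k, 'c) hom_space" +
  comul :: "'c \<Rightarrow> ('c \<times> 'c \<Rightarrow> 'k) set"
  counit :: "'c \<Rightarrow> 'k"

text \<open>
  Hom-coassociativity is an equation in \<open>C \<otimes> (C \<otimes> C)\<close>; the right-hand side
  \<open>\<Delta>(c\<^sub>1) \<otimes> \<gamma>\<^sup>-\<^sup>1(c\<^sub>2)\<close> is moved there along \<open>(x \<otimes> y) \<otimes> z \<mapsto> x \<otimes> (y \<otimes> z)\<close>.
\<close>

definition hom_coalgebra ::
  "('k, 'r) ring_scheme \<Rightarrow> ('k, 'c, 'x) hom_coalg_scheme \<Rightarrow> bool" where
  "hom_coalgebra R C \<longleftrightarrow>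
     is_hom_space R C \<and>
     linear_on R C (tensor R C C) (comul C) \<and>
     linear_on R C (scalar_space R) (counit C) \<and>
     (\<forall>c\<in>carrier C.
        tlift R C C (tensor R C (tensor R C C))
          (\<lambda>c1 c2. tens R C (tensor R C C) (twist_inv C c1) (comul C c2)) (comul C c) =
        tlift R C C (tensor R C (tensor R C C))
          (\<lambda>c1 c2. tlift R C C (tensor R C (tensor R C C))
             (\<lambda>x y. tens R C (tensor R C C) x (tens R C C y (twist_inv C c2))) (comul C c1))
          (comul C c)) \<and>
     (\<forall>c\<in>carrier C.
        tlift R C C C (\<lambda>c1 c2. counit C c2 \<odot>\<^bsub>C\<^esub> c1) (comul C c) = twist_inv C c \<and>
        tlift R C C C (\<lambda>c1 c2. counit C c1 \<odot>\<^bsub>C\<^esub> c2) (comul C c) = twist_inv C c) \<and>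
     (\<forall>c\<in>carrier C.
        comul C (twist C c) =
        tlift R C C (tensor R C C) (\<lambda>c1 c2. tens R C C (twist C c1) (twist C c2)) (comul C c)) \<and>
     (\<forall>c\<in>carrier C. counit C (twist C c) = counit C c)"

record ('k, 'h) hom_hopf = "('k, 'h) hom_coalg" +
  antipode :: "'h \<Rightarrow> 'h"

definition hom_hopf_algebra ::
  "('k, 'r) ring_scheme \<Rightarrow> ('k, 'h, 'x) hom_hopf_scheme \<Rightarrow> bool" where
  "hom_hopf_algebra R H \<longleftrightarrow>
     hom_algebra R H \<and> hom_coalgebra R H \<and>
     (\<forall>g\<in>carrier H. \<forall>h\<in>carrier H.
        comul H (g \<otimes>\<^bsub>H\<^esub> h) = tensor_mult R H H (comul H g) (comul H h)) \<and>
     comul H \<one>\<^bsub>H\<^esub> = tens R H H \<one>\<^bsub>H\<^esub> \<one>\<^bsub>H\<^esub> \<and>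
     (\<forall>g\<in>carrier H. \<forall>h\<in>carrier H.
        counit H (g \<otimes>\<^bsub>H\<^esub> h) = counit H g \<otimes>\<^bsub>R\<^esub> counit H h) \<and>
     counit H \<one>\<^bsub>H\<^esub> = \<one>\<^bsub>R\<^esub> \<and>
     hom_morphism R H H (antipode H) \<and>
     (\<forall>h\<in>carrier H.
        tlift R H H H (\<lambda>h1 h2. antipode H h1 \<otimes>\<^bsub>H\<^esub> h2) (comul H h) = counit H h \<odot>\<^bsub>H\<^esub> \<one>\<^bsub>H\<^esub> \<and>
        tlift R H H H (\<lambda>h1 h2. h1 \<otimes>\<^bsub>H\<^esub> antipode H h2) (comul H h) = counit H h \<odot>\<^bsub>H\<^esub> \<one>\<^bsub>H\<^esub>)"

definition right_hom_module ::
  "('k, 'r) ring_scheme \<Rightarrow> ('k, 'a, 'x) hom_space_scheme \<Rightarrow> ('k, 'm, 'y) hom_space_scheme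
    \<Rightarrow> ('m \<Rightarrow> 'a \<Rightarrow> 'm) \<Rightarrow> bool" where
  "right_hom_module R A M ac \<longleftrightarrow>
     is_hom_space R M \<and>
     bilinear_on R M A M ac \<and>
     (\<forall>m\<in>carrier M. \<forall>a\<in>carrier A. \<forall>b\<in>carrier A.
        ac (ac m a) (twist A b) = ac (twist M m) (a \<otimes>\<^bsub>A\<^esub> b)) \<and>
     (\<forall>m\<in>carrier M. ac m \<one>\<^bsub>A\<^esub> = twist M m) \<and>
     (\<forall>m\<in>carrier M. \<forall>a\<in>carrier A. twist M (ac m a) = ac (twist M m) (twist A a))"

text \<open>Here the coassociativity equation is read in \<open>M \<otimes> (H \<otimes> H)\<close>.\<close>

definition right_hom_comodule ::
  "('k, 'r) ring_scheme \<Rightarrow> ('k, 'h, 'x) hom_coalg_scheme \<Rightarrow> ('k, 'm, 'y) hom_space_scheme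
    \<Rightarrow> ('m \<Rightarrow> ('m \<times> 'h \<Rightarrow> 'k) set) \<Rightarrow> bool" where
  "right_hom_comodule R H M \<rho> \<longleftrightarrow>
     is_hom_space R M \<and>
     linear_on R M (tensor R M H) \<rho> \<and>
     (\<forall>m\<in>carrier M.
        tlift R M H (tensor R M (tensor R H H))
          (\<lambda>m0 m1. tens R M (tensor R H H) (twist_inv M m0) (comul H m1)) (\<rho> m) =
        tlift R M H (tensor R M (tensor R H H))
          (\<lambda>m0 m1. tlift R M H (tensor R M (tensor R H H))
             (\<lambda>m00 m01. tens R M (tensor R H H) m00 (tens R H H m01 (twist_inv H m1))) (\<rho> m0))
          (\<rho> m)) \<and>
     (\<forall>m\<in>carrier M.
        tlift R M H M (\<lambda>m0 m1. counit H m1 \<odot>\<^bsub>M\<^esub> m0) (\<rho> m) = twist_inv M m) \<and>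
     (\<forall>m\<in>carrier M.
        \<rho> (twist M m) =
        tlift R M H (tensor R M H) (\<lambda>m0 m1. tens R M H (twist M m0) (twist H m1)) (\<rho> m))"

definition coinvariants ::
  "('k, 'r) ring_scheme \<Rightarrow> ('k, 'h, 'x) hom_coalg_scheme \<Rightarrow> ('k, 'm, 'y) hom_space_scheme
    \<Rightarrow> ('m \<Rightarrow> ('m \<times> 'h \<Rightarrow> 'k) set) \<Rightarrow> 'm set" where
  "coinvariants R H M \<rho> = {m \<in> carrier M. \<rho> m = tens R M H (twist_inv M m) \<one>\<^bsub>H\<^esub>}"

definition hom_colinear ::
  "('k, 'r) ring_scheme \<Rightarrow> ('k, 'h, 'x) hom_coalg_scheme
    \<Rightarrow> ('k, 'm, 'y) hom_space_scheme \<Rightarrow> ('m \<Rightarrow> ('m \<times> 'h \<Rightarrow> 'k) set)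
    \<Rightarrow> ('k, 'n, 'z) hom_space_scheme \<Rightarrow> ('n \<Rightarrow> ('n \<times> 'h \<Rightarrow> 'k) set) \<Rightarrow> ('m \<Rightarrow> 'n) \<Rightarrow> bool" where
  "hom_colinear R H M \<rho> N \<sigma> f \<longleftrightarrow>
     hom_morphism R M N f \<and>
     (\<forall>m\<in>carrier M.
        \<sigma> (f m) = tlift R M H (tensor R N H) (\<lambda>m0 m1. tens R N H (f m0) m1) (\<rho> m))"

section \<open>Comodule algebras\<close>

record ('k, 'a, 'h) comod_alg = "('k, 'a) hom_space" +
  alg_coact :: "'a \<Rightarrow> ('a \<times> 'h \<Rightarrow> 'k) set"

definition hom_comodule_algebra ::
  "('k, 'r) ring_scheme \<Rightarrow> ('k, 'h, 'x) hom_coalg_scheme \<Rightarrow> ('k, 'a, 'h, 'y) comod_alg_scheme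
    \<Rightarrow> bool" where
  "hom_comodule_algebra R H A \<longleftrightarrow>
     hom_algebra R A \<and> right_hom_comodule R H A (alg_coact A) \<and>
     (\<forall>a\<in>carrier A. \<forall>b\<in>carrier A.
        alg_coact A (a \<otimes>\<^bsub>A\<^esub> b) = tensor_mult R A H (alg_coact A a) (alg_coact A b)) \<and>
     alg_coact A \<one>\<^bsub>A\<^esub> = tens R A H \<one>\<^bsub>A\<^esub> \<one>\<^bsub>H\<^esub>"

definition coinv_alg ::
  "('k, 'r) ring_scheme \<Rightarrow> ('k, 'h, 'x) hom_coalg_scheme \<Rightarrow> ('k, 'a, 'h, 'y) comod_alg_scheme
    \<Rightarrow> ('k, 'a) hom_space" where
  "coinv_alg R H A = hom_space.truncate (A\<lparr>carrier := coinvariants R H A (alg_coact A)\<rparr>)"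

definition total_integral ::
  "('k, 'r) ring_scheme \<Rightarrow> ('k, 'h, 'x) hom_coalg_scheme \<Rightarrow> ('k, 'a, 'h, 'y) comod_alg_scheme
    \<Rightarrow> ('h \<Rightarrow> 'a) \<Rightarrow> bool" where
  "total_integral R H A \<phi> \<longleftrightarrow>
     hom_colinear R H H (comul H) A (alg_coact A) \<phi> \<and> \<phi> \<one>\<^bsub>H\<^esub> = \<one>\<^bsub>A\<^esub>"

section \<open>Tensor products over a Hom-algebra\<close>

text \<open>
  \<open>M \<otimes>\<^sub>B N\<close> for a right action \<open>ra\<close> of \<open>B\<close> on \<open>M\<close> and a left action \<open>la\<close> of \<open>B\<close> on \<open>N\<close>.
\<close>

definition btensor_ker ::
  "('k, 'r) ring_scheme \<Rightarrow> ('k, 'b, 'w) hom_space_scheme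
    \<Rightarrow> ('k, 'm, 'x) hom_space_scheme \<Rightarrow> ('m \<Rightarrow> 'b \<Rightarrow> 'm)
    \<Rightarrow> ('k, 'n, 'y) hom_space_scheme \<Rightarrow> ('b \<Rightarrow> 'n \<Rightarrow> 'n) \<Rightarrow> ('m \<times> 'n \<Rightarrow> 'k) set set" where
  "btensor_ker R B M ra N la =
     span_of R (tensor R M N)
       {tens R M N (ra m b) (twist N n) \<ominus>\<^bsub>tensor R M N\<^esub> tens R M N (twist M m) (la b n) | m b n.
          m \<in> carrier M \<and> b \<in> carrier B \<and> n \<in> carrier N}"

definition btensor ::
  "('k, 'r) ring_scheme \<Rightarrow> ('k, 'b, 'w) hom_space_scheme
    \<Rightarrow> ('k, 'm, 'x) hom_space_scheme \<Rightarrow> ('m \<Rightarrow> 'b \<Rightarrow> 'm)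
    \<Rightarrow> ('k, 'n, 'y) hom_space_scheme \<Rightarrow> ('b \<Rightarrow> 'n \<Rightarrow> 'n)
    \<Rightarrow> ('k, ('m \<times> 'n \<Rightarrow> 'k) set set) module" where
  "btensor R B M ra N la = quotient_space (tensor R M N) (btensor_ker R B M ra N la)"

definition btens ::
  "('k, 'r) ring_scheme \<Rightarrow> ('k, 'b, 'w) hom_space_scheme
    \<Rightarrow> ('k, 'm, 'x) hom_space_scheme \<Rightarrow> ('m \<Rightarrow> 'b \<Rightarrow> 'm)
    \<Rightarrow> ('k, 'n, 'y) hom_space_scheme \<Rightarrow> ('b \<Rightarrow> 'n \<Rightarrow> 'n)
    \<Rightarrow> 'm \<Rightarrow> 'n \<Rightarrow> ('m \<times> 'n \<Rightarrow> 'k) set set" where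
  "btens R B M ra N la m n = btensor_ker R B M ra N la +>\<^bsub>tensor R M N\<^esub> tens R M N m n"

text \<open>
  The linear map \<open>m \<otimes>\<^sub>B n \<mapsto> f m n\<close>, again computed on a representative; it is meaningful for
  those bilinear \<open>f\<close> whose induced map on \<open>M \<otimes> N\<close> vanishes on \<^const>\<open>btensor_ker\<close>.
\<close>

definition blift ::
  "('k, 'r) ring_scheme \<Rightarrow> ('k, 'm, 'x) module_scheme \<Rightarrow> ('k, 'n, 'y) module_scheme
    \<Rightarrow> ('k, 'p, 'z) module_scheme \<Rightarrow> ('m \<Rightarrow> 'n \<Rightarrow> 'p) \<Rightarrow> ('m \<times> 'n \<Rightarrow> 'k) set set \<Rightarrow> 'p" where
  "blift R M N P f u = tlift R M N P f (SOME t. t \<in> u)"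

definition can ::
  "('k, 'r) ring_scheme \<Rightarrow> ('k, 'h, 'x) hom_coalg_scheme \<Rightarrow> ('k, 'a, 'h, 'y) comod_alg_scheme
    \<Rightarrow> ('a \<times> 'a \<Rightarrow> 'k) set set \<Rightarrow> ('a \<times> 'h \<Rightarrow> 'k) set" where
  "can R H A =
     blift R A A (tensor R A H)
       (\<lambda>a b. tlift R A H (tensor R A H)
          (\<lambda>b0 b1. tens R A H (twist_inv A a \<otimes>\<^bsub>A\<^esub> b0) (twist H b1)) (alg_coact A b))"

section \<open>The two categories\<close>

record ('k, 'm, 'a) hom_rmod = "('k, 'm) hom_space" +
  act :: "'m \<Rightarrow> 'a \<Rightarrow> 'm"

definition rmod_obj ::
  "('k, 'r) ring_scheme \<Rightarrow> ('k, 'b, 'w) hom_space_scheme \<Rightarrow> ('k, 'm, 'b, 'x) hom_rmod_scheme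
    \<Rightarrow> bool" where
  "rmod_obj R B M \<longleftrightarrow> right_hom_module R B M (act M)"

definition rmod_mor ::
  "('k, 'r) ring_scheme \<Rightarrow> ('k, 'b, 'w) hom_space_scheme \<Rightarrow> ('k, 'm, 'b, 'x) hom_rmod_scheme
    \<Rightarrow> ('k, 'n, 'b, 'y) hom_rmod_scheme \<Rightarrow> ('m \<Rightarrow> 'n) \<Rightarrow> bool" where
  "rmod_mor R B M N f \<longleftrightarrow>
     rmod_obj R B M \<and> rmod_obj R B N \<and>
     hom_morphism R M N f \<and>
     (\<forall>m\<in>carrier M. \<forall>b\<in>carrier B. f (act M m b) = act N (f m) b)"

definition rmod_iso ::
  "('k, 'r) ring_scheme \<Rightarrow> ('k, 'b, 'w) hom_space_scheme \<Rightarrow> ('k, 'm, 'b, 'x) hom_rmod_scheme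
    \<Rightarrow> ('k, 'n, 'b, 'y) hom_rmod_scheme \<Rightarrow> ('m \<Rightarrow> 'n) \<Rightarrow> bool" where
  "rmod_iso R B M N f \<longleftrightarrow>
     rmod_mor R B M N f \<and>
     (\<exists>g. rmod_mor R B N M g \<and>
        (\<forall>m\<in>carrier M. g (f m) = m) \<and> (\<forall>n\<in>carrier N. f (g n) = n))"

record ('k, 'm, 'a, 'h) hopf_mod = "('k, 'm, 'a) hom_rmod" +
  coact :: "'m \<Rightarrow> ('m \<times> 'h \<Rightarrow> 'k) set"

definition hopf_mod_obj ::
  "('k, 'r) ring_scheme \<Rightarrow> ('k, 'h, 'w) hom_coalg_scheme \<Rightarrow> ('k, 'a, 'h, 'x) comod_alg_scheme
    \<Rightarrow> ('k, 'm, 'a, 'h, 'y) hopf_mod_scheme \<Rightarrow> bool" where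
  "hopf_mod_obj R H A M \<longleftrightarrow>
     rmod_obj R A M \<and> right_hom_comodule R H M (coact M) \<and>
     (\<forall>m\<in>carrier M. \<forall>a\<in>carrier A.
        coact M (act M m a) =
        tlift R M H (tensor R M H)
          (\<lambda>m0 m1. tlift R A H (tensor R M H)
             (\<lambda>a0 a1. tens R M H (act M m0 a0) (m1 \<otimes>\<^bsub>H\<^esub> a1)) (alg_coact A a))
          (coact M m))"

definition hopf_mod_mor ::
  "('k, 'r) ring_scheme \<Rightarrow> ('k, 'h, 'w) hom_coalg_scheme \<Rightarrow> ('k, 'a, 'h, 'x) comod_alg_scheme
    \<Rightarrow> ('k, 'm, 'a, 'h, 'y) hopf_mod_scheme \<Rightarrow> ('k, 'n, 'a, 'h, 'z) hopf_mod_scheme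
    \<Rightarrow> ('m \<Rightarrow> 'n) \<Rightarrow> bool" where
  "hopf_mod_mor R H A M N f \<longleftrightarrow>
     hopf_mod_obj R H A M \<and> hopf_mod_obj R H A N \<and>
     rmod_mor R A M N f \<and> hom_colinear R H M (coact M) N (coact N) f"

definition hopf_mod_iso ::
  "('k, 'r) ring_scheme \<Rightarrow> ('k, 'h, 'w) hom_coalg_scheme \<Rightarrow> ('k, 'a, 'h, 'x) comod_alg_scheme
    \<Rightarrow> ('k, 'm, 'a, 'h, 'y) hopf_mod_scheme \<Rightarrow> ('k, 'n, 'a, 'h, 'z) hopf_mod_scheme
    \<Rightarrow> ('m \<Rightarrow> 'n) \<Rightarrow> bool" where
  "hopf_mod_iso R H A M N f \<longleftrightarrow>
     hopf_mod_mor R H A M N f \<and>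
     (\<exists>g. hopf_mod_mor R H A N M g \<and>
        (\<forall>m\<in>carrier M. g (f m) = m) \<and> (\<forall>n\<in>carrier N. f (g n) = n))"

section \<open>The adjoint pair\<close>

definition functor_F ::
  "('k, 'r) ring_scheme \<Rightarrow> ('k, 'h, 'w) hom_coalg_scheme \<Rightarrow> ('k, 'a, 'h, 'x) comod_alg_scheme
    \<Rightarrow> ('k, 'm, 'a, 'y) hom_rmod_scheme
    \<Rightarrow> ('k, ('m \<times> 'a \<Rightarrow> 'k) set set, 'a, 'h) hopf_mod" where
  "functor_F R H A M =
     (let B = coinv_alg R H A;
          Q = btensor R B M (act M) A (mult A);
          bt = btens R B M (act M) A (mult A)
      in \<lparr>carrier = carrier Q, mult = undefined, one = undefined, zero = zero Q, add = add Q,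
          smult = smult Q,
          twist = blift R M A Q (\<lambda>m a. bt (twist M m) (twist A a)),
          act = (\<lambda>u b. blift R M A Q (\<lambda>m a. bt (twist M m) (a \<otimes>\<^bsub>A\<^esub> twist_inv A b)) u),
          coact = blift R M A (tensor R Q H)
            (\<lambda>m a. tlift R A H (tensor R Q H)
               (\<lambda>a0 a1. tens R Q H (bt (twist_inv M m) a0) (twist H a1)) (alg_coact A a))\<rparr>)"

definition functor_G ::
  "('k, 'r) ring_scheme \<Rightarrow> ('k, 'h, 'w) hom_coalg_scheme
    \<Rightarrow> ('k, 'n, 'a, 'h, 'y) hopf_mod_scheme \<Rightarrow> ('k, 'n, 'a) hom_rmod" where
  "functor_G R H N = hom_rmod.truncate (N\<lparr>carrier := coinvariants R H N (coact N)\<rparr>)"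

definition adj_unit ::
  "('k, 'r) ring_scheme \<Rightarrow> ('k, 'h, 'w) hom_coalg_scheme \<Rightarrow> ('k, 'a, 'h, 'x) comod_alg_scheme
    \<Rightarrow> ('k, 'm, 'a, 'y) hom_rmod_scheme \<Rightarrow> 'm \<Rightarrow> ('m \<times> 'a \<Rightarrow> 'k) set set" where
  "adj_unit R H A M m =
     btens R (coinv_alg R H A) M (act M) A (mult A) (twist_inv M m) \<one>\<^bsub>A\<^esub>"

definition adj_counit ::
  "('k, 'r) ring_scheme \<Rightarrow> ('k, 'h, 'w) hom_coalg_scheme \<Rightarrow> ('k, 'a, 'h, 'x) comod_alg_scheme
    \<Rightarrow> ('k, 'n, 'a, 'h, 'y) hopf_mod_scheme \<Rightarrow> ('n \<times> 'a \<Rightarrow> 'k) set set \<Rightarrow> 'n" where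
  "adj_counit R H A N = blift R (functor_G R H N) A N (act N)"

end

theory Submission
  imports Defs
begin

text \<open>
  The twists can be removed: if \<open>\<beta>\<close> is the automorphism of a monoidal Hom-algebra, then
  \<open>\<beta>\<^sup>-\<^sup>1(ab)\<close> is an ordinary associative product, and in the same way \<open>\<Delta>\<alpha>\<close>, \<open>\<rho>\<mu>\<close> and
  \<open>\<mu>\<^sup>-\<^sup>1(m\<cdot>a)\<close> are an ordinary coproduct, coaction and action; \<open>\<epsilon>\<close>, \<open>S\<close> and the total integral
  \<open>\<phi>\<close> do not change. Below, \<open>S'\<close> is the inverse of \<open>S\<close>.

  In the untwisted setting put \<open>tr(n, a) = n\<^sub>0 \<phi>(S(n\<^sub>1) S'(a\<^sub>1)) a\<^sub>0\<close> for \<open>n\<close> in a Hopf module and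
  \<open>a\<close> in \<open>A\<close>; this element is coinvariant. Since \<open>k\<close> is a field, the surjection \<open>can\<close> has a linear
  section, which gives a linear \<open>\<sigma> : H \<rightarrow> A \<otimes> A\<close>, written \<open>\<sigma>(h) = r(h) \<otimes> l(h)\<close>, with
  \<open>r(h) l(h)\<^sub>0 \<otimes> l(h)\<^sub>1 = 1 \<otimes> h\<close>, equivalently \<open>r(h)\<^sub>0 l(h) \<otimes> S'(r(h)\<^sub>1) = 1 \<otimes> h\<close>. The second form
  yields \<open>n = tr(n\<^sub>0, r(n\<^sub>1)) l(n\<^sub>1)\<close>, so that \<open>n \<mapsto> tr(n\<^sub>0, r(n\<^sub>1)) \<otimes>\<^sub>B l(n\<^sub>1)\<close> inverts the counit
      of
  the adjunction. It is inverse on both sides because \<open>tr(na, b) = n tr(a, b)\<close> for coinvariant \<open>n\<close>.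
  The unit is inverted by \<open>m \<otimes> a \<mapsto> m tr(a, 1)\<close>.
\<close>

section \<open>Linear maps\<close>

text \<open>Coinvariance dictates the order of the factors in \<open>tr\<close> and the use of both
  antipodes. Coacting puts \<open>n\<^sub>1\<close> at the left end and \<open>a\<^sub>1\<close> at
  the right end of the \<open>H\<close>-component. The first is cancelled by
  \<open>h\<^sub>1 S(h\<^sub>2) = \<epsilon>(h) 1\<close>; the second needs a factor on its left,
  and the law of that shape is \<open>S'(h\<^sub>2) h\<^sub>1 = \<epsilon>(h) 1\<close>. Both
  antipodes stand under a single \<phi>, which is colinear but not assumed multiplicative. For
  \<open>a = 1\<close> one gets the classical trace \<open>n\<^sub>0 \<phi>(S(n\<^sub>1))\<close>;
  the second argument is there to absorb the left leg of \<sigma>. Only identities between elements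
  are untwisted. \<open>F\<close>, \<open>G\<close> and the quotient over \<open>B\<close> keep
  their twists; the two settings meet in the coinvariants, which are the same in both, and in the
  balancing relation.\<close>

lemma linear_onI [intro?]:
  assumes "\<And>x. x \<in> carrier M \<Longrightarrow> f x \<in> carrier N"
    and "\<And>x y. x \<in> carrier M \<Longrightarrow> y \<in> carrier M \<Longrightarrow> f (x \<oplus>\<^bsub>M\<^esub> y) = f x \<oplus>\<^bsub>N\<^esub> f y"
    and "\<And>r x. r \<in> carrier R \<Longrightarrow> x \<in> carrier M \<Longrightarrow> f (r \<odot>\<^bsub>M\<^esub> x) = r \<odot>\<^bsub>N\<^esub> f x"
  shows "linear_on R M N f"
  using assms by (auto simp: linear_on_def)

lemma linear_onD:
  assumes "linear_on R M N f"
  shows linear_on_closed: "x \<in> carrier M \<Longrightarrow> f x \<in> carrier N"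
    and linear_on_add: "x \<in> carrier M \<Longrightarrow> y \<in> carrier M \<Longrightarrow> f (x \<oplus>\<^bsub>M\<^esub> y) = f x \<oplus>\<^bsub>N\<^esub> f y"
    and linear_on_scale: "r \<in> carrier R \<Longrightarrow> x \<in> carrier M \<Longrightarrow> f (r \<odot>\<^bsub>M\<^esub> x) = r \<odot>\<^bsub>N\<^esub> f x"
  using assms by (auto simp: linear_on_def)

lemma bilinear_onI [intro?]:
  assumes "\<And>x. x \<in> carrier M \<Longrightarrow> linear_on R N P (\<lambda>y. f x y)"
    and "\<And>y. y \<in> carrier N \<Longrightarrow> linear_on R M P (\<lambda>x. f x y)"
  shows "bilinear_on R M N P f"
  using assms by (auto simp: bilinear_on_def)

lemma bilinear_onD:
  assumes "bilinear_on R M N P f"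
  shows bilinear_on_right: "x \<in> carrier M \<Longrightarrow> linear_on R N P (f x)"
    and bilinear_on_left: "y \<in> carrier N \<Longrightarrow> linear_on R M P (\<lambda>x. f x y)"
    and bilinear_on_closed: "x \<in> carrier M \<Longrightarrow> y \<in> carrier N \<Longrightarrow> f x y \<in> carrier P"
  using assms by (auto simp: bilinear_on_def linear_on_def)

lemma linear_on_id: "linear_on R M M (\<lambda>x. x)"
  by (rule linear_onI) auto

lemma linear_on_comp:
  assumes "linear_on R N P g" "linear_on R M N f"
  shows "linear_on R M P (\<lambda>x. g (f x))"
  using assms by (auto simp: linear_on_def Pi_iff)

lemma linear_on_zero:
  assumes "module R M" "module R N" "linear_on R M N f"
  shows "f \<zero>\<^bsub>M\<^esub> = \<zero>\<^bsub>N\<^esub>"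
proof -
  interpret M: module R M by fact
  interpret N: module R N by fact
  have "f \<zero>\<^bsub>M\<^esub> = f (\<zero>\<^bsub>R\<^esub> \<odot>\<^bsub>M\<^esub> \<zero>\<^bsub>M\<^esub>)" by simp
  also have "\<dots> = \<zero>\<^bsub>R\<^esub> \<odot>\<^bsub>N\<^esub> f \<zero>\<^bsub>M\<^esub>"
    using assms(3) by (intro linear_on_scale) auto
  also have "\<dots> = \<zero>\<^bsub>N\<^esub>" using linear_on_closed[OF assms(3)] by simp
  finally show ?thesis .
qed

lemma linear_on_neg:
  assumes "module R M" "module R N" "linear_on R M N f" "x \<in> carrier M"
  shows "f (\<ominus>\<^bsub>M\<^esub> x) = \<ominus>\<^bsub>N\<^esub> f x"
proof -
  interpret M: module R M by fact
  interpret N: module R N by fact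
  note [simp] = linear_on_closed[OF assms(3)] assms(4)
  have "f (\<ominus>\<^bsub>M\<^esub> x) \<oplus>\<^bsub>N\<^esub> f x = f (\<ominus>\<^bsub>M\<^esub> x \<oplus>\<^bsub>M\<^esub> x)"
    using linear_on_add[OF assms(3), of "\<ominus>\<^bsub>M\<^esub> x" x] by simp
  also have "\<dots> = \<zero>\<^bsub>N\<^esub>" using linear_on_zero[OF assms(1-3)] by (simp add: M.l_neg)
  finally show ?thesis by (metis N.add.inv_equality M.add.inv_closed assms(4)
      linear_on_closed[OF assms(3)])
qed

lemma minus_eq_zero_iff:
  assumes "module R M" "x \<in> carrier M" "y \<in> carrier M"
  shows "x \<ominus>\<^bsub>M\<^esub> y = \<zero>\<^bsub>M\<^esub> \<longleftrightarrow> x = y"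
proof -
  interpret M: module R M by fact
  show ?thesis using assms(2,3)
    by (metis M.add.inv_closed M.add.inv_equality M.add.inv_inv M.r_neg a_minus_def)
qed

lemma linear_on_minus:
  assumes "module R M" "module R N" "linear_on R M N f" "x \<in> carrier M" "y \<in> carrier M"
  shows "f (x \<ominus>\<^bsub>M\<^esub> y) = f x \<ominus>\<^bsub>N\<^esub> f y"
proof -
  interpret M: module R M by fact
  show ?thesis using assms(4,5) linear_on_neg[OF assms(1-3)] linear_on_add[OF assms(3)]
    by (simp add: a_minus_def)
qed

lemma linear_on_finsum:
  assumes "module R M" "module R N" "linear_on R M N f" "finite I" "g \<in> I \<rightarrow> carrier M"
  shows "f (finsum M g I) = finsum N (\<lambda>i. f (g i)) I"
proof -
  interpret M: module R M by fact
  interpret N: module R N by fact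
  from assms(4,5) show ?thesis
  proof (induction I rule: finite_induct)
    case empty
    then show ?case using linear_on_zero[OF assms(1-3)] by simp
  next
    case (insert i I)
    then have "f (g i \<oplus>\<^bsub>M\<^esub> finsum M g I) = f (g i) \<oplus>\<^bsub>N\<^esub> f (finsum M g I)"
      by (intro linear_on_add[OF assms(3)]) auto
    moreover have "(\<lambda>i. f (g i)) \<in> I \<rightarrow> carrier N" "f (g i) \<in> carrier N"
      using insert.prems linear_on_closed[OF assms(3)] by auto
    ultimately show ?case using insert by simp
  qed
qed

lemma linear_on_smult:
  assumes "linear_on R M N f" "r \<in> carrier R" "module R N"
  shows "linear_on R M N (\<lambda>x. r \<odot>\<^bsub>N\<^esub> f x)"
proof -
  interpret N: module R N by fact
  show ?thesis
  proof
    fix s x assume "s \<in> carrier R" "x \<in> carrier M"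
    then show "r \<odot>\<^bsub>N\<^esub> f (s \<odot>\<^bsub>M\<^esub> x) = s \<odot>\<^bsub>N\<^esub> (r \<odot>\<^bsub>N\<^esub> f x)"
      using assms by (metis linear_on_closed linear_on_scale N.smult_assoc1 N.R.m_comm)
  qed (use assms in \<open>auto simp: linear_onD N.smult_r_distr\<close>)
qed

lemma linear_on_smult_left:
  assumes "linear_on R M (scalar_space R) f" "n \<in> carrier N" "module R N"
  shows "linear_on R M N (\<lambda>x. f x \<odot>\<^bsub>N\<^esub> n)"
proof -
  interpret N: module R N by fact
  have "f x \<in> carrier R" if "x \<in> carrier M" for x
    using linear_on_closed[OF assms(1) that] by (simp add: scalar_space_def)
  then show ?thesis
    using assms(2) linear_on_add[OF assms(1)] linear_on_scale[OF assms(1)]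
    by (intro linear_onI) (auto simp: scalar_space_def N.smult_l_distr N.smult_assoc1)
qed

lemma linear_on_finsum_fun:
  assumes "finite I" "\<And>i. i \<in> I \<Longrightarrow> linear_on R M N (\<lambda>x. f x i)" "module R N"
  shows "linear_on R M N (\<lambda>x. finsum N (f x) I)"
proof -
  interpret N: module R N by fact
  have cl: "f x \<in> I \<rightarrow> carrier N" if "x \<in> carrier M" for x
    using linear_on_closed[OF assms(2) that] by auto
  show ?thesis
  proof
    fix x y assume xy: "x \<in> carrier M" "y \<in> carrier M"
    have "finsum N (f (x \<oplus>\<^bsub>M\<^esub> y)) I = finsum N (\<lambda>i. f x i \<oplus>\<^bsub>N\<^esub> f y i) I"
      using cl xy by (intro N.finsum_cong') (auto simp: linear_on_add[OF assms(2)] Pi_iff)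
    then show "finsum N (f (x \<oplus>\<^bsub>M\<^esub> y)) I = finsum N (f x) I \<oplus>\<^bsub>N\<^esub> finsum N (f y) I"
      using N.finsum_addf[OF cl[OF xy(1)] cl[OF xy(2)]] by simp
  next
    fix r x assume rx: "r \<in> carrier R" "x \<in> carrier M"
    have "finsum N (f (r \<odot>\<^bsub>M\<^esub> x)) I = finsum N (\<lambda>i. r \<odot>\<^bsub>N\<^esub> f x i) I"
      using cl rx by (intro N.finsum_cong') (auto simp: linear_on_scale[OF assms(2)] Pi_iff)
    then show "finsum N (f (r \<odot>\<^bsub>M\<^esub> x)) I = r \<odot>\<^bsub>N\<^esub> finsum N (f x) I"
      using N.finsum_smult_ldistr[OF assms(1) rx(1) cl[OF rx(2)]] by simp
  qed (use cl in auto)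
qed

lemma linear_on_inverse:
  assumes "linear_on R M N f" "module R M" "bij_betw f (carrier M) (carrier N)"
  shows "linear_on R N M (inv_into (carrier M) f)"
proof -
  interpret M: module R M by fact
  let ?g = "inv_into (carrier M) f"
  have g: "?g y \<in> carrier M" "f (?g y) = y" if "y \<in> carrier N" for y
    using that assms(3) by (auto simp: bij_betw_def inv_into_into f_inv_into_f)
  have inv: "?g (f x) = x" if "x \<in> carrier M" for x
    using that assms(3) by (auto simp: bij_betw_def)
  show ?thesis
  proof
    fix x y assume xy: "x \<in> carrier N" "y \<in> carrier N"
    then have "?g (f (?g x \<oplus>\<^bsub>M\<^esub> ?g y)) = ?g (x \<oplus>\<^bsub>N\<^esub> y)"
      by (simp add: linear_on_add[OF assms(1)] g)
    then show "?g (x \<oplus>\<^bsub>N\<^esub> y) = ?g x \<oplus>\<^bsub>M\<^esub> ?g y" using xy g by (simp add: inv)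
  next
    fix r x assume xy: "r \<in> carrier R" "x \<in> carrier N"
    then have "?g (f (r \<odot>\<^bsub>M\<^esub> ?g x)) = ?g (r \<odot>\<^bsub>N\<^esub> x)"
      by (simp add: linear_on_scale[OF assms(1)] g)
    then show "?g (r \<odot>\<^bsub>N\<^esub> x) = r \<odot>\<^bsub>M\<^esub> ?g x" using xy g by (simp add: inv)
  qed (use g in auto)
qed

section \<open>Quotient spaces\<close>

lemma submodule_abelian_subgroup:
  assumes "module R M" "submodule K R M"
  shows "abelian_subgroup K M"
proof -
  interpret M: module R M by fact
  show ?thesis
    by (intro abelian_subgroupI3 additive_subgroupI submodule.axioms(1)[OF assms(2)]
        M.abelian_group_axioms)
qed

lemma quotient_space_carrier:
  "carrier (quotient_space M K) = (\<lambda>x. K +>\<^bsub>M\<^esub> x) ` carrier M"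
  by (auto simp: quotient_space_def A_RCOSETS_def')

lemma coset_self:
  assumes "module R M" "submodule K R M" "x \<in> carrier M"
  shows "x \<in> K +>\<^bsub>M\<^esub> x"
  using abelian_subgroup.a_rcos_self[OF submodule_abelian_subgroup] assms by metis

lemma coset_eq_iff:
  assumes "module R M" "submodule K R M" "x \<in> carrier M" "y \<in> carrier M"
  shows "K +>\<^bsub>M\<^esub> x = K +>\<^bsub>M\<^esub> y \<longleftrightarrow> x \<ominus>\<^bsub>M\<^esub> y \<in> K"
proof -
  interpret M: module R M by fact
  interpret K: abelian_subgroup K M by (rule submodule_abelian_subgroup) fact+
  have "x \<ominus>\<^bsub>M\<^esub> y \<in> K \<longleftrightarrow> x \<in> K +>\<^bsub>M\<^esub> y"
    using K.a_rcos_module[OF assms(4,3)] by (simp add: a_minus_def)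
  also have "\<dots> \<longleftrightarrow> K +>\<^bsub>M\<^esub> x = K +>\<^bsub>M\<^esub> y"
    using K.a_repr_independence' K.a_repr_independenceD assms(3,4) K.a_rcos_self by metis
  finally show ?thesis by blast
qed

lemma mem_coset_iff:
  assumes "module R M" "submodule K R M" "y \<in> carrier M"
  shows "x \<in> K +>\<^bsub>M\<^esub> y \<longleftrightarrow> x \<in> carrier M \<and> K +>\<^bsub>M\<^esub> x = K +>\<^bsub>M\<^esub> y"
proof -
  interpret M: module R M by fact
  interpret K: abelian_subgroup K M by (rule submodule_abelian_subgroup) fact+
  show ?thesis
    using K.a_elemrcos_carrier K.a_repr_independence' K.a_rcos_self assms(3) by metis
qed

lemma quotient_space_add:
  assumes "module R M" "submodule K R M" "x \<in> carrier M" "y \<in> carrier M"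
  shows "(K +>\<^bsub>M\<^esub> x) \<oplus>\<^bsub>quotient_space M K\<^esub> (K +>\<^bsub>M\<^esub> y) = K +>\<^bsub>M\<^esub> (x \<oplus>\<^bsub>M\<^esub> y)"
  using abelian_subgroup.a_rcos_sum[OF submodule_abelian_subgroup[OF assms(1,2)]] assms(3,4)
  by (simp add: quotient_space_def)

text \<open>Scalar multiplication of a coset is defined as a union over all its members. Every
  member yields the same coset because \<open>K\<close> is closed under scalars, and the union is
  not empty, so it collapses to that one coset.\<close>

lemma quotient_space_smult:
  assumes "module R M" "submodule K R M" "x \<in> carrier M" "r \<in> carrier R"
  shows "r \<odot>\<^bsub>quotient_space M K\<^esub> (K +>\<^bsub>M\<^esub> x) = K +>\<^bsub>M\<^esub> (r \<odot>\<^bsub>M\<^esub> x)"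
proof -
  interpret M: module R M by fact
  have "K +>\<^bsub>M\<^esub> (r \<odot>\<^bsub>M\<^esub> y) = K +>\<^bsub>M\<^esub> (r \<odot>\<^bsub>M\<^esub> x)" if y: "y \<in> K +>\<^bsub>M\<^esub> x" for y
  proof -
    have yc: "y \<in> carrier M" and "y \<ominus>\<^bsub>M\<^esub> x \<in> K"
      using y mem_coset_iff[OF assms(1-3)] coset_eq_iff[OF assms(1,2) _ assms(3)] by auto
    then have "r \<odot>\<^bsub>M\<^esub> (y \<ominus>\<^bsub>M\<^esub> x) \<in> K"
      using M.submoduleE(4)[OF assms(2)] assms(4) by blast
    moreover have "r \<odot>\<^bsub>M\<^esub> (y \<ominus>\<^bsub>M\<^esub> x) = r \<odot>\<^bsub>M\<^esub> y \<ominus>\<^bsub>M\<^esub> r \<odot>\<^bsub>M\<^esub> x"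
      using yc assms(3,4) by (simp add: a_minus_def M.smult_r_distr M.smult_r_minus)
    ultimately show ?thesis
      using coset_eq_iff[OF assms(1,2)] yc assms(3,4) by simp
  qed
  then have "(\<Union>y\<in>K +>\<^bsub>M\<^esub> x. K +>\<^bsub>M\<^esub> (r \<odot>\<^bsub>M\<^esub> y)) = K +>\<^bsub>M\<^esub> (r \<odot>\<^bsub>M\<^esub> x)"
    using coset_self[OF assms(1-3)] by blast
  then show ?thesis by (simp add: quotient_space_def)
qed

lemma quotient_module:
  assumes "module R M" "submodule K R M"
  shows "module R (quotient_space M K)"
proof -
  interpret M: module R M by fact
  let ?Q = "quotient_space M K"
  note simps = quotient_space_add[OF assms] quotient_space_smult[OF assms]
  have K0: "\<zero>\<^bsub>?Q\<^esub> = K +>\<^bsub>M\<^esub> \<zero>\<^bsub>M\<^esub>"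
    using M.submoduleE(1)[OF assms(2)] by (simp add: quotient_space_def)
  have "abelian_group ?Q"
  proof (rule abelian_groupI)
    fix X assume "X \<in> carrier ?Q"
    then obtain x where x: "x \<in> carrier M" "X = K +>\<^bsub>M\<^esub> x" by (auto simp: quotient_space_carrier)
    then show "\<exists>Y\<in>carrier ?Q. Y \<oplus>\<^bsub>?Q\<^esub> X = \<zero>\<^bsub>?Q\<^esub>"
      by (intro bexI[of _ "K +>\<^bsub>M\<^esub> (\<ominus>\<^bsub>M\<^esub> x)"]) (auto simp: simps K0 M.l_neg quotient_space_carrier)
  qed (use K0 in \<open>auto simp: quotient_space_carrier simps M.a_ac\<close>)
  then show ?thesis
    by (rule moduleI[OF M.is_cring])
      (auto simp: quotient_space_carrier simps M.smult_l_distr M.smult_r_distr M.smult_assoc1)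
qed

lemma coset_linear:
  assumes "module R M" "submodule K R M"
  shows "linear_on R M (quotient_space M K) (\<lambda>x. K +>\<^bsub>M\<^esub> x)"
  by (rule linear_onI) (auto simp: quotient_space_carrier quotient_space_add[OF assms]
      quotient_space_smult[OF assms])

lemma span_of_submodule:
  assumes "module R M" "X \<subseteq> carrier M"
  shows "submodule (span_of R M X) R M"
proof -
  interpret M: module R M by fact
  \<comment> \<open>By \<open>X \<subseteq> carrier M\<close> the carrier itself is one of the
    intersected submodules, so the intersection is not taken over the empty family.\<close>
  have "span_of R M X \<subseteq> carrier M"
    using M.carrier_is_submodule assms(2) by (auto simp: span_of_def)
  moreover have "\<zero>\<^bsub>M\<^esub> \<in> K" if "submodule K R M" for K
    using that by (metis submodule_abelian_subgroup[OF assms(1)] additive_subgroup.zero_closed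
        abelian_subgroup.axioms(1))
  ultimately show ?thesis
    by (intro M.submoduleI) (auto simp: span_of_def M.submoduleE(3-5))
qed

lemma span_of_superset: "X \<subseteq> span_of R M X"
  by (auto simp: span_of_def)

lemma span_of_minimal:
  assumes "submodule K R M" "X \<subseteq> K"
  shows "span_of R M X \<subseteq> K"
  using assms by (auto simp: span_of_def)

lemma kernel_submodule:
  assumes "module R M" "module R N" "linear_on R M N f"
  shows "submodule {x \<in> carrier M. f x = \<zero>\<^bsub>N\<^esub>} R M"
proof -
  interpret M: module R M by fact
  interpret N: module R N by fact
  show ?thesis
    by (intro M.submoduleI)
      (auto simp: linear_on_zero[OF assms] linear_on_neg[OF assms] linear_onD[OF assms(3)])
qed

lemma vanishes_on_span:
  assumes "module R M" "module R N" "linear_on R M N f" "X \<subseteq> carrier M"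
    and "\<And>x. x \<in> X \<Longrightarrow> f x = \<zero>\<^bsub>N\<^esub>" "x \<in> span_of R M X"
  shows "f x = \<zero>\<^bsub>N\<^esub>"
  using span_of_minimal[OF kernel_submodule[OF assms(1-3)], of X] assms(4-6) by auto

lemma quotient_some_rep:
  assumes "module R M" "submodule K R M" "u \<in> carrier (quotient_space M K)"
  shows "(SOME x. x \<in> u) \<in> carrier M" "K +>\<^bsub>M\<^esub> (SOME x. x \<in> u) = u"
proof -
  obtain y where y: "y \<in> carrier M" "u = K +>\<^bsub>M\<^esub> y"
    using assms(3) by (auto simp: quotient_space_carrier)
  have "(SOME x. x \<in> u) \<in> u" using coset_self[OF assms(1,2) y(1)] y(2) by (metis someI)
  then show "(SOME x. x \<in> u) \<in> carrier M" "K +>\<^bsub>M\<^esub> (SOME x. x \<in> u) = u"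
    using mem_coset_iff[OF assms(1,2) y(1)] y(2) by auto
qed

text \<open>\<open>tlift\<close> and \<open>blift\<close> evaluate at a representative picked by
  \<open>SOME\<close>. A linear map that vanishes on \<open>K\<close> takes the same value at all
  members of a coset, so evaluating at the pick is the map induced on the quotient.\<close>

lemma quotient_lift:
  assumes "module R M" "submodule K R M" "module R N" "linear_on R M N f"
    and "\<And>x. x \<in> K \<Longrightarrow> f x = \<zero>\<^bsub>N\<^esub>"
  shows quotient_lift_eq: "x \<in> carrier M \<Longrightarrow> f (SOME y. y \<in> K +>\<^bsub>M\<^esub> x) = f x"
    and quotient_lift_linear: "linear_on R (quotient_space M K) N (\<lambda>u. f (SOME x. x \<in> u))"
proof -
  interpret M: module R M by fact
  interpret N: module R N by fact
  have *: "f (SOME y. y \<in> K +>\<^bsub>M\<^esub> x) = f x" if x: "x \<in> carrier M" for x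
  proof -
    let ?y = "SOME y. y \<in> K +>\<^bsub>M\<^esub> x"
    have "K +>\<^bsub>M\<^esub> x \<in> carrier (quotient_space M K)" using x by (auto simp: quotient_space_carrier)
    note y = quotient_some_rep[OF assms(1,2) this]
    then have "f (?y \<ominus>\<^bsub>M\<^esub> x) = \<zero>\<^bsub>N\<^esub>"
      using coset_eq_iff[OF assms(1,2) y(1) x] assms(5) by auto
    then show ?thesis
      using linear_on_minus[OF assms(1,3,4) y(1) x] linear_on_closed[OF assms(4)] x y(1)
by (metis minus_eq_zero_iff[OF assms(3)])
  qed
  show "x \<in> carrier M \<Longrightarrow> f (SOME y. y \<in> K +>\<^bsub>M\<^esub> x) = f x" by (rule *)
  show "linear_on R (quotient_space M K) N (\<lambda>u. f (SOME x. x \<in> u))"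
    by (rule linear_onI)
      (auto simp: quotient_space_carrier quotient_space_add[OF assms(1,2)]
        quotient_space_smult[OF assms(1,2)] * linear_onD[OF assms(4)])
qed

section \<open>Free spaces and tensor products\<close>

lemma free_space_module:
  fixes R (structure)
  assumes "cring R"
  shows "module R (free_space R X)"
proof -
  interpret cring R by fact
  let ?F = "free_space R X"
  have sub: "finite {i. p i \<oplus> q i \<noteq> \<zero>} \<and> {i. p i \<oplus> q i \<noteq> \<zero>} \<subseteq> X"
    if "p \<in> carrier ?F" "q \<in> carrier ?F" for p q
  proof -
    have "{i. p i \<oplus> q i \<noteq> \<zero>} \<subseteq> {i. p i \<noteq> \<zero>} \<union> {i. q i \<noteq> \<zero>}" by auto
    then show ?thesis using that by (auto simp: free_space_def intro: finite_subset)
  qed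
  have sub2: "finite {i. f (p i) \<noteq> \<zero>} \<and> {i. f (p i) \<noteq> \<zero>} \<subseteq> X"
    if "p \<in> carrier ?F" "f \<zero> = \<zero>" for p f
  proof -
    have "{i. f (p i) \<noteq> \<zero>} \<subseteq> {i. p i \<noteq> \<zero>}" using that(2) by auto
    then show ?thesis using that by (auto simp: free_space_def intro: finite_subset)
  qed
  have "abelian_group ?F"
  proof (rule abelian_groupI)
    fix p assume p: "p \<in> carrier ?F"
    show "\<exists>q\<in>carrier ?F. q \<oplus>\<^bsub>?F\<^esub> p = \<zero>\<^bsub>?F\<^esub>"
      by (rule bexI[of _ "\<lambda>i. \<ominus> p i"])
        (use p sub2[OF p, of "\<lambda>i. \<ominus> i"] in \<open>auto simp: free_space_def l_neg\<close>)
  qed (use sub in \<open>auto simp: free_space_def a_ac\<close>)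
  then show ?thesis
  proof (rule moduleI[OF is_cring], goal_cases)
    case (1 a x)
    then show ?case using sub2[OF 1(2), of "\<lambda>i. a \<otimes> i"] by (auto simp: free_space_def)
  qed (auto simp: free_space_def l_distr r_distr m_assoc)
qed

lemma free_gen_closed:
  fixes R (structure)
  assumes "cring R" "i \<in> X"
  shows "free_gen R i \<in> carrier (free_space R X)"
proof -
  interpret cring R by fact
  have "{j. free_gen R i j \<noteq> \<zero>} \<subseteq> {i}" by (auto simp: free_gen_def)
  then show ?thesis using assms(2)
    by (auto simp: free_space_def free_gen_def intro: finite_subset)
qed

text \<open>Linear extension of a family from the standard basis. It is the sum inside
  \<open>tlift\<close> with the representative as an argument, so that linearity can be proved
  before any representative is chosen.\<close>

definition free_lift where
  "free_lift R P f p = (\<Oplus>\<^bsub>P\<^esub>i\<in>{i. p i \<noteq> \<zero>\<^bsub>R\<^esub>}. p i \<odot>\<^bsub>P\<^esub> f i)"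

text \<open>The support of a sum may be smaller than the union of the two supports; sums over a
  common finite superset can be compared term by term.\<close>

lemma free_lift_superset:
  assumes "module R P" "p \<in> carrier (free_space R X)" "finite S" "{i. p i \<noteq> \<zero>\<^bsub>R\<^esub>} \<subseteq> S" "S \<subseteq> X"
    and "\<And>i. i \<in> X \<Longrightarrow> f i \<in> carrier P"
  shows "free_lift R P f p = (\<Oplus>\<^bsub>P\<^esub>i\<in>S. p i \<odot>\<^bsub>P\<^esub> f i)"
proof -
  interpret P: module R P by fact
  show ?thesis unfolding free_lift_def
    by (rule P.add.finprod_mono_neutral_cong_left)
      (use assms in \<open>auto simp: free_space_def\<close>)
qed

lemma free_lift_linear:
  assumes "module R P" "\<And>i. i \<in> X \<Longrightarrow> f i \<in> carrier P"
  shows "linear_on R (free_space R X) P (free_lift R P f)"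
proof -
  interpret P: module R P by fact
  interpret F: module R "free_space R X" using free_space_module[OF P.is_cring] .
  note sup = free_lift_superset[OF assms(1) _ _ _ _ assms(2)]
  show ?thesis
  proof
    fix p assume p: "p \<in> carrier (free_space R X)"
    then show "free_lift R P f p \<in> carrier P"
      unfolding free_lift_def using assms(2) by (intro P.finsum_closed) (auto simp: free_space_def)
  next
    fix p q assume p: "p \<in> carrier (free_space R X)" and q: "q \<in> carrier (free_space R X)"
    let ?S = "{i. p i \<noteq> \<zero>\<^bsub>R\<^esub>} \<union> {i. q i \<noteq> \<zero>\<^bsub>R\<^esub>}"
    have S: "finite ?S" "?S \<subseteq> X" using p q by (auto simp: free_space_def)
    have c: "p i \<in> carrier R" "q i \<in> carrier R" for i using p q by (auto simp: free_space_def)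
    have "free_lift R P f (p \<oplus>\<^bsub>free_space R X\<^esub> q)
        = (\<Oplus>\<^bsub>P\<^esub>i\<in>?S. (p \<oplus>\<^bsub>free_space R X\<^esub> q) i \<odot>\<^bsub>P\<^esub> f i)"
      using S F.a_closed[OF p q] by (intro sup) (auto simp: free_space_def)
    also have "\<dots> = (\<Oplus>\<^bsub>P\<^esub>i\<in>?S. p i \<odot>\<^bsub>P\<^esub> f i \<oplus>\<^bsub>P\<^esub> q i \<odot>\<^bsub>P\<^esub> f i)"
      using c S(2) assms(2) by (intro P.finsum_cong') (auto simp: free_space_def P.smult_l_distr)
    also have "\<dots> = (\<Oplus>\<^bsub>P\<^esub>i\<in>?S. p i \<odot>\<^bsub>P\<^esub> f i) \<oplus>\<^bsub>P\<^esub> (\<Oplus>\<^bsub>P\<^esub>i\<in>?S. q i \<odot>\<^bsub>P\<^esub> f i)"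
      using c S(2) assms(2) by (intro P.finsum_addf) auto
    also have "\<dots> = free_lift R P f p \<oplus>\<^bsub>P\<^esub> free_lift R P f q"
      using sup[OF p S(1) _ S(2)] sup[OF q S(1) _ S(2)] by simp
    finally show "free_lift R P f (p \<oplus>\<^bsub>free_space R X\<^esub> q) = \<dots>" .
  next
    fix r p assume r: "r \<in> carrier R" and p: "p \<in> carrier (free_space R X)"
    let ?S = "{i. p i \<noteq> \<zero>\<^bsub>R\<^esub>}"
    have S: "finite ?S" "?S \<subseteq> X" using p by (auto simp: free_space_def)
    have c: "p i \<in> carrier R" for i using p by (auto simp: free_space_def)
    have "free_lift R P f (r \<odot>\<^bsub>free_space R X\<^esub> p)
        = (\<Oplus>\<^bsub>P\<^esub>i\<in>?S. (r \<odot>\<^bsub>free_space R X\<^esub> p) i \<odot>\<^bsub>P\<^esub> f i)"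
      using S F.smult_closed[OF r p] r by (intro sup) (auto simp: free_space_def)
    also have "\<dots> = (\<Oplus>\<^bsub>P\<^esub>i\<in>?S. r \<odot>\<^bsub>P\<^esub> (p i \<odot>\<^bsub>P\<^esub> f i))"
      using c r S(2) assms(2) by (intro P.finsum_cong') (auto simp: free_space_def P.smult_assoc1)
    also have "\<dots> = r \<odot>\<^bsub>P\<^esub> free_lift R P f p"
      using c r S assms(2) unfolding free_lift_def by (subst P.finsum_smult_ldistr) auto
    finally show "free_lift R P f (r \<odot>\<^bsub>free_space R X\<^esub> p) = \<dots>" .
  qed
qed

lemma free_lift_gen:
  assumes "module R P" "i \<in> X" "\<And>i. i \<in> X \<Longrightarrow> f i \<in> carrier P"
  shows "free_lift R P f (free_gen R i) = f i"
proof -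
  interpret P: module R P by fact
  have "free_lift R P f (free_gen R i) = (\<Oplus>\<^bsub>P\<^esub>j\<in>{i}. free_gen R i j \<odot>\<^bsub>P\<^esub> f j)"
    using assms free_gen_closed[OF P.is_cring assms(2)]
    by (intro free_lift_superset) (auto simp: free_gen_def split: if_splits)
  then show ?thesis using assms by (simp add: free_gen_def)
qed

lemma free_space_expand:
  assumes "cring R" "p \<in> carrier (free_space R X)"
  shows "p = free_lift R (free_space R X) (free_gen R) p"
proof -
  interpret R: cring R by fact
  let ?F = "free_space R X"
  interpret F: module R ?F by (rule free_space_module) fact
  let ?S = "{i. p i \<noteq> \<zero>\<^bsub>R\<^esub>}"
  have S: "finite ?S" "?S \<subseteq> X" and c: "p i \<in> carrier R" for i
    using assms(2) by (auto simp: free_space_def)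
  have g: "free_gen R i \<in> carrier ?F" if "i \<in> X" for i using free_gen_closed[OF assms(1) that] .
  \<comment> \<open>Elements of the free space are functions, so evaluating at \<open>j\<close>
    turns a sum in the space into a sum in \<open>R\<close>; of the basis expansion only the summand
    at \<open>j\<close> then survives.\<close>
  have ev: "finsum ?F h T j = finsum R (\<lambda>i. h i j) T"
    if "finite T" "h \<in> T \<rightarrow> carrier ?F" for h T j
    using that
  proof (induction T rule: finite_induct)
    case empty
    then show ?case unfolding F.M.finsum_empty R.finsum_empty by (simp add: free_space_def)
  next
    case (insert t T)
    have h: "h t \<in> carrier ?F" "h \<in> T \<rightarrow> carrier ?F" using insert.prems by auto
    have "(\<lambda>i. h i j) \<in> T \<rightarrow> carrier R" "h t j \<in> carrier R"
      using insert.prems by (auto simp: free_space_def)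
    moreover have "finsum ?F h (insert t T) = h t \<oplus>\<^bsub>?F\<^esub> finsum ?F h T"
      using insert.hyps h by (intro F.M.finsum_insert) auto
    moreover have "(h t \<oplus>\<^bsub>?F\<^esub> finsum ?F h T) j = h t j \<oplus>\<^bsub>R\<^esub> finsum ?F h T j"
      by (simp add: free_space_def)
    ultimately show ?case using insert.IH[OF h(2)] insert.hyps by simp
  qed
  have "free_lift R ?F (free_gen R) p j = p j" for j
  proof -
    have "free_lift R ?F (free_gen R) p j = finsum R (\<lambda>i. (p i \<odot>\<^bsub>?F\<^esub> free_gen R i) j) ?S"
      unfolding free_lift_def using S g c by (intro ev) auto
    also have "\<dots> = finsum R (\<lambda>i. if j = i then p i else \<zero>\<^bsub>R\<^esub>) ?S"
      using c by (intro R.finsum_cong') (auto simp: free_space_def free_gen_def)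
    also have "\<dots> = p j"
    proof (cases "j \<in> ?S")
      case True
      then show ?thesis using S c by (intro R.finsum_singleton) auto
    next
      case False
      then have "finsum R (\<lambda>i. if j = i then p i else \<zero>\<^bsub>R\<^esub>) ?S = finsum R (\<lambda>i. \<zero>\<^bsub>R\<^esub>) ?S"
        using c by (intro R.finsum_cong') auto
      then show ?thesis using False by simp
    qed
    finally show ?thesis .
  qed
  then show ?thesis by auto
qed

lemma tensor_rels_closed:
  assumes "module R M" "module R N"
  shows "tensor_rels R M N \<subseteq> carrier (free_space R (carrier M \<times> carrier N))"
proof -
  interpret M: module R M by fact
  interpret N: module R N by fact
  interpret F: module R "free_space R (carrier M \<times> carrier N)"
    by (rule free_space_module[OF M.is_cring])
  note [simp] = free_gen_closed[OF M.is_cring]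
  show ?thesis
    unfolding tensor_rels_def Let_def
    by (intro Un_least subsetI) (auto intro!: F.minus_closed)
qed

lemma tensor_ker_submodule:
  assumes "module R M" "module R N"
  shows "submodule (tensor_ker R M N) R (free_space R (carrier M \<times> carrier N))"
proof -
  interpret M: module R M by fact
  show ?thesis unfolding tensor_ker_def
    by (intro span_of_submodule free_space_module M.is_cring tensor_rels_closed assms)
qed

lemma tensor_module:
  assumes "module R M" "module R N"
  shows "module R (tensor R M N)"
proof -
  interpret M: module R M by fact
  show ?thesis unfolding tensor_def
    by (intro quotient_module free_space_module M.is_cring tensor_ker_submodule assms)
qed

lemma tens_closed:
  assumes "module R M" "module R N" "m \<in> carrier M" "n \<in> carrier N"
  shows "tens R M N m n \<in> carrier (tensor R M N)"
proof -
  interpret M: module R M by fact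
  show ?thesis using assms(3,4)
    by (auto simp: tensor_def tens_def quotient_space_carrier intro!: free_gen_closed M.is_cring)
qed

lemma tens_rels:
  assumes "module R M" "module R N"
  shows tens_add_left: "x \<in> carrier M \<Longrightarrow> y \<in> carrier M \<Longrightarrow> n \<in> carrier N \<Longrightarrow>
      tens R M N (x \<oplus>\<^bsub>M\<^esub> y) n = tens R M N x n \<oplus>\<^bsub>tensor R M N\<^esub> tens R M N y n"
    and tens_add_right: "m \<in> carrier M \<Longrightarrow> z \<in> carrier N \<Longrightarrow> w \<in> carrier N \<Longrightarrow>
      tens R M N m (z \<oplus>\<^bsub>N\<^esub> w) = tens R M N m z \<oplus>\<^bsub>tensor R M N\<^esub> tens R M N m w"
    and tens_smult_left: "r \<in> carrier R \<Longrightarrow> m \<in> carrier M \<Longrightarrow> n \<in> carrier N \<Longrightarrow>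
      tens R M N (r \<odot>\<^bsub>M\<^esub> m) n = r \<odot>\<^bsub>tensor R M N\<^esub> tens R M N m n"
    and tens_smult_right: "r \<in> carrier R \<Longrightarrow> m \<in> carrier M \<Longrightarrow> n \<in> carrier N \<Longrightarrow>
      tens R M N m (r \<odot>\<^bsub>N\<^esub> n) = r \<odot>\<^bsub>tensor R M N\<^esub> tens R M N m n"
proof -
  interpret M: module R M by fact
  interpret N: module R N by fact
  let ?W = "free_space R (carrier M \<times> carrier N)"
  let ?d = "\<lambda>m n. free_gen R (m, n)"
  interpret W: module R ?W by (rule free_space_module[OF M.is_cring])
  note K = tensor_ker_submodule[OF assms]
  have [simp]: "?d m n \<in> carrier ?W" if "m \<in> carrier M" "n \<in> carrier N" for m n
    using that by (intro free_gen_closed[OF M.is_cring]) auto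
  have rel: "x \<ominus>\<^bsub>?W\<^esub> y \<in> tensor_rels R M N \<Longrightarrow> x \<ominus>\<^bsub>?W\<^esub> y \<in> tensor_ker R M N" for x y
    unfolding tensor_ker_def by (rule subsetD[OF span_of_superset])
  note simps = tens_def tensor_def quotient_space_add[OF W.module_axioms K]
    quotient_space_smult[OF W.module_axioms K] coset_eq_iff[OF W.module_axioms K]
  show "tens R M N (x \<oplus>\<^bsub>M\<^esub> y) n = tens R M N x n \<oplus>\<^bsub>tensor R M N\<^esub> tens R M N y n"
    if "x \<in> carrier M" "y \<in> carrier M" "n \<in> carrier N" for x y n
  proof -
    have "?d (x \<oplus>\<^bsub>M\<^esub> y) n \<ominus>\<^bsub>?W\<^esub> (?d x n \<oplus>\<^bsub>?W\<^esub> ?d y n) \<in> tensor_rels R M N"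
      unfolding tensor_rels_def Let_def using that by blast
    then show ?thesis using that rel by (simp add: simps)
  qed
  show "tens R M N m (z \<oplus>\<^bsub>N\<^esub> w) = tens R M N m z \<oplus>\<^bsub>tensor R M N\<^esub> tens R M N m w"
    if "m \<in> carrier M" "z \<in> carrier N" "w \<in> carrier N" for m z w
  proof -
    have "?d m (z \<oplus>\<^bsub>N\<^esub> w) \<ominus>\<^bsub>?W\<^esub> (?d m z \<oplus>\<^bsub>?W\<^esub> ?d m w) \<in> tensor_rels R M N"
      unfolding tensor_rels_def Let_def using that by blast
    then show ?thesis using that rel by (simp add: simps)
  qed
  show "tens R M N (r \<odot>\<^bsub>M\<^esub> m) n = r \<odot>\<^bsub>tensor R M N\<^esub> tens R M N m n"
    if "r \<in> carrier R" "m \<in> carrier M" "n \<in> carrier N" for r m n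
  proof -
    have "?d (r \<odot>\<^bsub>M\<^esub> m) n \<ominus>\<^bsub>?W\<^esub> (r \<odot>\<^bsub>?W\<^esub> ?d m n) \<in> tensor_rels R M N"
      unfolding tensor_rels_def Let_def using that by blast
    then show ?thesis using that rel by (simp add: simps)
  qed
  show "tens R M N m (r \<odot>\<^bsub>N\<^esub> n) = r \<odot>\<^bsub>tensor R M N\<^esub> tens R M N m n"
    if "r \<in> carrier R" "m \<in> carrier M" "n \<in> carrier N" for r m n
  proof -
    have "?d m (r \<odot>\<^bsub>N\<^esub> n) \<ominus>\<^bsub>?W\<^esub> (r \<odot>\<^bsub>?W\<^esub> ?d m n) \<in> tensor_rels R M N"
      unfolding tensor_rels_def Let_def using that by blast
    then show ?thesis using that rel by (simp add: simps)
  qed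
qed

lemma tens_bilinear:
  assumes "module R M" "module R N"
  shows "bilinear_on R M N (tensor R M N) (tens R M N)"
  by (intro bilinear_onI linear_onI tens_rels tens_closed assms)

section \<open>Induced maps evaluated on chosen representatives\<close>

lemma tlift_free_lift:
  "tlift R M N P f t = free_lift R P (\<lambda>i. f (fst i) (snd i)) (SOME p. p \<in> t)"
  by (simp add: tlift_def free_lift_def Let_def)

lemma tensor_some_rep:
  assumes "module R M" "module R N" "t \<in> carrier (tensor R M N)"
  shows "(SOME p. p \<in> t) \<in> carrier (free_space R (carrier M \<times> carrier N))"
    and "tensor_ker R M N +>\<^bsub>free_space R (carrier M \<times> carrier N)\<^esub> (SOME p. p \<in> t) = t"
proof -
  interpret M: module R M by fact
  note * = quotient_some_rep[OF free_space_module[OF M.is_cring] tensor_ker_submodule[OF assms(1,2)]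
      assms(3)[unfolded tensor_def]]
  show "(SOME p. p \<in> t) \<in> carrier (free_space R (carrier M \<times> carrier N))"
    "tensor_ker R M N +>\<^bsub>free_space R (carrier M \<times> carrier N)\<^esub> (SOME p. p \<in> t) = t"
    by (rule *)+
qed

text \<open>Coefficients and support of the representative that \<open>tlift\<close> chooses. They
  depend on the tensor alone, so all \<open>tlift\<close> expressions over the same tensor are
  finite sums over one index set and can be compared term by term.\<close>

definition tcoef where "tcoef t = (SOME p. p \<in> t)"
definition tsupp where "tsupp R t = {i. tcoef t i \<noteq> \<zero>\<^bsub>R\<^esub>}"

lemma tlift_finsum:
  "tlift R M N P f t = (\<Oplus>\<^bsub>P\<^esub>i\<in>tsupp R t. tcoef t i \<odot>\<^bsub>P\<^esub> f (fst i) (snd i))"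
  by (simp add: tlift_def tcoef_def tsupp_def Let_def)

lemma tsupp:
  assumes "module R M" "module R N" "t \<in> carrier (tensor R M N)"
  shows "finite (tsupp R t)" "tsupp R t \<subseteq> carrier M \<times> carrier N" "tcoef t i \<in> carrier R"
  using tensor_some_rep(1)[OF assms] unfolding free_space_def tcoef_def tsupp_def
  by (simp_all del: split_paired_All)

text \<open>Expand the representative in the standard basis and apply the quotient map: it is linear
  and sends basis vectors to pure tensors, so \<open>t\<close> is the sum of pure tensors given by
  its own coefficients.\<close>

lemma tensor_expand:
  assumes "module R M" "module R N" "t \<in> carrier (tensor R M N)"
  shows "tlift R M N (tensor R M N) (tens R M N) t = t"
proof -
  interpret M: module R M by fact
  let ?W = "free_space R (carrier M \<times> carrier N)"
  let ?p = "SOME p. p \<in> t"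
  note F = free_space_module[OF M.is_cring]
  note K = tensor_ker_submodule[OF assms(1,2)]
  interpret W: module R ?W by (rule F)
  note p = tensor_some_rep[OF assms]
  have supp: "finite {i. ?p i \<noteq> \<zero>\<^bsub>R\<^esub>}" "{i. ?p i \<noteq> \<zero>\<^bsub>R\<^esub>} \<subseteq> carrier M \<times> carrier N"
    "\<And>i. ?p i \<in> carrier R"
    using p(1) unfolding free_space_def by auto
  have g: "free_gen R i \<in> carrier ?W" if "i \<in> carrier M \<times> carrier N" for i
    using free_gen_closed[OF M.is_cring that] .
  interpret T: module R "tensor R M N" by (rule tensor_module) fact+
  have "t = tensor_ker R M N +>\<^bsub>?W\<^esub> free_lift R ?W (free_gen R) ?p"
    using p free_space_expand[OF M.is_cring p(1)] by simp
  also have "\<dots> = (\<Oplus>\<^bsub>tensor R M N\<^esub>i\<in>{i. ?p i \<noteq> \<zero>\<^bsub>R\<^esub>}. tensor_ker R M N +>\<^bsub>?W\<^esub>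
      (?p i \<odot>\<^bsub>?W\<^esub> free_gen R i))"
    unfolding free_lift_def tensor_def
    using supp g
    by (intro linear_on_finsum[OF F quotient_module[OF F K] coset_linear[OF F K]]) auto
  also have "\<dots> = (\<Oplus>\<^bsub>tensor R M N\<^esub>i\<in>{i. ?p i \<noteq> \<zero>\<^bsub>R\<^esub>}. ?p i \<odot>\<^bsub>tensor R M N\<^esub> tens R M N (fst i)
      (snd i))"
    using supp g
    by (intro T.finsum_cong') (auto simp: tens_def tensor_def quotient_space_smult[OF F K]
        intro!: T.smult_closed[unfolded tensor_def]
            tens_closed[OF assms(1,2), unfolded tens_def tensor_def])
  finally show ?thesis by (simp add: tlift_def Let_def)
qed

lemma tlift_closed:
  assumes "module R M" "module R N" "module R P"
    "\<And>a b. a \<in> carrier M \<Longrightarrow> b \<in> carrier N \<Longrightarrow> f a b \<in> carrier P" "t \<in> carrier (tensor R M N)"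
  shows "tlift R M N P f t \<in> carrier P"
proof -
  interpret P: module R P by fact
  show ?thesis unfolding tlift_finsum
    using tsupp[OF assms(1,2,5)] assms(4) by (auto intro!: P.finsum_closed)
qed

lemma tlift_cong:
  assumes "module R M" "module R N" "module R P" "t \<in> carrier (tensor R M N)"
    and "\<And>a b. a \<in> carrier M \<Longrightarrow> b \<in> carrier N \<Longrightarrow> f a b = g a b"
    and "\<And>a b. a \<in> carrier M \<Longrightarrow> b \<in> carrier N \<Longrightarrow> g a b \<in> carrier P"
  shows "tlift R M N P f t = tlift R M N P g t"
proof -
  interpret P: module R P by fact
  note S = tsupp[OF assms(1,2,4)] tlift_finsum
  show ?thesis unfolding S(4) using S(1,2,3) assms(5,6)
    by (intro P.finsum_cong') auto
qed

lemma linear_tlift: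
  assumes "module R M" "module R N" "module R P" "module R Q" "linear_on R P Q g"
    and "\<And>a b. a \<in> carrier M \<Longrightarrow> b \<in> carrier N \<Longrightarrow> f a b \<in> carrier P"
    and "t \<in> carrier (tensor R M N)"
  shows "g (tlift R M N P f t) = tlift R M N Q (\<lambda>a b. g (f a b)) t"
proof -
  interpret P: module R P by fact
  interpret Q: module R Q by fact
  note S = tsupp[OF assms(1,2,7)] tlift_finsum
  have c: "f (fst i) (snd i) \<in> carrier P" if "i \<in> tsupp R t" for i using that S(2) assms(6) by auto
  have "g (tlift R M N P f t) = (\<Oplus>\<^bsub>Q\<^esub>i\<in>tsupp R t. g (tcoef t i \<odot>\<^bsub>P\<^esub> f (fst i) (snd i)))"
    unfolding S using c S(1,3) by (intro linear_on_finsum[OF assms(3,4,5)]) auto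
  also have "\<dots> = tlift R M N Q (\<lambda>a b. g (f a b)) t"
    unfolding S using c S(3) linear_onD(1,3)[OF assms(5)] by (intro Q.finsum_cong') auto
  finally show ?thesis .
qed

text \<open>Universal property: bilinearity of \<open>f\<close> makes its linear extension kill the
  four families in \<open>tensor_rels\<close>, hence their span, and so the extension descends to
  the quotient.\<close>

lemma tlift_linear:
  assumes "module R M" "module R N" "module R P" "bilinear_on R M N P f"
  shows "linear_on R (tensor R M N) P (tlift R M N P f)"
    and tlift_tens: "m \<in> carrier M \<Longrightarrow> n \<in> carrier N \<Longrightarrow> tlift R M N P f (tens R M N m n) = f m n"
proof -
  interpret M: module R M by fact
  interpret N: module R N by fact
  interpret P: module R P by fact
  let ?W = "free_space R (carrier M \<times> carrier N)" and ?f = "\<lambda>i. f (fst i) (snd i)"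
  let ?d = "\<lambda>m n. free_gen R (m, n)"
  let ?L = "free_lift R P ?f"
  note F = free_space_module[OF M.is_cring]
  note K = tensor_ker_submodule[OF assms(1,2)]
  interpret W: module R ?W by (rule F)
  note fc = bilinear_on_closed[OF assms(4)]
  have L: "linear_on R ?W P ?L"
    by (intro free_lift_linear assms) (auto intro: fc)
  have gen [simp]: "?d m n \<in> carrier ?W" "?L (?d m n) = f m n" if "m \<in> carrier M" "n \<in> carrier N"
      for m n
    using that free_lift_gen[OF assms(3), of "(m, n)" "carrier M \<times> carrier N" ?f] fc
    by (auto intro!: free_gen_closed[OF M.is_cring])
  note Ls = linear_on_minus[OF F assms(3) L] linear_on_add[OF L] linear_on_scale[OF L]
  note fbil = linear_on_add[OF bilinear_on_left[OF assms(4)]]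
    linear_on_scale[OF bilinear_on_left[OF assms(4)]]
    linear_on_add[OF bilinear_on_right[OF assms(4)]]
    linear_on_scale[OF bilinear_on_right[OF assms(4)]]
  have van: "?L p = \<zero>\<^bsub>P\<^esub>" if "p \<in> tensor_rels R M N" for p
    using that unfolding tensor_rels_def Let_def
    by (elim UnE) (auto simp: Ls fc minus_eq_zero_iff[OF assms(3)] fbil)
  have van: "?L p = \<zero>\<^bsub>P\<^esub>" if "p \<in> tensor_ker R M N" for p
    using vanishes_on_span[OF F assms(3) L tensor_rels_closed[OF assms(1,2)] van
        that[unfolded tensor_ker_def]] .
  show "linear_on R (tensor R M N) P (tlift R M N P f)"
    unfolding tlift_free_lift tensor_def
    by (rule quotient_lift_linear[OF F K assms(3) L van])
  show "tlift R M N P f (tens R M N m n) = f m n" if "m \<in> carrier M" "n \<in> carrier N"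
    unfolding tlift_free_lift tens_def
    by (subst quotient_lift_eq[OF F K assms(3) L van gen(1)[OF that]])
        (assumption, rule gen(2)[OF that])
qed

text \<open>Scalar multiples get no case of their own: a coefficient is absorbed into the left
  factor of a pure tensor.\<close>

lemma tensor_induct [consumes 3, case_names zero add tens]:
  assumes "module R M" "module R N" "t \<in> carrier (tensor R M N)"
    and "Pr \<zero>\<^bsub>tensor R M N\<^esub>"
    and "\<And>s t. s \<in> carrier (tensor R M N) \<Longrightarrow> t \<in> carrier (tensor R M N) \<Longrightarrow> Pr s \<Longrightarrow> Pr t \<Longrightarrow>
      Pr (s \<oplus>\<^bsub>tensor R M N\<^esub> t)"
    and "\<And>m n. m \<in> carrier M \<Longrightarrow> n \<in> carrier N \<Longrightarrow> Pr (tens R M N m n)"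
  shows "Pr t"
proof -
  interpret M: module R M by fact
  interpret T: module R "tensor R M N" by (rule tensor_module) fact+
  let ?p = "tcoef t"
  note p = tsupp(3)[OF assms(1-3)]
  have "Pr (\<Oplus>\<^bsub>tensor R M N\<^esub>i\<in>tsupp R t. ?p i \<odot>\<^bsub>tensor R M N\<^esub> tens R M N (fst i) (snd i))"
    using tsupp(1,2)[OF assms(1-3)]
  proof (induction rule: finite_induct)
    case empty
    then show ?case using assms(4) by simp
  next
    case (insert i S)
    have c: "tens R M N (fst i) (snd i) \<in> carrier (tensor R M N)"
      "(\<lambda>i. ?p i \<odot>\<^bsub>tensor R M N\<^esub> tens R M N (fst i) (snd i)) \<in> S \<rightarrow> carrier (tensor R M N)"
      using insert.prems p by (auto intro!: T.smult_closed tens_closed[OF assms(1,2)])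
    have "Pr (?p i \<odot>\<^bsub>tensor R M N\<^esub> tens R M N (fst i) (snd i))"
      using insert.prems assms(6)[of "?p i \<odot>\<^bsub>M\<^esub> fst i" "snd i"] p
      by (auto simp: tens_smult_left[OF assms(1,2)])
    then show ?case using insert c p
      by (auto intro!: assms(5) T.finsum_closed)
  qed
  then show ?thesis using tensor_expand[OF assms(1-3)] by (simp add: tlift_finsum)
qed

lemma tensor_ext:
  assumes "module R M" "module R N" "module R P"
    and "linear_on R (tensor R M N) P f" "linear_on R (tensor R M N) P g"
    and "\<And>m n. m \<in> carrier M \<Longrightarrow> n \<in> carrier N \<Longrightarrow> f (tens R M N m n) = g (tens R M N m n)"
    and "t \<in> carrier (tensor R M N)"
  shows "f t = g t"
  using assms(1,2,7)
proof (induction rule: tensor_induct)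
  case zero
  then show ?case using linear_on_zero[OF tensor_module[OF assms(1,2)] assms(3)] assms(4,5) by metis
next
  case (add s t)
  then show ?case using assms(4,5) by (simp add: linear_on_add)
qed (use assms in auto)

lemma linear_on_tlift_param:
  assumes "module R M" "module R N" "module R P" "t \<in> carrier (tensor R M N)"
    and "\<And>a b. a \<in> carrier M \<Longrightarrow> b \<in> carrier N \<Longrightarrow> linear_on R X P (\<lambda>x. f x a b)"
  shows "linear_on R X P (\<lambda>x. tlift R M N P (f x) t)"
proof -
  note S = tsupp[OF assms(1,2,4)] tlift_finsum
  show ?thesis unfolding S(4)
    using S(1-3) assms(3,5) by (intro linear_on_finsum_fun linear_on_smult) auto
qed

lemma linear_on_tlift_arg:
  assumes "module R M" "module R N" "module R P" "bilinear_on R M N P f"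
    "linear_on R X (tensor R M N) g"
  shows "linear_on R X P (\<lambda>x. tlift R M N P f (g x))"
  by (rule linear_on_comp[OF tlift_linear(1)[OF assms(1-4)] assms(5)])

lemma linear_on_tens_left:
  assumes "module R M" "module R N" "n \<in> carrier N" "linear_on R X M f"
  shows "linear_on R X (tensor R M N) (\<lambda>x. tens R M N (f x) n)"
  using linear_on_comp[OF bilinear_on_left[OF tens_bilinear[OF assms(1,2)] assms(3)] assms(4)] .

lemma linear_on_tens_right:
  assumes "module R M" "module R N" "m \<in> carrier M" "linear_on R X N f"
  shows "linear_on R X (tensor R M N) (\<lambda>x. tens R M N m (f x))"
  using linear_on_comp[OF bilinear_on_right[OF tens_bilinear[OF assms(1,2)] assms(3)] assms(4)] .

lemma tlift_tlift:
  assumes "module R M" "module R N" "module R K" "module R L" "module R P"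
    and "bilinear_on R M N P f"
    and "\<And>a b. a \<in> carrier K \<Longrightarrow> b \<in> carrier L \<Longrightarrow> g a b \<in> carrier (tensor R M N)"
    and "t \<in> carrier (tensor R K L)"
  shows "tlift R M N P f (tlift R K L (tensor R M N) g t) = tlift R K L P
      (\<lambda>a b. tlift R M N P f (g a b)) t"
  by (intro linear_tlift tlift_linear tensor_module assms) (use assms in auto)

text \<open>Fubini for two independent Sweedler sums. Both sides are linear in \<open>t\<close>, and
  on a pure tensor \<open>c \<otimes> d\<close> both become the sum of \<open>f a b c d\<close> over
  \<open>s\<close>.\<close>

lemma tlift_swap:
  assumes "module R M" "module R N" "module R K" "module R L" "module R P"
    and "\<And>a b. a \<in> carrier M \<Longrightarrow> b \<in> carrier N \<Longrightarrow> bilinear_on R K L P (f a b)"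
    and "s \<in> carrier (tensor R M N)" "t \<in> carrier (tensor R K L)"
  shows "tlift R M N P (\<lambda>a b. tlift R K L P (f a b) t) s =
         tlift R K L P (\<lambda>c d. tlift R M N P (\<lambda>a b. f a b c d) s) t"
proof -
  have fc: "f a b c d \<in> carrier P" if "a \<in> carrier M" "b \<in> carrier N" "c \<in> carrier K" "d \<in> carrier
      L" for a b c d
    using bilinear_on_closed[OF assms(6)] that by auto
  have lin: "bilinear_on R K L P (\<lambda>c d. tlift R M N P (\<lambda>a b. f a b c d) s)"
    using bilinear_on_left[OF assms(6)] bilinear_on_right[OF assms(6)]
    by (intro bilinear_onI linear_on_tlift_param assms) auto
  show ?thesis
  proof (rule tensor_ext[of R K L P "\<lambda>t. tlift R M N P (\<lambda>a b. tlift R K L P (f a b) t) s", OF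
      assms(3,4,5) _ _ _ assms(8)])
    show "linear_on R (tensor R K L) P (\<lambda>t. tlift R M N P (\<lambda>a b. tlift R K L P (f a b) t) s)"
      by (intro linear_on_tlift_param tlift_linear assms) auto
    show "linear_on R (tensor R K L) P (tlift R K L P (\<lambda>c d. tlift R M N P (\<lambda>a b. f a b c d) s))"
      by (intro tlift_linear assms lin)
    fix c d assume cd: "c \<in> carrier K" "d \<in> carrier L"
    show "tlift R M N P (\<lambda>a b. tlift R K L P (f a b) (tens R K L c d)) s =
      tlift R K L P (\<lambda>c d. tlift R M N P (\<lambda>a b. f a b c d) s) (tens R K L c d)"
      using cd by (subst tlift_tens[OF assms(3,4,5) lin])
        (auto intro!: tlift_cong assms fc simp: tlift_tens[OF assms(3,4,5,6)])
  qed
qed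

definition trilinear_on where
  "trilinear_on R M N L P f \<longleftrightarrow>
    (\<forall>x\<in>carrier M. bilinear_on R N L P (f x)) \<and>
    (\<forall>y\<in>carrier N. \<forall>z\<in>carrier L. linear_on R M P (\<lambda>x. f x y z))"

text \<open>Coassociativity is an equation in \<open>M \<otimes> (H \<otimes> H)\<close>; this lift
  turns it into a substitution rule for arbitrary trilinear expressions.\<close>

lemma trilinear_lift:
  assumes "module R M" "module R N" "module R L" "module R P" "trilinear_on R M N L P f"
  shows trilinear_lift_linear:
      "linear_on R (tensor R M (tensor R N L)) P
          (tlift R M (tensor R N L) P (\<lambda>x. tlift R N L P (f x)))"
    and trilinear_lift_tens: "x \<in> carrier M \<Longrightarrow> t \<in> carrier (tensor R N L) \<Longrightarrow>
      tlift R M (tensor R N L) P (\<lambda>x. tlift R N L P (f x)) (tens R M (tensor R N L) x t)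
      = tlift R N L P (f x) t"
proof -
  have *: "bilinear_on R M (tensor R N L) P (\<lambda>x. tlift R N L P (f x))"
    using assms(5) unfolding trilinear_on_def
    by (intro bilinear_onI) (auto intro!: linear_on_tlift_param tlift_linear assms)
  note T = tensor_module[OF assms(2,3)]
  show "linear_on R (tensor R M (tensor R N L)) P
      (tlift R M (tensor R N L) P (\<lambda>x. tlift R N L P (f x)))"
    by (rule tlift_linear[OF assms(1) T assms(4) *])
  show "tlift R M (tensor R N L) P (\<lambda>x. tlift R N L P (f x)) (tens R M (tensor R N L) x t)
      = tlift R N L P (f x) t" if "x \<in> carrier M" "t \<in> carrier (tensor R N L)"
    by (rule tlift_tens[OF assms(1) T assms(4) * that])
qed

section \<open>Balanced tensor products\<close>

text \<open>Stated for arbitrary actions and twists that stay in the carriers, so that it covers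
  \<open>A \<otimes>\<^sub>B A\<close>, the source of \<open>can\<close>, as well as
  \<open>M \<otimes>\<^sub>B A\<close>.\<close>

locale balanced_tensor =
  fixes R :: "('k, 'r) ring_scheme" and B :: "('k, 'b, 'w) hom_space_scheme"
    and M :: "('k, 'm, 'x) hom_space_scheme" and ra :: "'m \<Rightarrow> 'b \<Rightarrow> 'm"
    and N :: "('k, 'n, 'y) hom_space_scheme" and la :: "'b \<Rightarrow> 'n \<Rightarrow> 'n"
  assumes M: "module R M" and N: "module R N"
    and ra_closed: "m \<in> carrier M \<Longrightarrow> b \<in> carrier B \<Longrightarrow> ra m b \<in> carrier M"
    and la_closed: "b \<in> carrier B \<Longrightarrow> n \<in> carrier N \<Longrightarrow> la b n \<in> carrier N"
    and tw_M: "m \<in> carrier M \<Longrightarrow> twist M m \<in> carrier M"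
    and tw_N: "n \<in> carrier N \<Longrightarrow> twist N n \<in> carrier N"
begin

abbreviation "Q \<equiv> btensor R B M ra N la"
abbreviation "bt \<equiv> btens R B M ra N la"

lemma T_module: "module R (tensor R M N)"
  by (rule tensor_module[OF M N])

lemma ker_gens_closed:
  "{tens R M N (ra m b) (twist N n) \<ominus>\<^bsub>tensor R M N\<^esub> tens R M N (twist M m) (la b n) | m b n.
     m \<in> carrier M \<and> b \<in> carrier B \<and> n \<in> carrier N} \<subseteq> carrier (tensor R M N)"
proof -
  interpret T: module R "tensor R M N" by (rule T_module)
  show ?thesis
    by (auto intro!: T.minus_closed tens_closed M N ra_closed la_closed tw_M tw_N)
qed

lemma ker_submodule: "submodule (btensor_ker R B M ra N la) R (tensor R M N)"
  unfolding btensor_ker_def by (intro span_of_submodule T_module ker_gens_closed)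

lemma Q_module: "module R Q"
  unfolding btensor_def by (intro quotient_module T_module ker_submodule)

lemma coset_lin: "linear_on R (tensor R M N) Q (\<lambda>t. btensor_ker R B M ra N la +>\<^bsub>tensor R M N\<^esub> t)"
  unfolding btensor_def by (rule coset_linear[OF T_module ker_submodule])

lemma bt_bilinear: "bilinear_on R M N Q bt"
  unfolding btens_def
  by (intro bilinear_onI linear_on_comp[OF coset_lin] linear_on_tens_left linear_on_tens_right M N
      linear_on_id)

lemma bt_balanced:
  assumes "m \<in> carrier M" "b \<in> carrier B" "n \<in> carrier N"
  shows "bt (ra m b) (twist N n) = bt (twist M m) (la b n)"
  unfolding btens_def
  by (subst coset_eq_iff[OF T_module ker_submodule])
    (use assms in \<open>auto intro!: tens_closed M N ra_closed la_closed tw_M tw_N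
      subsetD[OF span_of_superset] simp: btensor_ker_def\<close>)

lemma blift_balanced:
  assumes "module R P" "bilinear_on R M N P f"
    and bal: "\<And>m b n. m \<in> carrier M \<Longrightarrow> b \<in> carrier B \<Longrightarrow> n \<in> carrier N \<Longrightarrow>
      f (ra m b) (twist N n) = f (twist M m) (la b n)"
  shows blift_linear: "linear_on R Q P (blift R M N P f)"
    and blift_bt: "m \<in> carrier M \<Longrightarrow> n \<in> carrier N \<Longrightarrow> blift R M N P f (bt m n) = f m n"
proof -
  note L = tlift_linear[OF M N assms(1,2)]
  have van: "tlift R M N P f t = \<zero>\<^bsub>P\<^esub>" if "t \<in> btensor_ker R B M ra N la" for t
  proof (rule vanishes_on_span[OF T_module assms(1) L(1) ker_gens_closed _
      that[unfolded btensor_ker_def]], clarify)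
    fix m b n assume "m \<in> carrier M" "b \<in> carrier B" "n \<in> carrier N"
    then show "tlift R M N P f (tens R M N (ra m b) (twist N n) \<ominus>\<^bsub>tensor R M N\<^esub> tens R M N
        (twist M m) (la b n)) = \<zero>\<^bsub>P\<^esub>"
      using bilinear_on_closed[OF assms(2)] bal
      by (simp add: linear_on_minus[OF T_module assms(1) L(1)] L(2) tens_closed M N ra_closed
          la_closed tw_M tw_N
          minus_eq_zero_iff[OF assms(1)])
  qed
  show "linear_on R Q P (blift R M N P f)"
    unfolding btensor_def blift_def by (rule quotient_lift_linear[OF T_module ker_submodule
        assms(1) L(1) van])
  show "blift R M N P f (bt m n) = f m n" if "m \<in> carrier M" "n \<in> carrier N"
    unfolding btens_def blift_def using that
    by (subst quotient_lift_eq[OF T_module ker_submodule assms(1) L(1) van])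
        (auto simp: L(2) tens_closed M N)
qed

lemma Q_some_rep:
  assumes "u \<in> carrier Q"
  shows "(SOME t. t \<in> u) \<in> carrier (tensor R M N)"
    "btensor_ker R B M ra N la +>\<^bsub>tensor R M N\<^esub> (SOME t. t \<in> u) = u"
  using quotient_some_rep[OF T_module ker_submodule assms[unfolded btensor_def]] by blast+

lemma Q_ext:
  assumes "module R P" "linear_on R Q P f" "linear_on R Q P g"
    and "\<And>m n. m \<in> carrier M \<Longrightarrow> n \<in> carrier N \<Longrightarrow> f (bt m n) = g (bt m n)"
    and "u \<in> carrier Q"
  shows "f u = g u"
proof -
  let ?c = "\<lambda>t. btensor_ker R B M ra N la +>\<^bsub>tensor R M N\<^esub> t"
  have "f (?c (SOME t. t \<in> u)) = g (?c (SOME t. t \<in> u))"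
    by (rule tensor_ext[OF M N assms(1) linear_on_comp[OF assms(2) coset_lin]
        linear_on_comp[OF assms(3) coset_lin]])
      (use assms(4) Q_some_rep[OF assms(5)] in \<open>auto simp: btens_def\<close>)
  then show ?thesis using Q_some_rep[OF assms(5)] by simp
qed

lemma linear_on_blift_param:
  assumes "module R P" "u \<in> carrier Q"
    and "\<And>a b. a \<in> carrier M \<Longrightarrow> b \<in> carrier N \<Longrightarrow> linear_on R X P (\<lambda>x. f x a b)"
  shows "linear_on R X P (\<lambda>x. blift R M N P (f x) u)"
  unfolding blift_def by (intro linear_on_tlift_param M N assms Q_some_rep)

end

section \<open>Rewriting under Sweedler sums\<close>

lemma finsum_cong_pointwise:
  assumes "\<And>i. i \<in> S \<Longrightarrow> f i = g i"
  shows "finsum P f S = finsum P g S"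
proof -
  \<comment> \<open>\<open>finsum\<close> is defined through \<open>foldSetD\<close>, whose
    derivations apply the function only to elements of \<open>S\<close>. Two functions that agree on
    \<open>S\<close> therefore have the same derivations, whether or not their values lie in the
    carrier of \<open>P\<close>.\<close>
  have mono: "(T, y) \<in> foldSetD D b e"
    if "(T, y) \<in> foldSetD D a e" "T \<subseteq> S" "\<And>x. x \<in> S \<Longrightarrow> a x = b x"
    for T y D and e and a b :: "'a \<Rightarrow> 'b \<Rightarrow> 'b"
    using that
  proof (induction rule: foldSetD.induct)
    case (insertI x A y)
    then have "a x = b x" by auto
    then show ?case using insertI foldSetD.insertI[of x A b y D e] by auto
  qed (rule foldSetD.emptyI)
  have "(S, y) \<in> foldSetD D (add P \<circ> f) e \<longleftrightarrow> (S, y) \<in> foldSetD D (add P \<circ> g) e" for y D e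
    using mono[of S y D "add P \<circ> f" e "add P \<circ> g"] mono[of S y D "add P \<circ> g" e "add P \<circ> f"] assms
    by auto
  then show ?thesis by (simp add: finsum_def finprod_def foldD_def)
qed

lemma tlift_cong_pointwise:
  assumes "module R M" "module R N" "t \<in> carrier (tensor R M N)"
    and "\<And>a b. a \<in> carrier M \<Longrightarrow> b \<in> carrier N \<Longrightarrow> f a b = g a b"
  shows "tlift R M N P f t = tlift R M N P g t"
  unfolding tlift_finsum
  by (rule finsum_cong_pointwise) (use tsupp(2)[OF assms(1-3)] assms(4) in auto)

text \<open>Shaped as a congruence rule: the simplifier first normalizes the tensor, then the
  summand under the assumptions that \<open>a\<close> and \<open>b\<close> lie in the carriers,
  which the closure rules in \<open>lin\<close> rely on.\<close>

lemma tlift_cong_simp: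
  assumes "t = t'" "t' \<in> carrier (tensor R M N)" "module R M" "module R N"
    and "\<And>a b. a \<in> carrier M \<Longrightarrow> b \<in> carrier N \<Longrightarrow> f a b = g a b"
  shows "tlift R M N P f t = tlift R M N P g t'"
  using tlift_cong_pointwise[OF assms(3,4,2)] assms(1,5) by auto

text \<open>
  In Sweedler notation: \<open>lin\<close> discharges closure and (multi)linearity side conditions, \<open>push\<close> moves
  linear maps into a sum \<^const>\<open>tlift\<close> and flattens nested sums, \<open>scl\<close> pulls out scalars, and \<open>tws\<close>
  moves the structure automorphisms and their inverses inwards, where they cancel.
\<close>

named_theorems lin
named_theorems push
named_theorems scl
named_theorems tws

lemma bilinear_on_iff [lin]:
  "bilinear_on R M N P f \<longleftrightarrow>
    (\<forall>x\<in>carrier M. linear_on R N P (\<lambda>y. f x y)) \<and> (\<forall>y\<in>carrier N. linear_on R M P (\<lambda>x. f x y))"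
  by (simp add: bilinear_on_def)

lemma trilinear_on_iff [lin]:
  "trilinear_on R M N L P f \<longleftrightarrow>
     (\<forall>y\<in>carrier N. \<forall>z\<in>carrier L. linear_on R M P (\<lambda>x. f x y z)) \<and>
     (\<forall>x\<in>carrier M. \<forall>z\<in>carrier L. linear_on R N P (\<lambda>y. f x y z)) \<and>
     (\<forall>x\<in>carrier M. \<forall>y\<in>carrier N. linear_on R L P (\<lambda>z. f x y z))"
  by (auto simp add: trilinear_on_def bilinear_on_def)

declare linear_on_id [lin] tensor_module [lin] tens_closed [lin] tlift_closed [lin]
  linear_on_tlift_param [lin] linear_on_tlift_arg [lin]
  linear_on_tens_left [lin] linear_on_tens_right [lin] linear_on_smult [lin] linear_on_smult_left
      [lin]

section \<open>Comodules and Hopf algebras without twist\<close>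

text \<open>Linear data only. Coassociativity and the right counit law come from
  \<open>comodule\<close>, once \<open>H\<close> is taken as a comodule over itself in
  \<open>hopf_algebra\<close>.\<close>

locale coalgebra =
  fixes R :: "('k, 'r) ring_scheme" and H :: "('k, 'h, 'x) module_scheme"
    and \<Delta> :: "'h \<Rightarrow> ('h \<times> 'h \<Rightarrow> 'k) set" and \<epsilon> :: "'h \<Rightarrow> 'k"
  assumes H [lin]: "module R H"
    and D_lin: "linear_on R H (tensor R H H) \<Delta>"
    and e_lin: "linear_on R H (scalar_space R) \<epsilon>"
begin

abbreviation "HH \<equiv> tensor R H H"

lemma D_closed [lin]: "h \<in> carrier H \<Longrightarrow> \<Delta> h \<in> carrier HH"
  by (rule linear_on_closed[OF D_lin])

lemma e_closed [lin]: "h \<in> carrier H \<Longrightarrow> \<epsilon> h \<in> carrier R"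
  using linear_on_closed[OF e_lin] by (simp add: scalar_space_def)

lemmas [lin] = module.smult_closed[OF H] linear_on_comp[OF D_lin] linear_on_comp[OF e_lin] D_lin
    e_lin

end

locale comodule = coalgebra R H \<Delta> \<epsilon> for R :: "('k, 'r) ring_scheme"
  and H :: "('k, 'h, 'x) module_scheme" and \<Delta> \<epsilon> +
  fixes M :: "('k, 'm, 'y) module_scheme" and \<rho> :: "'m \<Rightarrow> ('m \<times> 'h \<Rightarrow> 'k) set"
  assumes M [lin]: "module R M"
    and r_lin: "linear_on R M (tensor R M H) \<rho>"
    and coassoc_tens: "m \<in> carrier M \<Longrightarrow>
      tlift R M H (tensor R M HH) (\<lambda>a b. tens R M HH a (\<Delta> b)) (\<rho> m) =
      tlift R M H (tensor R M HH) (\<lambda>a b.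
        tlift R M H (tensor R M HH) (\<lambda>x y. tens R M HH x (tens R H H y b)) (\<rho> a)) (\<rho> m)"
    and counit: "m \<in> carrier M \<Longrightarrow> tlift R M H M (\<lambda>a b. \<epsilon> b \<odot>\<^bsub>M\<^esub> a) (\<rho> m) = m"
begin

abbreviation "sw P f m \<equiv> tlift R M H P f (\<rho> m)"

lemma r_closed [lin]: "h \<in> carrier M \<Longrightarrow> \<rho> h \<in> carrier (tensor R M H)"
  by (rule linear_on_closed[OF r_lin])

lemmas [lin] = module.smult_closed[OF M] linear_on_comp[OF r_lin] r_lin

text \<open>The trilinear lift of \<open>f\<close> is applied to both sides of
  \<open>coassoc_tens\<close>, so \<open>m\<^sub>0 \<otimes> m\<^sub>1 \<otimes> m\<^sub>2\<close>
  may be fed to \<open>f\<close> under either bracketing.\<close>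

lemma coassoc:
  assumes P: "module R P" and f: "trilinear_on R M H H P f" and m: "m \<in> carrier M"
  shows "sw P (\<lambda>a b. tlift R H H P (f a) (\<Delta> b)) m = sw P (\<lambda>a b. sw P (\<lambda>x y. f x y b) a) m"
proof -
  let ?L = "tlift R M HH P (\<lambda>x. tlift R H H P (f x))"
  have fs: "\<And>x. x \<in> carrier M \<Longrightarrow> bilinear_on R H H P (f x)" using f by (simp add: trilinear_on_def)
  have fc: "\<And>x y z. x \<in> carrier M \<Longrightarrow> y \<in> carrier H \<Longrightarrow> z \<in> carrier H \<Longrightarrow> f x y z \<in> carrier P"
    using bilinear_on_closed[OF fs] .
  note T = tensor_module[OF M tensor_module[OF H H]]
  note L = trilinear_lift_linear[OF M H H P f] and Lt = trilinear_lift_tens[OF M H H P f]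
  have "sw P (\<lambda>a b. tlift R H H P (f a) (\<Delta> b)) m = sw P (\<lambda>a b. ?L (tens R M HH a (\<Delta> b))) m"
    by (rule tlift_cong_pointwise) (simp_all add: lin Lt m)
  also have "\<dots> = ?L (sw (tensor R M HH) (\<lambda>a b. tens R M HH a (\<Delta> b)) m)"
    by (rule linear_tlift[symmetric]) (simp_all add: lin m L P T del: bilinear_on_iff)
  also have "\<dots> = ?L (tlift R M H (tensor R M HH) (\<lambda>a b.
        tlift R M H (tensor R M HH) (\<lambda>x y. tens R M HH x (tens R H H y b)) (\<rho> a)) (\<rho> m))"
    by (simp only: coassoc_tens[OF m])
  also have "\<dots> = sw P (\<lambda>a b. ?L (tlift R M H (tensor R M HH)
      (\<lambda>x y. tens R M HH x (tens R H H y b)) (\<rho> a))) m"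
    by (rule linear_tlift) (simp_all add: lin m L P T)
  also have "\<dots> = sw P (\<lambda>a b. sw P (\<lambda>x y. ?L (tens R M HH x (tens R H H y b))) a) m"
    by (intro tlift_cong_pointwise linear_tlift) (simp_all add: lin m L P T)
  also have "\<dots> = sw P (\<lambda>a b. sw P (\<lambda>x y. f x y b) a) m"
    by (intro tlift_cong_pointwise) (simp_all add: lin m Lt tlift_tens fs P del: bilinear_on_iff)
  finally show ?thesis .
qed

lemma counit_lin:
  assumes "module R P" "linear_on R M P f" "m \<in> carrier M"
  shows "sw P (\<lambda>a b. f (\<epsilon> b \<odot>\<^bsub>M\<^esub> a)) m = f m"
  using linear_tlift[OF M H M assms(1,2), of "\<lambda>a b. \<epsilon> b \<odot>\<^bsub>M\<^esub> a" "\<rho> m"] counit[OF assms(3)] assms(3)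
  by (simp add: lin)

end

lemma [push]:
  assumes "module R M" "module R N" "module R K" "module R L"
    and "\<And>a b. a \<in> carrier K \<Longrightarrow> b \<in> carrier L \<Longrightarrow> f a b \<in> carrier M"
    and "t \<in> carrier (tensor R K L)" "n \<in> carrier N"
  shows "tens R M N (tlift R K L M f t) n = tlift R K L (tensor R M N)
      (\<lambda>a b. tens R M N (f a b) n) t"
  by (rule linear_tlift) (simp_all add: assms lin)

lemma [push]:
  assumes "module R M" "module R N" "module R K" "module R L"
    and "\<And>a b. a \<in> carrier K \<Longrightarrow> b \<in> carrier L \<Longrightarrow> f a b \<in> carrier N"
    and "t \<in> carrier (tensor R K L)" "m \<in> carrier M"
  shows "tens R M N m (tlift R K L N f t) = tlift R K L (tensor R M N)
      (\<lambda>a b. tens R M N m (f a b)) t"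
  by (rule linear_tlift) (simp_all add: assms lin)

declare tlift_tlift [push] tlift_tens [push]

locale hopf_algebra = HC: comodule R H \<Delta> \<epsilon> H \<Delta> for R :: "('k, 'r) ring_scheme"
  and H :: "('k, 'h, 'x) module_scheme" and \<Delta> \<epsilon> +
  fixes hm :: "'h \<Rightarrow> 'h \<Rightarrow> 'h" (infixl "\<star>" 70) and u :: 'h and S :: "'h \<Rightarrow> 'h"
  assumes hm: "bilinear_on R H H H hm"
    and hm_assoc: "x \<in> carrier H \<Longrightarrow> y \<in> carrier H \<Longrightarrow> z \<in> carrier H \<Longrightarrow> x \<star> y \<star> z = x \<star> (y \<star> z)"
    and u_closed [lin]: "u \<in> carrier H"
    and hm_unit: "x \<in> carrier H \<Longrightarrow> x \<star> u = x" "x \<in> carrier H \<Longrightarrow> u \<star> x = x"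
    and left_counit: "h \<in> carrier H \<Longrightarrow> tlift R H H H (\<lambda>a b. \<epsilon> a \<odot>\<^bsub>H\<^esub> b) (\<Delta> h) = h"
    and D_mult: "g \<in> carrier H \<Longrightarrow> h \<in> carrier H \<Longrightarrow> \<Delta> (g \<star> h) =
      tlift R H H (tensor R H H) (\<lambda>a b. tlift R H H (tensor R H H)
          (\<lambda>c d. tens R H H (a \<star> c) (b \<star> d)) (\<Delta> h)) (\<Delta> g)"
    and D_u: "\<Delta> u = tens R H H u u"
    and e_mult: "g \<in> carrier H \<Longrightarrow> h \<in> carrier H \<Longrightarrow> \<epsilon> (g \<star> h) = \<epsilon> g \<otimes>\<^bsub>R\<^esub> \<epsilon> h"
    and e_u: "\<epsilon> u = \<one>\<^bsub>R\<^esub>"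
    and S_lin: "linear_on R H H S"
    and S_left: "h \<in> carrier H \<Longrightarrow> tlift R H H H (\<lambda>a b. S a \<star> b) (\<Delta> h) = \<epsilon> h \<odot>\<^bsub>H\<^esub> u"
    and S_right: "h \<in> carrier H \<Longrightarrow> tlift R H H H (\<lambda>a b. a \<star> S b) (\<Delta> h) = \<epsilon> h \<odot>\<^bsub>H\<^esub> u"
begin

abbreviation "T \<equiv> tensor R H H"
abbreviation "D P f h \<equiv> tlift R H H P f (\<Delta> h)"

lemma hm_closed [lin]: "x \<in> carrier H \<Longrightarrow> y \<in> carrier H \<Longrightarrow> x \<star> y \<in> carrier H"
  by (rule bilinear_on_closed[OF hm])
lemma S_closed [lin]: "x \<in> carrier H \<Longrightarrow> S x \<in> carrier H"
  by (rule linear_on_closed[OF S_lin])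
lemmas [lin] = linear_on_comp[OF bilinear_on_left[OF hm]]
    linear_on_comp[OF bilinear_on_right[OF hm]]
  linear_on_comp[OF S_lin] S_lin

lemma [push]:
  assumes "module R K" "module R L"
    and "\<And>a b. a \<in> carrier K \<Longrightarrow> b \<in> carrier L \<Longrightarrow> f a b \<in> carrier H"
    and "t \<in> carrier (tensor R K L)"
  shows hm_push1: "n \<in> carrier H \<Longrightarrow> (tlift R K L H f t) \<star> n = tlift R K L H (\<lambda>a b. f a b \<star> n) t"
    and hm_push2: "n \<in> carrier H \<Longrightarrow> n \<star> (tlift R K L H f t) = tlift R K L H (\<lambda>a b. n \<star> f a b) t"
    and S_push: "S (tlift R K L H f t) = tlift R K L H (\<lambda>a b. S (f a b)) t"
    and D_push: "\<Delta> (tlift R K L H f t) = tlift R K L T (\<lambda>a b. \<Delta> (f a b)) t"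
  by (rule linear_tlift; simp add: assms lin)+

lemma left_counit_lin:
  assumes "module R P" "linear_on R H P f" "h \<in> carrier H"
  shows "D P (\<lambda>a b. f (\<epsilon> a \<odot>\<^bsub>H\<^esub> b)) h = f h"
  using linear_tlift[OF HC.M HC.M HC.M assms(1,2), of "\<lambda>a b. \<epsilon> a \<odot>\<^bsub>H\<^esub> b" "\<Delta> h"]
      left_counit[OF assms(3)]
    assms(3)
  by (simp add: lin)

text \<open>The antipode law turns the inner sum into \<epsilon>(k) times \<open>u\<close>; that
  scalar is moved to the other argument of \<open>F\<close>, where the left counit law absorbs it.
  For arbitrary \<open>F\<close> this is
  \<open>S(h\<^sub>1) h\<^sub>2 \<otimes> h\<^sub>3 = 1 \<otimes> h\<close>.\<close>

lemma S_left2: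
  assumes "module R P" "bilinear_on R H H P F" "h \<in> carrier H"
  shows "D P (\<lambda>k c. D P (\<lambda>p q. F (S p \<star> q) c) k) h = F u h"
proof -
  note [lin] = linear_on_comp[OF bilinear_on_left[OF assms(2)]]
      linear_on_comp[OF bilinear_on_right[OF assms(2)]]
    bilinear_on_closed[OF assms(2)] assms(1,3) bilinear_on_left[OF assms(2)]
        bilinear_on_right[OF assms(2)]
  note sc = linear_on_scale[OF bilinear_on_left[OF assms(2)]]
      linear_on_scale[OF bilinear_on_right[OF assms(2)]]
  have "D P (\<lambda>k c. D P (\<lambda>p q. F (S p \<star> q) c) k) h = D P (\<lambda>k c. F (D H (\<lambda>p q. S p \<star> q) k) c) h"
    by (intro tlift_cong_pointwise linear_tlift[symmetric, where g="\<lambda>x. F x _"]; simp add: lin)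
  also have "\<dots> = D P (\<lambda>k c. F u (\<epsilon> k \<odot>\<^bsub>H\<^esub> c)) h"
    by (intro tlift_cong_pointwise; simp add: lin S_left sc)
  also have "\<dots> = F u h"
    by (rule left_counit_lin) (simp_all add: lin)
  finally show ?thesis .
qed

lemma
  assumes "comodule R H \<Delta> \<epsilon> N \<rho>" "module R P" "bilinear_on R N H P F" "n \<in> carrier N"
  shows S_right2: "tlift R N H P (\<lambda>m c. D P (\<lambda>q r. F m (q \<star> S r)) c) (\<rho> n) = F n u"
    and S_left3: "tlift R N H P (\<lambda>m c. D P (\<lambda>q r. F m (S q \<star> r)) c) (\<rho> n) = F n u"
proof -
  interpret NC: comodule R H \<Delta> \<epsilon> N \<rho> by fact
  note [lin] = linear_on_comp[OF bilinear_on_left[OF assms(3)]]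
      linear_on_comp[OF bilinear_on_right[OF assms(3)]]
    bilinear_on_closed[OF assms(3)] assms(2,4) bilinear_on_left[OF assms(3)]
        bilinear_on_right[OF assms(3)]
  note sc = linear_on_scale[OF bilinear_on_left[OF assms(3)]]
      linear_on_scale[OF bilinear_on_right[OF assms(3)]]
  \<comment> \<open>The scalar left over by the antipode law is carried from the
    \<open>H\<close>-slot to the \<open>N\<close>-slot, where the counit law of the comodule
    applies; both claims end in this sum.\<close>
  have fin: "NC.sw P (\<lambda>m c. F m (\<epsilon> c \<odot>\<^bsub>H\<^esub> u)) n = F n u"
  proof -
    have "NC.sw P (\<lambda>m c. F m (\<epsilon> c \<odot>\<^bsub>H\<^esub> u)) n = NC.sw P (\<lambda>m c. F (\<epsilon> c \<odot>\<^bsub>N\<^esub> m) u) n"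
      by (intro tlift_cong_pointwise; simp add: lin sc)
    also have "\<dots> = F n u"
      by (rule NC.counit_lin) (simp_all add: lin)
    finally show ?thesis .
  qed
  have "NC.sw P (\<lambda>m c. D P (\<lambda>q r. F m (q \<star> S r)) c) n = NC.sw P
      (\<lambda>m c. F m (D H (\<lambda>p q. p \<star> S q) c)) n"
    by (intro tlift_cong_pointwise linear_tlift[symmetric, where g="\<lambda>x. F _ x"]; simp add: lin)
  also have "\<dots> = NC.sw P (\<lambda>m c. F m (\<epsilon> c \<odot>\<^bsub>H\<^esub> u)) n"
    by (intro tlift_cong_pointwise; simp add: lin S_right)
  finally show "NC.sw P (\<lambda>m c. D P (\<lambda>q r. F m (q \<star> S r)) c) n = F n u" using fin by simp
  have "NC.sw P (\<lambda>m c. D P (\<lambda>q r. F m (S q \<star> r)) c) n = NC.sw P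
      (\<lambda>m c. F m (D H (\<lambda>p q. S p \<star> q) c)) n"
    by (intro tlift_cong_pointwise linear_tlift[symmetric, where g="\<lambda>x. F _ x"]; simp add: lin)
  also have "\<dots> = NC.sw P (\<lambda>m c. F m (\<epsilon> c \<odot>\<^bsub>H\<^esub> u)) n"
    by (intro tlift_cong_pointwise; simp add: lin S_left)
  finally show "NC.sw P (\<lambda>m c. D P (\<lambda>q r. F m (S q \<star> r)) c) n = F n u" using fin by simp
qed

lemma S_u: "S u = u"
proof -
  have "D H (\<lambda>a b. S a \<star> b) u = S u"
    by (simp add: D_u push lin hm_unit)
  moreover have "D H (\<lambda>a b. S a \<star> b) u = u"
    using S_left[of u] module.smult_one[OF HC.M] by (simp add: lin e_u)
  ultimately show ?thesis by simp
qed

text \<open>Both sides compute \<open>S(h\<^sub>1) h\<^sub>2 S(h\<^sub>4)\<^sub>1 \<otimes> h\<^sub>3 S(h\<^sub>4)\<^sub>2\<close>.\<close>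

lemma S_coinv:
  assumes h: "h \<in> carrier H"
  shows "D T (\<lambda>a b. D T (\<lambda>x y. tens R H H x (a \<star> y)) (S b)) h = tens R H H (S h) u"
proof -
  note h [lin]
  define F where "F p q r s = D T (\<lambda>x y. tens R H H ((S p \<star> q) \<star> x) (r \<star> y)) (S s)" for p q r s
  define G where "G z c = D T (\<lambda>r s. D T (\<lambda>x y. tens R H H (z \<star> x) (r \<star> y)) (S s)) c" for z c
  define L where "L p t = tlift R H H T (\<lambda>x y. tens R H H (S p \<star> x) y) t" for p t
  have G_lin [lin]: "c \<in> carrier H \<Longrightarrow> linear_on R X H f \<Longrightarrow> linear_on R X T (\<lambda>z. G (f z) c)"
     "z \<in> carrier H \<Longrightarrow> linear_on R X H f \<Longrightarrow> linear_on R X T (\<lambda>c. G z (f c))" for X :: "('k, 'h, 'z)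
         module_scheme" and f z c
    by (simp_all add: G_def lin)
  have F_lin [lin]: "\<lbrakk>q \<in> carrier H; r \<in> carrier H; s \<in> carrier H\<rbrakk>
      \<Longrightarrow> linear_on R H T (\<lambda>p. F p q r s)"
     "\<lbrakk>p \<in> carrier H; r \<in> carrier H; s \<in> carrier H\<rbrakk> \<Longrightarrow> linear_on R H T (\<lambda>q. F p q r s)"
     "\<lbrakk>p \<in> carrier H; q \<in> carrier H; s \<in> carrier H\<rbrakk> \<Longrightarrow> linear_on R H T (\<lambda>r. F p q r s)"
     "\<lbrakk>p \<in> carrier H; q \<in> carrier H; r \<in> carrier H\<rbrakk> \<Longrightarrow> linear_on R H T (\<lambda>s. F p q r s)" for p q r s
    by (simp_all add: F_def lin)
  have L_lin: "linear_on R T T (L p)" if "p \<in> carrier H" for p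
    unfolding L_def by (rule tlift_linear) (simp_all add: lin that)
  \<comment> \<open>Read from the left: \<open>S(h\<^sub>1) h\<^sub>2\<close> collapses, which
    leaves the left-hand side of the claim.\<close>
  have "D T (\<lambda>p b. D T (\<lambda>q c. G (S p \<star> q) c) b) h = D T (\<lambda>k c. D T (\<lambda>p q. G (S p \<star> q) c) k) h"
    by (rule HC.coassoc) (simp_all add: lin)
  also have "\<dots> = G u h"
    by (rule S_left2) (simp_all add: lin)
  also have "\<dots> = D T (\<lambda>a b. D T (\<lambda>x y. tens R H H x (a \<star> y)) (S b)) h"
    unfolding G_def by (intro tlift_cong_pointwise; simp add: lin hm_unit)
  finally have 1: "D T (\<lambda>p b. D T (\<lambda>q c. G (S p \<star> q) c) b) h = \<dots>" .
  \<comment> \<open>Read from the right: by multiplicativity of \<Delta> the remaining factors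
    combine to \<open>\<Delta>(b\<^sub>1 S(b\<^sub>2))\<close>, which is \<epsilon>(b) times
    \<open>u \<otimes> u\<close>; only \<open>S p\<close> in the first leg is left.\<close>
  have inner: "D T (\<lambda>q c. G (S p \<star> q) c) b = \<epsilon> b \<odot>\<^bsub>T\<^esub> tens R H H (S p) u"
    if [lin]: "p \<in> carrier H" "b \<in> carrier H" for p b
  proof -
    have "D T (\<lambda>q c. G (S p \<star> q) c) b = D T (\<lambda>q c. D T (\<lambda>r s. F p q r s) c) b"
      by (simp add: F_def G_def)
    also have "\<dots> = D T (\<lambda>k s. D T (\<lambda>q r. F p q r s) k) b"
      by (rule HC.coassoc) (simp_all add: lin)
    also have "\<dots> = D T (\<lambda>k s. L p (\<Delta> (k \<star> S s))) b"
    proof (intro tlift_cong_pointwise)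
      fix k s assume [lin]: "k \<in> carrier H" "s \<in> carrier H"
      have "L p (\<Delta> (k \<star> S s)) = D T (\<lambda>a b. D T (\<lambda>c d. tens R H H (S p \<star> (a \<star> c)) (b \<star> d)) (S s)) k"
        by (simp add: L_def D_mult push lin cong: tlift_cong_simp)
      also have "\<dots> = D T (\<lambda>q r. F p q r s) k"
        unfolding F_def by (intro tlift_cong_pointwise; simp add: lin hm_assoc)
      finally show "D T (\<lambda>q r. F p q r s) k = L p (\<Delta> (k \<star> S s))" by simp
    qed (simp_all add: lin)
    also have "\<dots> = L p (\<Delta> (D H (\<lambda>k s. k \<star> S s) b))"
      by (rule linear_tlift[symmetric, where g="\<lambda>x. L p (\<Delta> x)"])
          (simp_all add: lin linear_on_comp[OF L_lin])
    also have "\<dots> = \<epsilon> b \<odot>\<^bsub>T\<^esub> L p (tens R H H u u)"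
      by (simp add: S_right lin linear_on_scale[OF HC.D_lin] linear_on_scale[OF L_lin] D_u)
    also have "\<dots> = \<epsilon> b \<odot>\<^bsub>T\<^esub> tens R H H (S p) u"
      by (simp add: L_def push lin hm_unit)
    finally show ?thesis .
  qed
  have "D T (\<lambda>p b. D T (\<lambda>q c. G (S p \<star> q) c) b) h = D T (\<lambda>p b. tens R H H (S (\<epsilon> b \<odot>\<^bsub>H\<^esub> p)) u) h"
    by (intro tlift_cong_pointwise; simp add: lin inner linear_on_scale[OF S_lin] tens_smult_left)
  also have "\<dots> = tens R H H (S h) u"
    by (rule HC.counit_lin) (simp_all add: lin)
  finally show ?thesis using 1 by simp
qed

end

text \<open>Coassociativity in two independent elements whose sums are interleaved:
  \<open>tlift_swap\<close> separates the sums so that it can be used once for \<open>n\<close> and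
  once for \<open>m\<close>. It serves the two factors of a product in \<open>S_antimult\<close>,
  and the two arguments of the trace in \<open>tr_coinv\<close>.\<close>

lemma double_coassoc:
  fixes R :: "('k, 'r) ring_scheme" and H :: "('k, 'h, 'x) module_scheme"
    and M :: "('k, 'm, 'y) module_scheme" and N :: "('k, 'n, 'z) module_scheme"
    and P :: "('k, 'p, 'w) module_scheme"
  assumes "comodule R H \<Delta> \<epsilon> M \<rho>" "comodule R H \<Delta> \<epsilon> N \<sigma>" and P: "module R P"
    and f1: "\<And>z w q. z \<in> carrier N \<Longrightarrow> w \<in> carrier H \<Longrightarrow> q \<in> carrier H \<Longrightarrow>
      trilinear_on R M H H P (\<lambda>x y p. f x y p z w q)"
    and f2: "\<And>x y p. x \<in> carrier M \<Longrightarrow> y \<in> carrier H \<Longrightarrow> p \<in> carrier H \<Longrightarrow>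
      trilinear_on R N H H P (\<lambda>z w q. f x y p z w q)"
    and m [lin]: "m \<in> carrier M" and n [lin]: "n \<in> carrier N"
  shows "tlift R M H P (\<lambda>m0 m1. tlift R N H P (\<lambda>n0 n1. tlift R M H P (\<lambda>x y. tlift R N H P (\<lambda>z w.
      f x y m1 z w n1) (\<sigma> n0)) (\<rho> m0)) (\<sigma> n)) (\<rho> m) =
    tlift R M H P (\<lambda>m0 m1. tlift R N H P (\<lambda>n0 n1. tlift R H H P (\<lambda>y p. tlift R H H P (\<lambda>w q.
      f m0 y p n0 w q) (\<Delta> n1)) (\<Delta> m1)) (\<sigma> n)) (\<rho> m)"
proof -
  interpret MC: comodule R H \<Delta> \<epsilon> M \<rho> by fact
  interpret NC: comodule R H \<Delta> \<epsilon> N \<sigma> by fact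
  note [lin] = P
  have l [lin]: "\<lbrakk>y \<in> carrier H; p \<in> carrier H; z \<in> carrier N; w \<in> carrier H; q \<in> carrier H\<rbrakk> \<Longrightarrow>
      linear_on R M P (\<lambda>x. f x y p z w q)"
    "\<lbrakk>x \<in> carrier M; p \<in> carrier H; z \<in> carrier N; w \<in> carrier H; q \<in> carrier H\<rbrakk> \<Longrightarrow>
      linear_on R H P (\<lambda>y. f x y p z w q)"
    "\<lbrakk>x \<in> carrier M; y \<in> carrier H; z \<in> carrier N; w \<in> carrier H; q \<in> carrier H\<rbrakk> \<Longrightarrow>
      linear_on R H P (\<lambda>p. f x y p z w q)"
    "\<lbrakk>x \<in> carrier M; y \<in> carrier H; p \<in> carrier H; w \<in> carrier H; q \<in> carrier H\<rbrakk> \<Longrightarrow>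
      linear_on R N P (\<lambda>z. f x y p z w q)"
    "\<lbrakk>x \<in> carrier M; y \<in> carrier H; p \<in> carrier H; z \<in> carrier N; q \<in> carrier H\<rbrakk> \<Longrightarrow>
      linear_on R H P (\<lambda>w. f x y p z w q)"
    "\<lbrakk>x \<in> carrier M; y \<in> carrier H; p \<in> carrier H; z \<in> carrier N; w \<in> carrier H\<rbrakk> \<Longrightarrow>
      linear_on R H P (\<lambda>q. f x y p z w q)" for x y p z w q
    using f1 f2 by (simp_all add: trilinear_on_iff)
  have [lin]: "f x y p z w q \<in> carrier P" if "x \<in> carrier M" "y \<in> carrier H" "p \<in> carrier H"
    "z \<in> carrier N" "w \<in> carrier H" "q \<in> carrier H" for x y p z w q
    using linear_on_closed[OF l(1)] that by blast
  have "MC.sw P (\<lambda>m0 m1. NC.sw P (\<lambda>n0 n1. MC.sw P (\<lambda>x y. NC.sw P (\<lambda>z w. f x y m1 z w n1) n0) m0)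
      n) m
    = MC.sw P (\<lambda>m0 m1. MC.sw P (\<lambda>x y. NC.sw P (\<lambda>n0 n1. NC.sw P (\<lambda>z w. f x y m1 z w n1) n0) n) m0) m"
    by (intro tlift_cong_pointwise tlift_swap; simp add: lin)
  also have "\<dots> = MC.sw P (\<lambda>m0 m1. MC.sw P (\<lambda>x y. NC.sw P
      (\<lambda>n0 n1. tlift R H H P (\<lambda>w q. f x y m1 n0 w q) (\<Delta> n1)) n) m0) m"
    by (intro tlift_cong_pointwise NC.coassoc[symmetric]; simp add: lin)
  also have "\<dots> = MC.sw P (\<lambda>m0 m1. tlift R H H P
      (\<lambda>y p. NC.sw P (\<lambda>n0 n1. tlift R H H P (\<lambda>w q. f m0 y p n0 w q) (\<Delta> n1)) n) (\<Delta> m1)) m"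
    by (rule MC.coassoc[symmetric]; simp add: lin)
  also have "\<dots> = MC.sw P (\<lambda>m0 m1. NC.sw P (\<lambda>n0 n1. tlift R H H P
      (\<lambda>y p. tlift R H H P (\<lambda>w q. f m0 y p n0 w q) (\<Delta> n1)) (\<Delta> m1)) n) m"
    by (intro tlift_cong_pointwise tlift_swap; simp add: lin)
  finally show ?thesis .
qed

lemma [scl]:
  assumes "module R M" "module R N" "r \<in> carrier R"
  shows "m \<in> carrier M \<Longrightarrow> n \<in> carrier N \<Longrightarrow> tens R M N (r \<odot>\<^bsub>M\<^esub> m) n = r \<odot>\<^bsub>tensor R M N\<^esub> tens R M N m n"
    and "m \<in> carrier M \<Longrightarrow> n \<in> carrier N \<Longrightarrow> tens R M N m (r \<odot>\<^bsub>N\<^esub> n) = r \<odot>\<^bsub>tensor R M N\<^esub> tens R M N m n"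
  using tens_rels[OF assms(1,2)] assms(3) by auto

section \<open>Antimultiplicativity of the antipode\<close>

context hopf_algebra begin

lemmas [scl] = linear_on_scale[OF S_lin] linear_on_scale[OF bilinear_on_left[OF hm]]
  linear_on_scale[OF bilinear_on_right[OF hm]]

text \<open>Uniqueness of inverses under convolution: \<open>S(gh)\<close> is a left inverse and
  \<open>S(h) S(g)\<close> a right inverse of the multiplication, so the triple product
  \<open>S(g\<^sub>1 h\<^sub>1) (g\<^sub>2 h\<^sub>2) (S(h\<^sub>3) S(g\<^sub>3))\<close> equals
  both.\<close>

lemma S_antimult:
  assumes g: "g \<in> carrier H" and h: "h \<in> carrier H"
  shows "S (g \<star> h) = S h \<star> S g"
proof -
  note [lin] = g h
  define f where "f g1 g2 g3 h1 h2 h3 = S (g1 \<star> h1) \<star> ((g2 \<star> h2) \<star> (S h3 \<star> S g3))" for g1 g2 g3 h1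
      h2 h3
  have *: "D H (\<lambda>m0 m1. D H (\<lambda>n0 n1. D H (\<lambda>x y. D H (\<lambda>z w. f x y m1 z w n1) n0) m0) h) g =
    D H (\<lambda>m0 m1. D H (\<lambda>n0 n1. D H (\<lambda>y p. D H (\<lambda>w q. f m0 y p n0 w q) n1) m1) h) g"
    by (rule double_coassoc[OF HC.comodule_axioms HC.comodule_axioms HC.H]; simp add: f_def lin)
  \<comment> \<open>The first two legs of both elements form \<open>S(x\<^sub>1) x\<^sub>2\<close>
    for \<open>x = m0 \<star> n0\<close>.\<close>
  have 1: "D H (\<lambda>x y. D H (\<lambda>z w. f x y m1 z w n1) n0) m0 = S (\<epsilon> n0 \<odot>\<^bsub>H\<^esub> n1) \<star> S (\<epsilon> m0 \<odot>\<^bsub>H\<^esub> m1)"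
    if [lin]: "m0 \<in> carrier H" "m1 \<in> carrier H" "n0 \<in> carrier H" "n1 \<in> carrier H" for m0 m1 n0 n1
  proof -
    have "D H (\<lambda>a b. S a \<star> b) (m0 \<star> n0) \<star> (S n1 \<star> S m1) = D H
        (\<lambda>x y. D H (\<lambda>z w. f x y m1 z w n1) n0) m0"
      by (simp add: D_mult push lin f_def hm_assoc cong: tlift_cong_simp)
    then show ?thesis by (simp add: S_left lin scl e_mult hm_unit module.smult_assoc1[OF HC.H])
  qed
  \<comment> \<open>The last two legs collapse from the inside: first \<open>w \<star> S q\<close>,
    and then, after its scalar is pulled out, \<open>y \<star> S p\<close>.\<close>
  have 2: "D H (\<lambda>y p. D H (\<lambda>w q. f m0 y p n0 w q) n1) m1 = S ((\<epsilon> m1 \<odot>\<^bsub>H\<^esub> m0) \<star> (\<epsilon> n1 \<odot>\<^bsub>H\<^esub> n0))"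
    if [lin]: "m0 \<in> carrier H" "m1 \<in> carrier H" "n0 \<in> carrier H" "n1 \<in> carrier H" for m0 m1 n0 n1
  proof -
    have "D H (\<lambda>y p. D H (\<lambda>w q. f m0 y p n0 w q) n1) m1 = D H
        (\<lambda>y p. S (m0 \<star> n0) \<star> (y \<star> (D H (\<lambda>w q. w \<star> S q) n1 \<star> S p))) m1"
      by (simp add: push lin f_def hm_assoc cong: tlift_cong_simp)
    also have "\<dots> = S (m0 \<star> n0) \<star> (\<epsilon> n1 \<odot>\<^bsub>H\<^esub> D H (\<lambda>w q. w \<star> S q) m1)"
      by (subst linear_tlift[where g="\<lambda>x. S (m0 \<star> n0) \<star> (\<epsilon> n1 \<odot>\<^bsub>H\<^esub> x)"])
        (simp_all add: S_right lin hm_unit scl cong: tlift_cong_simp)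
    also have "\<dots> = S ((\<epsilon> m1 \<odot>\<^bsub>H\<^esub> m0) \<star> (\<epsilon> n1 \<odot>\<^bsub>H\<^esub> n0))"
      by (simp add: S_right lin scl hm_unit)
    finally show ?thesis .
  qed
  have "D H (\<lambda>m0 m1. D H (\<lambda>n0 n1. S (\<epsilon> n0 \<odot>\<^bsub>H\<^esub> n1) \<star> S (\<epsilon> m0 \<odot>\<^bsub>H\<^esub> m1)) h) g =
    D H (\<lambda>m0 m1. S h \<star> S (\<epsilon> m0 \<odot>\<^bsub>H\<^esub> m1)) g"
    by (intro tlift_cong_pointwise left_counit_lin[where f="\<lambda>x. S x \<star> _"]; simp add: lin)
  also have "\<dots> = S h \<star> S g"
    by (rule left_counit_lin[where f="\<lambda>x. _ \<star> S x"]; simp add: lin)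
  finally have 3: "D H (\<lambda>m0 m1. D H (\<lambda>n0 n1. D H (\<lambda>x y. D H (\<lambda>z w. f x y m1 z w n1) n0) m0) h) g =
      S h \<star> S g"
    by (simp add: 1 lin cong: tlift_cong_simp)
  have "D H (\<lambda>m0 m1. D H (\<lambda>n0 n1. S ((\<epsilon> m1 \<odot>\<^bsub>H\<^esub> m0) \<star> (\<epsilon> n1 \<odot>\<^bsub>H\<^esub> n0))) h) g =
    D H (\<lambda>m0 m1. S ((\<epsilon> m1 \<odot>\<^bsub>H\<^esub> m0) \<star> h)) g"
    by (intro tlift_cong_pointwise HC.counit_lin[where f="\<lambda>x. S (_ \<star> x)"]; simp add: lin)
  also have "\<dots> = S (g \<star> h)"
    by (rule HC.counit_lin[where f="\<lambda>x. S (x \<star> _)"]; simp add: lin)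
  finally have "D H (\<lambda>m0 m1. D H (\<lambda>n0 n1. D H (\<lambda>y p. D H (\<lambda>w q. f m0 y p n0 w q) n1) m1) h) g =
      S (g \<star> h)"
    by (simp add: 2 lin cong: tlift_cong_simp)
  then show ?thesis using 3 * by simp
qed

end

section \<open>The inverse antipode\<close>

locale hopf_algebra_bij = hopf_algebra R H \<Delta> \<epsilon> hm u S for R :: "('k, 'r) ring_scheme" and H ::
    "('k, 'h, 'x) module_scheme" and \<Delta> \<epsilon> and hm :: "'h \<Rightarrow> 'h \<Rightarrow> 'h" (infixl "\<star>" 70) and u S +
  fixes S' :: "'h \<Rightarrow> 'h"
  assumes S'_lin: "linear_on R H H S'"
    and SS': "h \<in> carrier H \<Longrightarrow> S (S' h) = h" and S'S: "h \<in> carrier H \<Longrightarrow> S' (S h) = h"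
begin

lemma S'_closed [lin]: "x \<in> carrier H \<Longrightarrow> S' x \<in> carrier H"
  by (rule linear_on_closed[OF S'_lin])
lemmas [lin] = linear_on_comp[OF S'_lin] S'_lin

lemma S_inj: "x \<in> carrier H \<Longrightarrow> y \<in> carrier H \<Longrightarrow> S x = S y \<Longrightarrow> x = y"
  by (metis S'S)

text \<open>\<open>S'\<close> is the antipode of \<open>H\<close> with opposite product and
  unchanged coproduct: its two laws are checked after applying the injective map \<open>S\<close>,
  which reverses products and turns them into \<open>S_right\<close> and \<open>S_left\<close>.
  Every statement about \<open>S\<close> thereby becomes one about \<open>S'\<close> with products
  reversed.\<close>

sublocale op: hopf_algebra R H \<Delta> \<epsilon> "\<lambda>x y. y \<star> x" u S'
proof unfold_locales
  show "bilinear_on R H H H (\<lambda>x y. y \<star> x)" by (simp add: lin)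
  fix g h assume [lin]: "g \<in> carrier H" "h \<in> carrier H"
  show "\<Delta> (h \<star> g) = D T (\<lambda>a b. D T (\<lambda>c d. tens R H H (c \<star> a) (d \<star> b)) h) g"
    by (subst D_mult, simp_all add: lin, rule tlift_swap) (simp_all add: lin)
  show "\<epsilon> (h \<star> g) = \<epsilon> g \<otimes>\<^bsub>R\<^esub> \<epsilon> h"
    using e_mult[of h g] cring.cring_simprules(14)[OF module.axioms(1)[OF HC.H]] by (simp add: lin)
  have "S (D H (\<lambda>a b. b \<star> S' a) h) = S (\<epsilon> h \<odot>\<^bsub>H\<^esub> u)"
    by (simp add: push lin S_antimult SS' S_right scl S_u cong: tlift_cong_simp)
  then show "D H (\<lambda>a b. b \<star> S' a) h = \<epsilon> h \<odot>\<^bsub>H\<^esub> u"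
    by (rule S_inj[rotated 2]) (simp_all add: lin)
  have "S (D H (\<lambda>a b. S' b \<star> a) h) = S (\<epsilon> h \<odot>\<^bsub>H\<^esub> u)"
    by (simp add: push lin S_antimult SS' S_left scl S_u cong: tlift_cong_simp)
  then show "D H (\<lambda>a b. S' b \<star> a) h = \<epsilon> h \<odot>\<^bsub>H\<^esub> u"
    by (rule S_inj[rotated 2]) (simp_all add: lin)
qed (simp_all add: lin hm_assoc hm_unit left_counit D_u e_u)

end

section \<open>The generalized trace of a Hopf module\<close>

text \<open>\<sigma> takes the place of the translation map
  \<open>h \<mapsto> can\<^sup>-\<^sup>1(1 \<otimes> h)\<close>. It has values in
  \<open>A \<otimes> A\<close> and is one chosen linear lift, because \<open>can\<close> is given as
  surjective rather than bijective.\<close>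

locale comodule_algebra = hopf_algebra_bij R H \<Delta> \<epsilon> hm u S S' + AC: comodule R H \<Delta> \<epsilon> A \<rho>\<^sub>A
  for R :: "('k, 'r) ring_scheme" and H :: "('k, 'h, 'x) module_scheme" and \<Delta> \<epsilon>
    and hm :: "'h \<Rightarrow> 'h \<Rightarrow> 'h" (infixl "\<star>" 70) and u S S'
    and A :: "('k, 'a, 'y) module_scheme" and \<rho>\<^sub>A +
  fixes am :: "'a \<Rightarrow> 'a \<Rightarrow> 'a" (infixl "\<bullet>" 70) and e :: 'a and \<phi> :: "'h \<Rightarrow> 'a"
    and \<sigma> :: "'h \<Rightarrow> ('a \<times> 'a \<Rightarrow> 'k) set"
  assumes am: "bilinear_on R A A A am"
    and am_assoc: "x \<in> carrier A \<Longrightarrow> y \<in> carrier A \<Longrightarrow> z \<in> carrier A \<Longrightarrow> x \<bullet> y \<bullet> z = x \<bullet> (y \<bullet> z)"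
    and one_closed [lin]: "e \<in> carrier A"
    and am_unit: "x \<in> carrier A \<Longrightarrow> x \<bullet> e = x" "x \<in> carrier A \<Longrightarrow> e \<bullet> x = x"
    and A_mult: "x \<in> carrier A \<Longrightarrow> y \<in> carrier A \<Longrightarrow> \<rho>\<^sub>A (x \<bullet> y) =
      AC.sw (tensor R A H) (\<lambda>a b. AC.sw (tensor R A H) (\<lambda>c d. tens R A H (a \<bullet> c) (b \<star> d)) y) x"
    and A_one: "\<rho>\<^sub>A e = tens R A H e u"
    and phi_lin: "linear_on R H A \<phi>"
    and phi_colin: "h \<in> carrier H \<Longrightarrow> \<rho>\<^sub>A (\<phi> h) = D (tensor R A H) (\<lambda>a b. tens R A H (\<phi> a) b) h"
    and phi_u: "\<phi> u = e"
    and sigma_lin: "linear_on R H (tensor R A A) \<sigma>"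
    and sigma: "h \<in> carrier H \<Longrightarrow>
      tlift R A A (tensor R A H) (\<lambda>r l. AC.sw (tensor R A H) (\<lambda>x y. tens R A H (r \<bullet> x) y) l) (\<sigma> h)
          = tens R A H e h"
begin

abbreviation "AH \<equiv> tensor R A H"
abbreviation "sig P f h \<equiv> tlift R A A P f (\<sigma> h)"

lemma am_closed [lin]: "x \<in> carrier A \<Longrightarrow> y \<in> carrier A \<Longrightarrow> x \<bullet> y \<in> carrier A"
  by (rule bilinear_on_closed[OF am])
lemma phi_closed [lin]: "x \<in> carrier H \<Longrightarrow> \<phi> x \<in> carrier A"
  by (rule linear_on_closed[OF phi_lin])
lemma sigma_closed [lin]: "x \<in> carrier H \<Longrightarrow> \<sigma> x \<in> carrier (tensor R A A)"
  by (rule linear_on_closed[OF sigma_lin])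
lemmas [lin] = linear_on_comp[OF bilinear_on_left[OF am]]
    linear_on_comp[OF bilinear_on_right[OF am]]
  linear_on_comp[OF phi_lin] phi_lin linear_on_comp[OF sigma_lin] sigma_lin
  bilinear_on_left[OF am] bilinear_on_right[OF am]

lemma [push]:
  assumes "module R K" "module R L"
    and "\<And>a b. a \<in> carrier K \<Longrightarrow> b \<in> carrier L \<Longrightarrow> f a b \<in> carrier A"
    and "t \<in> carrier (tensor R K L)"
  shows "n \<in> carrier A \<Longrightarrow> (tlift R K L A f t) \<bullet> n = tlift R K L A (\<lambda>a b. f a b \<bullet> n) t"
    and "n \<in> carrier A \<Longrightarrow> n \<bullet> (tlift R K L A f t) = tlift R K L A (\<lambda>a b. n \<bullet> f a b) t"
  by (rule linear_tlift; simp add: assms lin)+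

text \<open>
  Since \<open>S'\<close> is bijective, the section of \<open>can\<close> is turned into a section of
  \<open>a \<otimes> b \<mapsto> a\<^sub>0 b \<otimes> S'(a\<^sub>1)\<close>.
\<close>

lemma sigma':
  assumes h: "h \<in> carrier H"
  shows "sig AH (\<lambda>r l. AC.sw AH (\<lambda>x y. tens R A H (x \<bullet> l) (S' y)) r) h = tens R A H e h"
proof -
  note [lin] = h
  \<comment> \<open>\<open>\<Psi>\<close> is
    \<open>a \<otimes> k \<mapsto> a\<^sub>0 \<otimes> k S'(a\<^sub>1)\<close>. It carries
    \<open>r l\<^sub>0 \<otimes> l\<^sub>1\<close> to \<open>r\<^sub>0 l\<^sub>0 \<otimes> l\<^sub>2
    S'(l\<^sub>1) S'(r\<^sub>1)\<close>, where \<open>l\<^sub>2 S'(l\<^sub>1)\<close> cancels, and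
    it fixes \<open>e \<otimes> h\<close>.\<close>
  define \<Psi> where "\<Psi> t = tlift R A H AH (\<lambda>a k. AC.sw AH (\<lambda>x y. tens R A H x (k \<star> S' y)) a) t" for t
  have psi: "linear_on R AH AH \<Psi>" unfolding \<Psi>_def by (rule tlift_linear) (simp_all add: lin)
  have "sig AH (\<lambda>r l. AC.sw AH (\<lambda>x y. tens R A H (x \<bullet> l) (S' y)) r) h =
     sig AH (\<lambda>r l. AC.sw AH (\<lambda>l0 l1. \<Psi> (tens R A H (r \<bullet> l0) l1)) l) h"
  proof (intro tlift_cong_pointwise)
    fix r l assume [lin]: "r \<in> carrier A" "l \<in> carrier A"
    have "AC.sw AH (\<lambda>l0 l1. \<Psi> (tens R A H (r \<bullet> l0) l1)) l =
      AC.sw AH (\<lambda>l0 l1. AC.sw AH (\<lambda>r0 r1. AC.sw AH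
          (\<lambda>x y. tens R A H (r0 \<bullet> x) ((l1 \<star> S' y) \<star> S' r1)) l0) r) l"
      by (simp add: \<Psi>_def A_mult push lin op.S_antimult hm_assoc cong: tlift_cong_simp)
    also have "\<dots> = AC.sw AH (\<lambda>r0 r1. AC.sw AH
        (\<lambda>l0 l1. AC.sw AH (\<lambda>x y. tens R A H (r0 \<bullet> x) ((l1 \<star> S' y) \<star> S' r1)) l0) l) r"
      by (rule tlift_swap) (simp_all add: lin)
    also have "\<dots> = AC.sw AH (\<lambda>r0 r1. AC.sw AH
        (\<lambda>l0 l1. D AH (\<lambda>y c. tens R A H (r0 \<bullet> l0) ((c \<star> S' y) \<star> S' r1)) l1) l) r"
      by (intro tlift_cong_pointwise AC.coassoc[symmetric]; simp add: lin)
    also have "\<dots> = AC.sw AH (\<lambda>r0 r1. tens R A H (r0 \<bullet> l) (u \<star> S' r1)) r"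
      by (intro tlift_cong_pointwise op.S_left3[OF AC.comodule_axioms]; simp add: lin)
    also have "\<dots> = AC.sw AH (\<lambda>x y. tens R A H (x \<bullet> l) (S' y)) r"
      by (intro tlift_cong_pointwise; simp add: lin hm_unit)
    finally show "AC.sw AH (\<lambda>x y. tens R A H (x \<bullet> l) (S' y)) r =
        AC.sw AH (\<lambda>l0 l1. \<Psi> (tens R A H (r \<bullet> l0) l1)) l"
      by simp
  qed (simp_all add: lin)
  also have "\<dots> = \<Psi> (sig AH (\<lambda>r l. AC.sw AH (\<lambda>x y. tens R A H (r \<bullet> x) y) l) h)"
    by (subst linear_tlift[OF _ _ _ _ psi], simp_all add: lin, intro tlift_cong_pointwise
        linear_tlift[OF _ _ _ _ psi, symmetric])
      (simp_all add: lin)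
  also have "\<dots> = tens R A H e h"
    by (simp add: sigma lin \<Psi>_def push A_one op.S_u hm_unit)
  finally show ?thesis .
qed

end

locale hopf_module = comodule_algebra R H \<Delta> \<epsilon> hm u S S' A \<rho>\<^sub>A am e \<phi> \<sigma> + NC: comodule R H \<Delta> \<epsilon> N \<rho>\<^sub>N
  for R :: "('k, 'r) ring_scheme" and H :: "('k, 'h, 'x) module_scheme" and \<Delta> \<epsilon>
    and hm :: "'h \<Rightarrow> 'h \<Rightarrow> 'h" (infixl "\<star>" 70) and u S S'
    and A :: "('k, 'a, 'y) module_scheme" and \<rho>\<^sub>A
    and am :: "'a \<Rightarrow> 'a \<Rightarrow> 'a" (infixl "\<bullet>" 70) and e :: 'a and \<phi> :: "'h \<Rightarrow> 'a"
    and \<sigma> :: "'h \<Rightarrow> ('a \<times> 'a \<Rightarrow> 'k) set"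
    and N :: "('k, 'n, 'z) module_scheme" and \<rho>\<^sub>N +
  fixes ac :: "'n \<Rightarrow> 'a \<Rightarrow> 'n" (infixl "\<cdot>" 70)
  assumes ac: "bilinear_on R N A N ac"
    and ac_assoc: "n \<in> carrier N \<Longrightarrow> x \<in> carrier A \<Longrightarrow> y \<in> carrier A \<Longrightarrow> n \<cdot> x \<cdot> y = n \<cdot> (x \<bullet> y)"
    and ac_unit: "n \<in> carrier N \<Longrightarrow> n \<cdot> e = n"
    and N_mult: "n \<in> carrier N \<Longrightarrow> x \<in> carrier A \<Longrightarrow> \<rho>\<^sub>N (n \<cdot> x) =
      NC.sw (tensor R N H) (\<lambda>a b. AC.sw (tensor R N H) (\<lambda>c d. tens R N H (a \<cdot> c) (b \<star> d)) x) n"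
begin

abbreviation "NH \<equiv> tensor R N H"

lemma ac_closed [lin]: "x \<in> carrier N \<Longrightarrow> y \<in> carrier A \<Longrightarrow> x \<cdot> y \<in> carrier N"
  by (rule bilinear_on_closed[OF ac])
lemmas [lin] = linear_on_comp[OF bilinear_on_left[OF ac]]
    linear_on_comp[OF bilinear_on_right[OF ac]]
  bilinear_on_left[OF ac] bilinear_on_right[OF ac]

lemma [push]:
  assumes "module R K" "module R L" "t \<in> carrier (tensor R K L)"
  shows ac_push1: "(\<And>a b. a \<in> carrier K \<Longrightarrow> b \<in> carrier L \<Longrightarrow> f a b \<in> carrier N) \<Longrightarrow> x \<in> carrier A \<Longrightarrow>
      (tlift R K L N f t) \<cdot> x = tlift R K L N (\<lambda>a b. f a b \<cdot> x) t"
    and ac_push2: "(\<And>a b. a \<in> carrier K \<Longrightarrow> b \<in> carrier L \<Longrightarrow> g a b \<in> carrier A) \<Longrightarrow> n \<in> carrier N \<Longrightarrow>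
      n \<cdot> (tlift R K L A g t) = tlift R K L N (\<lambda>a b. n \<cdot> g a b) t"
    and N_push: "(\<And>a b. a \<in> carrier K \<Longrightarrow> b \<in> carrier L \<Longrightarrow> f a b \<in> carrier N) \<Longrightarrow>
      \<rho>\<^sub>N (tlift R K L N f t) = tlift R K L NH (\<lambda>a b. \<rho>\<^sub>N (f a b)) t"
  by (rule linear_tlift; simp add: assms lin)+

definition tr :: "'n \<Rightarrow> 'a \<Rightarrow> 'n" where
  "tr n a = NC.sw N (\<lambda>n0 n1. AC.sw N (\<lambda>a0 a1. n0 \<cdot> (\<phi> (S n1 \<star> S' a1) \<bullet> a0)) a) n"

lemma tr_closed [lin]: "n \<in> carrier N \<Longrightarrow> a \<in> carrier A \<Longrightarrow> tr n a \<in> carrier N"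
  by (simp add: tr_def lin)

lemma tr_lin [lin]: "linear_on R X N f \<Longrightarrow> a \<in> carrier A \<Longrightarrow> linear_on R X N (\<lambda>x. tr (f x) a)"
  "linear_on R X A f' \<Longrightarrow> n \<in> carrier N \<Longrightarrow> linear_on R X N (\<lambda>x. tr n (f' x))"
  by (simp_all add: tr_def lin)

text \<open>Coacting gives \<open>n\<^sub>0 \<phi>(S(n\<^sub>2)\<^sub>1 S'(a\<^sub>2)\<^sub>1)
  a\<^sub>0\<close> in \<open>N\<close> and \<open>n\<^sub>1 S(n\<^sub>2)\<^sub>2
  S'(a\<^sub>2)\<^sub>2 a\<^sub>1\<close> in \<open>H\<close>. The legs coming from \<open>n\<close>
  and those coming from \<open>a\<close> are evaluated separately by \<open>S_coinv\<close>, for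
  \<open>S\<close> and for \<open>S'\<close> in the opposite algebra.\<close>

lemma tr_coinv:
  assumes n: "n \<in> carrier N" and a: "a \<in> carrier A"
  shows "\<rho>\<^sub>N (tr n a) = tens R N H (tr n a) u"
proof -
  note [lin] = n a
  \<comment> \<open>\<open>\<Psi>\<close> takes two tensors in \<open>H \<otimes> H\<close> as
    arguments, \<open>X\<close> with the legs from \<open>n\<close> and \<open>Y\<close> with those
    from \<open>a\<close>. It is linear in each, so the sums can be pushed into these arguments and
    evaluated there.\<close>
  define \<Psi> where "\<Psi> n0 a0 X Y = tlift R H H NH (\<lambda>x b. tlift R H H NH (\<lambda>z c.
    tens R N H (n0 \<cdot> (\<phi> (x \<star> z) \<bullet> a0)) (b \<star> c)) Y) X" for n0 a0 X Y
  define X where "X y s = D T (\<lambda>p q. tens R H H p (y \<star> q)) (S s)" for y s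
  define Y where "Y w s = D T (\<lambda>p q. tens R H H p (q \<star> w)) (S' s)" for w s
  have [lin]: "y \<in> carrier H \<Longrightarrow> s \<in> carrier H \<Longrightarrow> X y s \<in> carrier T"
    "y \<in> carrier H \<Longrightarrow> s \<in> carrier H \<Longrightarrow> Y y s \<in> carrier T" for y s
    by (simp_all add: X_def Y_def lin)
  have [lin]: "y \<in> carrier H \<Longrightarrow> linear_on R H T (X y)" "s \<in> carrier H \<Longrightarrow> linear_on R H T (\<lambda>y. X y s)"
    "y \<in> carrier H \<Longrightarrow> linear_on R H T (Y y)" "s \<in> carrier H \<Longrightarrow> linear_on R H T (\<lambda>y. Y y s)" for y s
    by (simp_all add: X_def[abs_def] Y_def[abs_def] lin)
  have [lin]: "\<lbrakk>m \<in> carrier N; b \<in> carrier A; Y' \<in> carrier T; linear_on R Z T f\<rbrakk>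
      \<Longrightarrow> linear_on R Z NH (\<lambda>x. \<Psi> m b (f x) Y')"
    "\<lbrakk>m \<in> carrier N; b \<in> carrier A; X' \<in> carrier T; linear_on R Z T f\<rbrakk>
        \<Longrightarrow> linear_on R Z NH (\<lambda>x. \<Psi> m b X' (f x))"
    "\<lbrakk>m \<in> carrier N; b \<in> carrier A; Y' \<in> carrier T\<rbrakk> \<Longrightarrow> linear_on R T NH (\<lambda>x. \<Psi> m b x Y')"
    "\<lbrakk>m \<in> carrier N; b \<in> carrier A; X' \<in> carrier T\<rbrakk> \<Longrightarrow> linear_on R T NH (\<Psi> m b X')"
    "\<lbrakk>b \<in> carrier A; X' \<in> carrier T; Y' \<in> carrier T\<rbrakk> \<Longrightarrow> linear_on R N NH (\<lambda>m. \<Psi> m b X' Y')"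
    "\<lbrakk>m \<in> carrier N; X' \<in> carrier T; Y' \<in> carrier T\<rbrakk> \<Longrightarrow> linear_on R A NH (\<lambda>b. \<Psi> m b X' Y')"
     for Z :: "('k, 'h, 'v) module_scheme" and f m b X' Y'
    by (simp_all add: \<Psi>_def[abs_def] lin)
  have [lin]: "\<lbrakk>m \<in> carrier N; b \<in> carrier A; X' \<in> carrier T; Y' \<in> carrier T\<rbrakk>
      \<Longrightarrow> \<Psi> m b X' Y' \<in> carrier NH" for m b X' Y'
    by (simp add: \<Psi>_def lin)
  have inner: "\<rho>\<^sub>N (n0 \<cdot> (\<phi> (S n1 \<star> S' a1) \<bullet> a0)) = NC.sw NH
      (\<lambda>x y. AC.sw NH (\<lambda>z w. \<Psi> x z (X y n1) (Y w a1)) a0) n0"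
    if [lin]: "n0 \<in> carrier N" "n1 \<in> carrier H" "a0 \<in> carrier A" "a1 \<in> carrier H" for n0 n1 a0 a1
  proof -
    have "\<rho>\<^sub>N (n0 \<cdot> (\<phi> (S n1 \<star> S' a1) \<bullet> a0)) =
        NC.sw NH (\<lambda>x y. D NH (\<lambda>p q. D NH (\<lambda>r s. AC.sw NH (\<lambda>z w.
      tens R N H (x \<cdot> (\<phi> (p \<star> r) \<bullet> z)) ((y \<star> q) \<star> (s \<star> w))) a0) (S' a1)) (S n1)) n0"
      by (simp add: N_mult A_mult phi_colin D_mult push lin hm_assoc cong: tlift_cong_simp)
    also have "\<dots> = NC.sw NH (\<lambda>x y. D NH (\<lambda>p q. AC.sw NH (\<lambda>z w. D NH (\<lambda>r s.
      tens R N H (x \<cdot> (\<phi> (p \<star> r) \<bullet> z)) ((y \<star> q) \<star> (s \<star> w))) (S' a1)) a0) (S n1)) n0"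
      by (intro tlift_cong_pointwise tlift_swap; simp add: lin)
    also have "\<dots> = NC.sw NH (\<lambda>x y. AC.sw NH (\<lambda>z w. D NH (\<lambda>p q. D NH (\<lambda>r s.
      tens R N H (x \<cdot> (\<phi> (p \<star> r) \<bullet> z)) ((y \<star> q) \<star> (s \<star> w))) (S' a1)) (S n1)) a0) n0"
      by (intro tlift_cong_pointwise tlift_swap; simp add: lin)
    also have "\<dots> = NC.sw NH (\<lambda>x y. AC.sw NH (\<lambda>z w. \<Psi> x z (X y n1) (Y w a1)) a0) n0"
      by (simp add: \<Psi>_def X_def Y_def push lin cong: tlift_cong_simp)
    finally show ?thesis .
  qed
  have "\<rho>\<^sub>N (tr n a) = NC.sw NH (\<lambda>n0 n1. AC.sw NH (\<lambda>a0 a1.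
      NC.sw NH (\<lambda>x y. AC.sw NH (\<lambda>z w. \<Psi> x z (X y n1) (Y w a1)) a0) n0) a) n"
    by (simp add: tr_def push lin inner cong: tlift_cong_simp)
  also have "\<dots> = NC.sw NH (\<lambda>n0 n1. AC.sw NH (\<lambda>a0 a1.
      D NH (\<lambda>y p. D NH (\<lambda>w q. \<Psi> n0 a0 (X y p) (Y w q)) a1) n1) a) n"
    by (rule double_coassoc[OF NC.comodule_axioms AC.comodule_axioms]; simp add: lin)
  also have "\<dots> = NC.sw NH (\<lambda>n0 n1. AC.sw NH (\<lambda>a0 a1.
      D NH (\<lambda>y p. \<Psi> n0 a0 (X y p) (D T (\<lambda>w q. Y w q) a1)) n1) a) n"
    by (intro tlift_cong_pointwise linear_tlift[symmetric, where g="\<lambda>t. \<Psi> _ _ _ t"]; simp add: lin)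
  also have "\<dots> = NC.sw NH (\<lambda>n0 n1. AC.sw NH (\<lambda>a0 a1.
      \<Psi> n0 a0 (D T (\<lambda>y p. X y p) n1) (D T (\<lambda>w q. Y w q) a1)) a) n"
    by (intro tlift_cong_pointwise linear_tlift[symmetric, where g="\<lambda>t. \<Psi> _ _ t _"]; simp add: lin)
  also have "\<dots> = NC.sw NH (\<lambda>n0 n1. AC.sw NH (\<lambda>a0 a1. tens R N H (n0 \<cdot> (\<phi> (S n1 \<star> S' a1) \<bullet> a0)) u)
      a) n"
  proof (intro tlift_cong_pointwise)
    fix n0 n1 a0 a1 assume [lin]: "n0 \<in> carrier N" "n1 \<in> carrier H" "a0 \<in> carrier A" "a1 \<in> carrier
        H"
    have "D T (\<lambda>y p. X y p) n1 = tens R H H (S n1) u"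
      unfolding X_def by (rule S_coinv) (simp add: lin)
    moreover have "D T (\<lambda>w q. Y w q) a1 = tens R H H (S' a1) u"
      unfolding Y_def by (rule op.S_coinv) (simp add: lin)
    ultimately show "\<Psi> n0 a0 (D T (\<lambda>y p. X y p) n1) (D T (\<lambda>w q. Y w q) a1) =
        tens R N H (n0 \<cdot> (\<phi> (S n1 \<star> S' a1) \<bullet> a0)) u"
      by (simp only:) (simp add: \<Psi>_def push lin hm_unit)
  qed (simp_all add: lin)
  also have "\<dots> = tens R N H (tr n a) u"
    by (simp add: tr_def push lin cong: tlift_cong_simp)
  finally show ?thesis .
qed

text \<open>By \<open>sigma'\<close> the terms
  \<open>\<phi>(S(n\<^sub>1) S'(r\<^sub>1)) r\<^sub>0 l\<close>, with
  \<open>r \<otimes> l = \<sigma>(n\<^sub>2)\<close>, add up to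
  \<open>\<phi>(S(n\<^sub>1) n\<^sub>2)\<close>; the antipode law then leaves
  \<open>n \<cdot> \<phi> u = n\<close>.\<close>

lemma tr_reconstruct:
  assumes n: "n \<in> carrier N"
  shows "NC.sw N (\<lambda>n0 n1. sig N (\<lambda>r l. tr n0 r \<cdot> l) n1) n = n"
proof -
  note [lin] = n
  define \<Gamma> where "\<Gamma> m k t = tlift R A H N (\<lambda>a h. m \<cdot> (\<phi> (S k \<star> h) \<bullet> a)) t" for m k t
  have gam: "linear_on R AH N (\<Gamma> m k)" if "m \<in> carrier N" "k \<in> carrier H" for m k
    unfolding \<Gamma>_def by (rule tlift_linear) (simp_all add: lin that)
  have "NC.sw N (\<lambda>n0 n1. sig N (\<lambda>r l. tr n0 r \<cdot> l) n1) n =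
    NC.sw N (\<lambda>n0 n1. sig N (\<lambda>r l. NC.sw N (\<lambda>m k. AC.sw N (\<lambda>x y. m \<cdot> (\<phi> (S k \<star> S' y) \<bullet> (x \<bullet> l))) r)
        n0) n1) n"
    by (simp add: tr_def push lin ac_assoc am_assoc cong: tlift_cong_simp)
  also have "\<dots> = NC.sw N (\<lambda>n0 n1. NC.sw N (\<lambda>m k. sig N
      (\<lambda>r l. AC.sw N (\<lambda>x y. m \<cdot> (\<phi> (S k \<star> S' y) \<bullet> (x \<bullet> l))) r) n1) n0) n"
    by (intro tlift_cong_pointwise tlift_swap; simp add: lin)
  also have "\<dots> = NC.sw N (\<lambda>n0 n1. NC.sw N (\<lambda>m k. m \<cdot> \<phi> (S k \<star> n1)) n0) n"
  proof (intro tlift_cong_pointwise)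
    fix n0 n1 m k assume [lin]: "n0 \<in> carrier N" "n1 \<in> carrier H" "m \<in> carrier N" "k \<in> carrier H"
    have "sig N (\<lambda>r l. AC.sw N (\<lambda>x y. m \<cdot> (\<phi> (S k \<star> S' y) \<bullet> (x \<bullet> l))) r) n1 =
      \<Gamma> m k (sig AH (\<lambda>r l. AC.sw AH (\<lambda>x y. tens R A H (x \<bullet> l) (S' y)) r) n1)"
      by (simp add: \<Gamma>_def push lin cong: tlift_cong_simp)
    also have "\<dots> = m \<cdot> \<phi> (S k \<star> n1)"
      by (simp add: sigma' lin \<Gamma>_def push am_unit)
    finally show "sig N (\<lambda>r l. AC.sw N (\<lambda>x y. m \<cdot> (\<phi> (S k \<star> S' y) \<bullet> (x \<bullet> l))) r) n1 =
        m \<cdot> \<phi> (S k \<star> n1)" .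
  qed (simp_all add: lin)
  also have "\<dots> = NC.sw N (\<lambda>m c. D N (\<lambda>k l. m \<cdot> \<phi> (S k \<star> l)) c) n"
    by (rule NC.coassoc[symmetric]) (simp_all add: lin)
  also have "\<dots> = n \<cdot> \<phi> u"
    by (rule S_left3[OF NC.comodule_axioms]) (simp_all add: lin)
  finally show ?thesis by (simp add: phi_u ac_unit lin)
qed

end

text \<open>\<open>A\<close> is a Hopf module over itself. Its trace \<open>AA.tr\<close> takes
  values in the coinvariants of \<open>A\<close>, that is in \<open>B\<close>, and so these values
  may be moved across a tensor sign over \<open>B\<close>.\<close>

sublocale comodule_algebra \<subseteq> AA: hopf_module R H \<Delta> \<epsilon> hm u S S' A \<rho>\<^sub>A am e \<phi> \<sigma> A \<rho>\<^sub>A am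
  by unfold_locales (simp_all add: lin am_assoc am_unit A_mult)

context hopf_module begin

text \<open>For coinvariant \<open>n\<close> the coaction of \<open>n \<cdot> a\<close> is
  \<open>n \<cdot> a\<^sub>0 \<otimes> a\<^sub>1\<close>, so \<open>n\<close> stands to the left of
  the whole sum defining the trace and factors out.\<close>

lemma tr_left_coinv:
  assumes "n \<in> carrier N" "a \<in> carrier A" "b \<in> carrier A" "\<rho>\<^sub>N n = tens R N H n u"
  shows "tr (n \<cdot> a) b = n \<cdot> AA.tr a b"
  using assms(1-3)
  by (simp add: tr_def AA.tr_def N_mult assms(4) push lin hm_unit ac_assoc am_assoc cong:
      tlift_cong_simp)

end

context comodule_algebra begin

lemma tr_e: "a \<in> carrier A \<Longrightarrow> AA.tr a e = AC.sw A (\<lambda>a0 a1. a0 \<bullet> \<phi> (S a1)) a"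
  by (simp add: AA.tr_def A_one push lin op.S_u am_unit hm_unit cong: tlift_cong_simp)

text \<open>The normalization of the total integral enters here: it makes
  \<open>m \<otimes> a \<mapsto> m tr(a, 1)\<close> a left inverse of the unit.\<close>

lemma tr_e_e: "AA.tr e e = e"
  by (simp add: tr_e A_one push lin S_u am_unit phi_u)

end

section \<open>Complements and sections\<close>

text \<open>By Zorn's lemma the kernel of a linear map has a complement.\<close>

lemma linear_section:
  assumes R: "field R" and V: "module R V" and W: "module R W" and f: "linear_on R V W f"
    and surj: "f ` carrier V = carrier W"
  obtains g where "linear_on R W V g" "\<And>w. w \<in> carrier W \<Longrightarrow> f (g w) = w"
proof -
  interpret R: field R by fact
  interpret V: module R V by fact
  interpret W: module R W by fact
  note fc = linear_on_closed[OF f] and f0 = linear_on_zero[OF V W f]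
  \<comment> \<open>The submodules that meet the kernel of \<open>f\<close> only in zero; a maximal
    one is the complement sought.\<close>
  define \<A> where "\<A> = {K. submodule K R V \<and> (\<forall>x\<in>K. f x = \<zero>\<^bsub>W\<^esub> \<longrightarrow> x = \<zero>\<^bsub>V\<^esub>)}"
  have "\<exists>K\<in>\<A>. \<forall>X\<in>\<A>. K \<subseteq> X \<longrightarrow> X = K"
  proof (rule subset_Zorn_nonempty)
    have "submodule {\<zero>\<^bsub>V\<^esub>} R V" by (intro V.submoduleI) auto
    then show "\<A> \<noteq> {}" by (auto simp: \<A>_def)
    fix \<C> assume ne: "\<C> \<noteq> {}" and ch: "subset.chain \<A> \<C>"
    have sub: "submodule K R V" if "K \<in> \<C>" for K
      using that ch by (auto simp: subset.chain_def \<A>_def)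
    have "submodule (\<Union>\<C>) R V"
    proof (rule V.submoduleI)
      show "\<Union>\<C> \<subseteq> carrier V" using V.submoduleE(1)[OF sub] by auto
      obtain K where "K \<in> \<C>" using ne by auto
      moreover have "\<zero>\<^bsub>V\<^esub> \<in> K" if "submodule K R V" for K
        using submodule.axioms(1)[OF that] subgroup.one_closed[of K "add_monoid V"] by simp
      ultimately show "\<zero>\<^bsub>V\<^esub> \<in> \<Union>\<C>" using sub by auto
    next
      fix a assume "a \<in> \<Union>\<C>" then show "\<ominus>\<^bsub>V\<^esub> a \<in> \<Union>\<C>" using V.submoduleE(3)[OF sub] by auto
    next
      fix a b assume "a \<in> \<Union>\<C>" "b \<in> \<Union>\<C>"
      then obtain K L where KL: "K \<in> \<C>" "L \<in> \<C>" "a \<in> K" "b \<in> L" by auto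
      then have "K \<subseteq> L \<or> L \<subseteq> K" using ch by (auto simp: subset.chain_def)
      then obtain J where "J \<in> \<C>" "a \<in> J" "b \<in> J" using KL by auto
      then show "a \<oplus>\<^bsub>V\<^esub> b \<in> \<Union>\<C>" using V.submoduleE(5)[OF sub] by auto
    next
      fix r x assume "r \<in> carrier R" "x \<in> \<Union>\<C>"
      then show "r \<odot>\<^bsub>V\<^esub> x \<in> \<Union>\<C>" using V.submoduleE(4)[OF sub] by auto
    qed
    moreover have "\<forall>x\<in>\<Union>\<C>. f x = \<zero>\<^bsub>W\<^esub> \<longrightarrow> x = \<zero>\<^bsub>V\<^esub>"
      using ch by (fastforce simp: subset.chain_def \<A>_def)
    ultimately show "\<Union>\<C> \<in> \<A>" by (simp add: \<A>_def)
  qed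
  then obtain K where K: "submodule K R V" and Kf: "\<And>x. x \<in> K \<Longrightarrow> f x = \<zero>\<^bsub>W\<^esub> \<Longrightarrow> x = \<zero>\<^bsub>V\<^esub>"
    and max: "\<And>X. X \<in> \<A> \<Longrightarrow> K \<subseteq> X \<Longrightarrow> X = K"
    by (auto simp: \<A>_def)
  note KE = V.submoduleE[OF K]
  have Kc: "x \<in> carrier V" if "x \<in> K" for x using that KE(1) by auto
  have K0: "\<zero>\<^bsub>V\<^esub> \<in> K"
    using submodule.axioms(1)[OF K] subgroup.one_closed[of K "add_monoid V"] by simp
  have im: "f v \<in> f ` K" if v: "v \<in> carrier V" for v
  proof (rule ccontr)
    assume no: "f v \<notin> f ` K"
    \<comment> \<open>\<open>K\<close> is enlarged by the line through \<open>v\<close>. A kernel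
      vector \<open>k + r v\<close> with \<open>r\<close> nonzero, hence invertible in the field,
      would express \<open>f v\<close> as the image of a multiple of \<open>k\<close>; so the
      enlargement still meets the kernel only in zero and contradicts maximality.\<close>
    define K' where "K' = {k \<oplus>\<^bsub>V\<^esub> r \<odot>\<^bsub>V\<^esub> v | k r. k \<in> K \<and> r \<in> carrier R}"
    have KI: "k \<oplus>\<^bsub>V\<^esub> r \<odot>\<^bsub>V\<^esub> v \<in> K'" if "k \<in> K" "r \<in> carrier R" for k r using that by
        (auto simp: K'_def)
    have "submodule K' R V"
    proof (rule V.submoduleI)
      show "K' \<subseteq> carrier V" using Kc v by (auto simp: K'_def)
      show "\<zero>\<^bsub>V\<^esub> \<in> K'" using KI[OF K0 R.zero_closed] v by simp
    next
      fix a assume "a \<in> K'"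
      then obtain k r where a: "k \<in> K" "r \<in> carrier R" "a = k \<oplus>\<^bsub>V\<^esub> r \<odot>\<^bsub>V\<^esub> v" by (auto simp: K'_def)
      then have "\<ominus>\<^bsub>V\<^esub> a = \<ominus>\<^bsub>V\<^esub> k \<oplus>\<^bsub>V\<^esub> (\<ominus>\<^bsub>R\<^esub> r) \<odot>\<^bsub>V\<^esub> v"
        using Kc v by (simp add: V.minus_add V.smult_l_minus)
      then show "\<ominus>\<^bsub>V\<^esub> a \<in> K'" using KI[of "\<ominus>\<^bsub>V\<^esub> k" "\<ominus>\<^bsub>R\<^esub> r"] a KE(3) by simp
    next
      fix a b assume "a \<in> K'" "b \<in> K'"
      then obtain k r l s where a: "k \<in> K" "r \<in> carrier R" "a = k \<oplus>\<^bsub>V\<^esub> r \<odot>\<^bsub>V\<^esub> v"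
        "l \<in> K" "s \<in> carrier R" "b = l \<oplus>\<^bsub>V\<^esub> s \<odot>\<^bsub>V\<^esub> v" by (auto simp: K'_def)
      then have "a \<oplus>\<^bsub>V\<^esub> b = (k \<oplus>\<^bsub>V\<^esub> l) \<oplus>\<^bsub>V\<^esub> (r \<oplus>\<^bsub>R\<^esub> s) \<odot>\<^bsub>V\<^esub> v"
        using Kc v by (simp add: V.smult_l_distr V.a_ac)
      then show "a \<oplus>\<^bsub>V\<^esub> b \<in> K'" using KI a KE(5) by simp
    next
      fix s a assume s: "s \<in> carrier R" and "a \<in> K'"
      then obtain k r where a: "k \<in> K" "r \<in> carrier R" "a = k \<oplus>\<^bsub>V\<^esub> r \<odot>\<^bsub>V\<^esub> v" by (auto simp: K'_def)
      then have "s \<odot>\<^bsub>V\<^esub> a = s \<odot>\<^bsub>V\<^esub> k \<oplus>\<^bsub>V\<^esub> (s \<otimes>\<^bsub>R\<^esub> r) \<odot>\<^bsub>V\<^esub> v"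
        using Kc v s by (simp add: V.smult_r_distr V.smult_assoc1)
      then show "s \<odot>\<^bsub>V\<^esub> a \<in> K'" using KI a s KE(4) by simp
    qed
    moreover have "x = \<zero>\<^bsub>V\<^esub>" if x: "x \<in> K'" "f x = \<zero>\<^bsub>W\<^esub>" for x
    proof -
      obtain k r where a: "k \<in> K" "r \<in> carrier R" "x = k \<oplus>\<^bsub>V\<^esub> r \<odot>\<^bsub>V\<^esub> v" using x(1) by
          (auto simp: K'_def)
      have eq: "f k \<oplus>\<^bsub>W\<^esub> r \<odot>\<^bsub>W\<^esub> f v = \<zero>\<^bsub>W\<^esub>"
        using x(2) a v Kc by (simp add: linear_on_add[OF f] linear_on_scale[OF f])
      show ?thesis
      proof (cases "r = \<zero>\<^bsub>R\<^esub>")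
        case True
        then show ?thesis using a v Kc eq fc Kf by simp
      next
        case False
        then have r: "r \<in> Units R" using a(2) R.field_Units by auto
        let ?c = "\<ominus>\<^bsub>R\<^esub> (inv\<^bsub>R\<^esub> r)"
        have c: "?c \<in> carrier R" "inv\<^bsub>R\<^esub> r \<in> carrier R" using r by auto
        have "f k = \<ominus>\<^bsub>W\<^esub> (r \<odot>\<^bsub>W\<^esub> f v)"
          using W.add.inv_equality[OF eq] a v Kc fc by (metis W.smult_closed)
        then have "f (?c \<odot>\<^bsub>V\<^esub> k) = ?c \<odot>\<^bsub>W\<^esub> (\<ominus>\<^bsub>W\<^esub> (r \<odot>\<^bsub>W\<^esub> f v))"
          using c a Kc by (simp add: linear_on_scale[OF f])
        also have "\<dots> = (inv\<^bsub>R\<^esub> r \<otimes>\<^bsub>R\<^esub> r) \<odot>\<^bsub>W\<^esub> f v"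
          using c a(2) fc[OF v] by (simp add: W.smult_l_minus W.smult_r_minus W.smult_assoc1)
        also have "\<dots> = f v" using r fc[OF v] by simp
        finally have "f v \<in> f ` K" using KE(4)[OF c(1) a(1)] by (metis imageI)
        then show ?thesis using no by simp
      qed
    qed
    ultimately have "K' \<in> \<A>" by (simp add: \<A>_def)
    moreover have "K \<subseteq> K'"
      using KI[OF _ R.zero_closed] v Kc by fastforce
    ultimately have "K' = K" by (rule max)
    moreover have "v \<in> K'" using KI[OF K0 R.one_closed] v by simp
    ultimately show False using no by auto
  qed
  have imK: "f ` K = carrier W" using im Kc by (auto simp: surj[symmetric])
  have inj: "inj_on f K"
  proof (rule inj_onI)
    fix x y assume xy: "x \<in> K" "y \<in> K" "f x = f y"
    have "f (x \<ominus>\<^bsub>V\<^esub> y) = \<zero>\<^bsub>W\<^esub>"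
      using xy Kc fc by (simp add: linear_on_minus[OF V W f] minus_eq_zero_iff[OF W])
    moreover have "x \<ominus>\<^bsub>V\<^esub> y \<in> K" using xy KE(3,5) by (simp add: a_minus_def)
    ultimately have "x \<ominus>\<^bsub>V\<^esub> y = \<zero>\<^bsub>V\<^esub>" by (intro Kf)
    then show "x = y" using minus_eq_zero_iff[OF V Kc[OF xy(1)] Kc[OF xy(2)]] by simp
  qed
  \<comment> \<open>With the carrier restricted to \<open>K\<close>, \<open>f\<close> is a linear
    bijection onto \<open>W\<close>, and its inverse is the section.\<close>
  let ?K = "V\<lparr>carrier := K\<rparr>"
  have "module R ?K" by (rule submodule.submodule_is_module[OF K V])
  moreover have fK: "linear_on R ?K W f" using f Kc by (auto simp: linear_on_def)
  moreover have "bij_betw f (carrier ?K) (carrier W)"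
    using inj imK by (simp add: bij_betw_def)
  ultimately have "linear_on R W ?K (inv_into (carrier ?K) f)" by (intro linear_on_inverse)
  then have "linear_on R W V (inv_into K f)" using Kc by (auto simp: linear_on_def)
  moreover have "f (inv_into K f w) = w" if "w \<in> carrier W" for w
    using imK that by (metis f_inv_into_f)
  ultimately show ?thesis by (rule that)
qed

section \<open>Untwisting Hom-structures\<close>

locale hom_object =
  fixes R :: "('k, 'r) ring_scheme" and M :: "('k, 'm, 'x) hom_space_scheme"
  assumes hom_object: "is_hom_space R M"
begin

lemma mod [lin]: "module R M"
  and tw_lin0: "linear_on R M M (twist M)"
  and tw_bij: "bij_betw (twist M) (carrier M) (carrier M)"
  using hom_object by (auto simp: is_hom_space_def)

lemma ti_lin0: "linear_on R M M (twist_inv M)"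
  unfolding twist_inv_def by (rule linear_on_inverse[OF tw_lin0 mod tw_bij])

lemma tw_ti [tws]: "x \<in> carrier M \<Longrightarrow> twist M (twist_inv M x) = x"
  and ti_tw [tws]: "x \<in> carrier M \<Longrightarrow> twist_inv M (twist M x) = x"
  using tw_bij by (auto simp: twist_inv_def bij_betw_def f_inv_into_f)

lemmas [lin] = linear_on_closed[OF tw_lin0] linear_on_closed[OF ti_lin0]
  tw_lin0 ti_lin0 linear_on_comp[OF tw_lin0] linear_on_comp[OF ti_lin0]

lemma [push]:
  assumes "module R K" "module R L"
    and "\<And>a b. a \<in> carrier K \<Longrightarrow> b \<in> carrier L \<Longrightarrow> f a b \<in> carrier M"
    and "t \<in> carrier (tensor R K L)"
  shows tw_push: "twist M (tlift R K L M f t) = tlift R K L M (\<lambda>a b. twist M (f a b)) t"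
    and ti_push: "twist_inv M (tlift R K L M f t) = tlift R K L M (\<lambda>a b. twist_inv M (f a b)) t"
  by (rule linear_tlift; simp add: assms lin)+

end

locale hom_comodule =
  fixes R :: "('k, 'r) ring_scheme" and H :: "('k, 'h, 'x) hom_coalg_scheme"
    and M :: "('k, 'm, 'y) hom_space_scheme" and \<rho> :: "'m \<Rightarrow> ('m \<times> 'h \<Rightarrow> 'k) set"
  assumes hcoalg: "hom_coalgebra R H" and hom_comodule: "right_hom_comodule R H M \<rho>"
begin

sublocale H: hom_object R H using hcoalg by unfold_locales (simp add: hom_coalgebra_def)
sublocale M: hom_object R M using hom_comodule by unfold_locales (simp add: right_hom_comodule_def)

lemma D_lin0: "linear_on R H (tensor R H H) (comul H)"
  and e_lin0: "linear_on R H (scalar_space R) (counit H)"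
  and r_lin0: "linear_on R M (tensor R M H) \<rho>"
  using hcoalg hom_comodule by (auto simp: hom_coalgebra_def right_hom_comodule_def)

lemmas [lin] = linear_on_comp[OF D_lin0] linear_on_comp[OF e_lin0] D_lin0 e_lin0
  linear_on_comp[OF r_lin0] r_lin0 linear_on_closed[OF D_lin0] linear_on_closed[OF r_lin0]
  module.smult_closed[OF H.mod] module.smult_closed[OF M.mod]

lemma r_tw [tws]: "m \<in> carrier M \<Longrightarrow>
    \<rho> (twist M m) = tlift R M H (tensor R M H) (\<lambda>a b. tens R M H (twist M a) (twist H b)) (\<rho> m)"
  and D_tw [tws]: "h \<in> carrier H \<Longrightarrow>
    comul H (twist H h) = tlift R H H (tensor R H H) (\<lambda>a b. tens R H H (twist H a) (twist H b))
        (comul H h)"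
  and e_tw [tws]: "h \<in> carrier H \<Longrightarrow> counit H (twist H h) = counit H h"
  and r_counit: "m \<in> carrier M \<Longrightarrow> tlift R M H M (\<lambda>m0 m1. counit H m1 \<odot>\<^bsub>M\<^esub> m0) (\<rho> m) = twist_inv M m"
  using hcoalg hom_comodule by (auto simp: hom_coalgebra_def right_hom_comodule_def)

text \<open>Hom-coassociativity puts an inverse twist on one outer leg of each side; in this form it
  can be used with an \<open>f\<close> that contains twists cancelling them.\<close>

lemma hcoassoc:
  assumes P: "module R P" and f: "trilinear_on R M H H P f" and m [lin]: "m \<in> carrier M"
  shows "tlift R M H P (\<lambda>a b. tlift R H H P (f (twist_inv M a)) (comul H b)) (\<rho> m) =
    tlift R M H P (\<lambda>a b. tlift R M H P (\<lambda>x y. f x y (twist_inv H b)) (\<rho> a)) (\<rho> m)"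
proof -
  note [lin] = P
  let ?T = "tensor R M (tensor R H H)"
  define L where "L = tlift R M (tensor R H H) P (\<lambda>x. tlift R H H P (f x))"
  have L: "linear_on R ?T P L" unfolding L_def by
      (rule trilinear_lift_linear[OF M.mod H.mod H.mod P f])
  have Lt: "x \<in> carrier M \<Longrightarrow> t \<in> carrier (tensor R H H) \<Longrightarrow> L (tens R M (tensor R H H) x t) =
      tlift R H H P (f x) t" for x t
    unfolding L_def by (rule trilinear_lift_tens[OF M.mod H.mod H.mod P f])
  have fs: "x \<in> carrier M \<Longrightarrow> bilinear_on R H H P (f x)" for x using f by (simp add: trilinear_on_def)
  have Lp: "L (tlift R K K' ?T g t) = tlift R K K' P (\<lambda>a b. L (g a b)) t"
    if "module R K" "module R K'" "\<And>a b. a \<in> carrier K \<Longrightarrow> b \<in> carrier K' \<Longrightarrow> g a b \<in> carrier ?T"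
      "t \<in> carrier (tensor R K K')"
    for K :: "('k, 'm, 'y) hom_space_scheme" and K' :: "('k, 'h, 'x) hom_coalg_scheme" and g t
    by (rule linear_tlift[OF _ _ _ _ L]) (simp_all add: lin that)
  have "L (tlift R M H ?T (\<lambda>a b. tens R M (tensor R H H) (twist_inv M a) (comul H b)) (\<rho> m))
    = L (tlift R M H ?T (\<lambda>a b. tlift R M H ?T
        (\<lambda>x y. tens R M (tensor R H H) x (tens R H H y (twist_inv H b))) (\<rho> a)) (\<rho> m))"
    using hom_comodule m by (simp add: right_hom_comodule_def)
  then show ?thesis
    by (simp add: Lp Lt lin tlift_tens[OF H.mod H.mod P fs] cong: tlift_cong_simp)
qed

text \<open>Untwisting: \<open>m \<mapsto> \<mu>(m\<^sub>0) \<otimes> \<alpha>(m\<^sub>1)\<close> is an ordinary coaction.\<close>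

abbreviation "uD h \<equiv> comul H (twist H h)"
abbreviation "ur m \<equiv> \<rho> (twist M m)"

lemma untwist: "comodule R H uD (counit H) M ur"
proof (intro comodule.intro coalgebra.intro comodule_axioms.intro)
  let ?T = "tensor R M (tensor R H H)"
  fix m assume m [lin]: "m \<in> carrier M"
  show "tlift R M H ?T (\<lambda>a b. tens R M (tensor R H H) a (uD b)) (ur m) =
    tlift R M H ?T (\<lambda>a b. tlift R M H ?T (\<lambda>x y. tens R M (tensor R H H) x (tens R H H y b))
        (ur a)) (ur m)"
    \<comment> \<open>Two twists per leg are what two successive uses of the untwisted coaction or
      coproduct produce. The outer leg that passes through only one of them, the first on one side
      and the last on the other, is the one that receives the inverse twist.\<close>
    using hcoassoc[where m=m and P = ?T and f="\<lambda>m x y. tens R M (tensor R H H)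
        (twist M (twist M m)) (tens R H H (twist H (twist H x)) (twist H (twist H y)))"]
    by (simp add: lin push tws cong: tlift_cong_simp)
  show "tlift R M H M (\<lambda>a b. counit H b \<odot>\<^bsub>M\<^esub> a) (ur m) = m"
    using r_counit[of "twist M m"] by (simp add: lin M.ti_tw)
qed (simp_all add: lin)

end

locale hom_algebra_object = fixes R :: "('k, 'r) ring_scheme" and A :: "('k, 'a, 'x)
    hom_space_scheme"
  assumes hom_algebra_object: "hom_algebra R A"
begin

sublocale hom_object R A using hom_algebra_object by unfold_locales (simp add: hom_algebra_def)

lemma mult_bil: "bilinear_on R A A A (mult A)"
  and one_closed [lin]: "\<one>\<^bsub>A\<^esub> \<in> carrier A"
  and mult_assoc: "x \<in> carrier A \<Longrightarrow> y \<in> carrier A \<Longrightarrow> z \<in> carrier A \<Longrightarrow>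
    twist A x \<otimes>\<^bsub>A\<^esub> (y \<otimes>\<^bsub>A\<^esub> z) = (x \<otimes>\<^bsub>A\<^esub> y) \<otimes>\<^bsub>A\<^esub> twist A z"
  and mult_one [tws]: "x \<in> carrier A \<Longrightarrow> x \<otimes>\<^bsub>A\<^esub> \<one>\<^bsub>A\<^esub> = twist A x"
    "x \<in> carrier A \<Longrightarrow> \<one>\<^bsub>A\<^esub> \<otimes>\<^bsub>A\<^esub> x = twist A x"
  and tw_mult [tws]: "x \<in> carrier A \<Longrightarrow> y \<in> carrier A \<Longrightarrow> twist A (x \<otimes>\<^bsub>A\<^esub> y) = twist A x \<otimes>\<^bsub>A\<^esub> twist A y"
  and tw_one [tws]: "twist A \<one>\<^bsub>A\<^esub> = \<one>\<^bsub>A\<^esub>"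
  using hom_algebra_object by (auto simp: hom_algebra_def)

lemma mult_closed [lin]: "x \<in> carrier A \<Longrightarrow> y \<in> carrier A \<Longrightarrow> x \<otimes>\<^bsub>A\<^esub> y \<in> carrier A"
  by (rule bilinear_on_closed[OF mult_bil])

lemmas [lin] = linear_on_comp[OF bilinear_on_left[OF mult_bil]]
    linear_on_comp[OF bilinear_on_right[OF mult_bil]]
  bilinear_on_left[OF mult_bil] bilinear_on_right[OF mult_bil]

lemma ti_one [tws]: "twist_inv A \<one>\<^bsub>A\<^esub> = \<one>\<^bsub>A\<^esub>"
  using ti_tw[OF one_closed] tw_one by simp

lemma ti_mult [tws]: "x \<in> carrier A \<Longrightarrow> y \<in> carrier A \<Longrightarrow> twist_inv A (x \<otimes>\<^bsub>A\<^esub> y) =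
    twist_inv A x \<otimes>\<^bsub>A\<^esub> twist_inv A y"
  using ti_tw[of "twist_inv A x \<otimes>\<^bsub>A\<^esub> twist_inv A y"] by (simp add: lin tw_mult tw_ti)

abbreviation "um x y \<equiv> twist_inv A (x \<otimes>\<^bsub>A\<^esub> y)"

lemma um_bil: "bilinear_on R A A A um"
  by (simp add: lin)

lemma um_assoc:
  assumes [lin]: "x \<in> carrier A" "y \<in> carrier A" "z \<in> carrier A"
  shows "um (um x y) z = um x (um y z)"
  using mult_assoc[of "twist_inv A x" "twist_inv A y" "twist_inv A z"] by (simp add: lin tws)

end

section \<open>The data of the theorem and their untwisted model\<close>

locale hom_galois =
  fixes R :: "'k ring" and H :: "('k, 'h) hom_hopf" and A :: "('k, 'a, 'h) comod_alg" and \<phi> :: "'h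
      \<Rightarrow> 'a"
  assumes field: "field R"
    and hopf_algebra: "hom_hopf_algebra R H"
    and S_bij: "bij_betw (antipode H) (carrier H) (carrier H)"
    and comod_algebra: "hom_comodule_algebra R H A"
    and can_surj: "can R H A ` carrier (btensor R (coinv_alg R H A) A (mult A) A (mult A)) =
         carrier (tensor R A H)"
    and integral: "total_integral R H A \<phi>"
begin

sublocale HA: hom_algebra_object R H using hopf_algebra by unfold_locales
    (simp add: hom_hopf_algebra_def)
sublocale AA: hom_algebra_object R A using comod_algebra by unfold_locales
    (simp add: hom_comodule_algebra_def)
sublocale HC: hom_comodule R H H "comul H"
  using hopf_algebra by unfold_locales (simp_all add: hom_hopf_algebra_def hom_coalgebra_def
      right_hom_comodule_def)
sublocale AC: hom_comodule R H A "alg_coact A"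
  using hopf_algebra comod_algebra by unfold_locales
      (simp_all add: hom_hopf_algebra_def hom_comodule_algebra_def)

abbreviation "B \<equiv> coinv_alg R H A"
abbreviation "S \<equiv> antipode H"
abbreviation "S' \<equiv> inv_into (carrier H) (antipode H)"
abbreviation "\<rho>\<^sub>A \<equiv> alg_coact A"

lemma S_lin: "linear_on R H H S"
  and S_tw [tws]: "h \<in> carrier H \<Longrightarrow> S (twist H h) = twist H (S h)"
  and e_mult: "g \<in> carrier H \<Longrightarrow> h \<in> carrier H \<Longrightarrow> counit H (g \<otimes>\<^bsub>H\<^esub> h) = counit H g \<otimes>\<^bsub>R\<^esub> counit H h"
  and e_one: "counit H \<one>\<^bsub>H\<^esub> = \<one>\<^bsub>R\<^esub>"
  and D_one: "comul H \<one>\<^bsub>H\<^esub> = tens R H H \<one>\<^bsub>H\<^esub> \<one>\<^bsub>H\<^esub>"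
  and D_mult: "g \<in> carrier H \<Longrightarrow> h \<in> carrier H \<Longrightarrow> comul H (g \<otimes>\<^bsub>H\<^esub> h) =
    tlift R H H (tensor R H H) (\<lambda>a b. tlift R H H (tensor R H H)
        (\<lambda>c d. tens R H H (a \<otimes>\<^bsub>H\<^esub> c) (b \<otimes>\<^bsub>H\<^esub> d)) (comul H h)) (comul H g)"
  and S_left: "h \<in> carrier H \<Longrightarrow> tlift R H H H (\<lambda>a b. S a \<otimes>\<^bsub>H\<^esub> b) (comul H h) = counit H h \<odot>\<^bsub>H\<^esub> \<one>\<^bsub>H\<^esub>"
  and S_right: "h \<in> carrier H \<Longrightarrow> tlift R H H H (\<lambda>a b. a \<otimes>\<^bsub>H\<^esub> S b) (comul H h) = counit H h \<odot>\<^bsub>H\<^esub> \<one>\<^bsub>H\<^esub>"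
  and left_counit: "h \<in> carrier H \<Longrightarrow> tlift R H H H (\<lambda>a b. counit H a \<odot>\<^bsub>H\<^esub> b) (comul H h) =
      twist_inv H h"
  using hopf_algebra by (auto simp: hom_hopf_algebra_def hom_morphism_def hom_coalgebra_def
      tensor_mult_def)

lemma A_one: "\<rho>\<^sub>A \<one>\<^bsub>A\<^esub> = tens R A H \<one>\<^bsub>A\<^esub> \<one>\<^bsub>H\<^esub>"
  and A_mult: "x \<in> carrier A \<Longrightarrow> y \<in> carrier A \<Longrightarrow> \<rho>\<^sub>A (x \<otimes>\<^bsub>A\<^esub> y) =
    tlift R A H (tensor R A H) (\<lambda>a b. tlift R A H (tensor R A H)
        (\<lambda>c d. tens R A H (a \<otimes>\<^bsub>A\<^esub> c) (b \<otimes>\<^bsub>H\<^esub> d)) (\<rho>\<^sub>A y)) (\<rho>\<^sub>A x)"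
  using comod_algebra by (auto simp: hom_comodule_algebra_def tensor_mult_def)

lemma phi_lin: "linear_on R H A \<phi>"
  and phi_tw [tws]: "h \<in> carrier H \<Longrightarrow> \<phi> (twist H h) = twist A (\<phi> h)"
  and phi_one: "\<phi> \<one>\<^bsub>H\<^esub> = \<one>\<^bsub>A\<^esub>"
  and phi_colin: "h \<in> carrier H \<Longrightarrow> \<rho>\<^sub>A (\<phi> h) = tlift R H H (tensor R A H)
      (\<lambda>a b. tens R A H (\<phi> a) b) (comul H h)"
  using integral by (auto simp: total_integral_def hom_colinear_def hom_morphism_def)

lemmas [lin] = linear_on_comp[OF S_lin] S_lin linear_on_closed[OF S_lin]
   linear_on_comp[OF phi_lin] phi_lin linear_on_closed[OF phi_lin]

lemma e_ti [tws]: "h \<in> carrier H \<Longrightarrow> counit H (twist_inv H h) = counit H h"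
  using HC.e_tw[of "twist_inv H h"] by (simp add: lin HA.tw_ti)

text \<open>\<open>can\<close> lives on the quotient over \<open>B\<close>. Its composite
  \<open>c\<close> with the projection from \<open>A \<otimes> A\<close> is still surjective, since
  the value of \<open>can\<close> on a class is the value of \<open>c\<close> on a representative. A
  linear section of \<open>c\<close>, restricted to the elements \<open>1 \<otimes> h\<close>, is
  the required map.\<close>

lemma ex_sigma:
  "\<exists>\<sigma>. linear_on R H (tensor R A A) \<sigma> \<and> (\<forall>h\<in>carrier H.
      tlift R A A (tensor R A H) (\<lambda>a b. tlift R A H (tensor R A H)
          (\<lambda>b0 b1. tens R A H (twist_inv A a \<otimes>\<^bsub>A\<^esub> b0) (twist H b1)) (\<rho>\<^sub>A b)) (\<sigma> h) =
              tens R A H \<one>\<^bsub>A\<^esub> h)"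
proof -
  let ?AH = "tensor R A H"
  define c where "c = tlift R A A ?AH (\<lambda>a b. tlift R A H ?AH
      (\<lambda>b0 b1. tens R A H (twist_inv A a \<otimes>\<^bsub>A\<^esub> b0) (twist H b1)) (\<rho>\<^sub>A b))"
  have c: "linear_on R (tensor R A A) ?AH c"
    unfolding c_def by (rule tlift_linear) (simp_all add: lin)
  interpret BT: balanced_tensor R B A "mult A" A "mult A"
    by (rule balanced_tensor.intro) (auto simp: lin coinv_alg_def hom_space.defs coinvariants_def)
  have "c ` carrier (tensor R A A) = carrier ?AH"
  proof
    show "c ` carrier (tensor R A A) \<subseteq> carrier ?AH" using linear_on_closed[OF c] by auto
    show "carrier ?AH \<subseteq> c ` carrier (tensor R A A)"
    proof
      fix x assume "x \<in> carrier ?AH"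
      then obtain t where "t \<in> carrier BT.Q" "x = can R H A t" using can_surj by blast
      then show "x \<in> c ` carrier (tensor R A A)"
        using BT.Q_some_rep(1) by (simp add: can_def blift_def c_def)
    qed
  qed
  then obtain g where g: "linear_on R ?AH (tensor R A A) g" "\<And>w. w \<in> carrier ?AH \<Longrightarrow> c (g w) = w"
    using linear_section[OF field _ _ c] by (auto simp: lin)
  show ?thesis
    by (rule exI[of _ "\<lambda>h. g (tens R A H \<one>\<^bsub>A\<^esub> h)"])
      (auto simp: g(2) lin c_def[symmetric] intro!: linear_on_comp[OF g(1)])
qed

definition "\<sigma> = (SOME \<sigma>. linear_on R H (tensor R A A) \<sigma> \<and> (\<forall>h\<in>carrier H.
      tlift R A A (tensor R A H) (\<lambda>a b. tlift R A H (tensor R A H)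
          (\<lambda>b0 b1. tens R A H (twist_inv A a \<otimes>\<^bsub>A\<^esub> b0) (twist H b1)) (\<rho>\<^sub>A b)) (\<sigma> h) =
              tens R A H \<one>\<^bsub>A\<^esub> h))"

lemma sigma_lin [lin]: "linear_on R H (tensor R A A) \<sigma>"
  and sigma: "h \<in> carrier H \<Longrightarrow> tlift R A A (tensor R A H) (\<lambda>a b. tlift R A H (tensor R A H)
          (\<lambda>b0 b1. tens R A H (twist_inv A a \<otimes>\<^bsub>A\<^esub> b0) (twist H b1)) (\<rho>\<^sub>A b)) (\<sigma> h) =
              tens R A H \<one>\<^bsub>A\<^esub> h"
  using someI_ex[OF ex_sigma] unfolding \<sigma>_def by auto

lemma S'_lin: "linear_on R H H S'"
  by (rule linear_on_inverse[OF S_lin HA.mod S_bij])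

text \<open>In the untwisted product and coaction the formula for \<open>can\<close> becomes the
  classical \<open>r l\<^sub>0 \<otimes> l\<^sub>1\<close>: one has \<open>\<beta>\<^sup>-\<^sup>1(r
  \<beta>(b)) = \<beta>\<^sup>-\<^sup>1(r) b\<close>, and the twist on the \<open>H\<close>-leg is
  that of the untwisted coaction. This is why \<sigma> can be reused as it is.\<close>

sublocale U: comodule_algebra R H HC.uD "counit H" HA.um "\<one>\<^bsub>H\<^esub>" S S' A AC.ur AA.um "\<one>\<^bsub>A\<^esub>" \<phi> \<sigma>
proof (intro comodule_algebra.intro hopf_algebra_bij.intro hopf_algebra.intro HC.untwist
    AC.untwist hopf_algebra_axioms.intro
    hopf_algebra_bij_axioms.intro comodule_algebra_axioms.intro HA.um_bil AA.um_bil HA.um_assoc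
        AA.um_assoc
    HA.one_closed AA.one_closed S_lin S'_lin phi_lin sigma_lin phi_one e_one)
  let ?HH = "tensor R H H"
  fix g h assume g [lin]: "g \<in> carrier H" and h [lin]: "h \<in> carrier H"
  show "HC.uD (HA.um g h) = tlift R H H ?HH (\<lambda>a b. tlift R H H ?HH
      (\<lambda>c d. tens R H H (HA.um a c) (HA.um b d)) (HC.uD h)) (HC.uD g)"
    by (simp add: D_mult HA.tw_ti lin tws push cong: tlift_cong_simp)
  show "counit H (HA.um g h) = counit H g \<otimes>\<^bsub>R\<^esub> counit H h"
    by (simp add: e_ti e_mult lin)
next
  let ?HH = "tensor R H H"
  fix h assume h [lin]: "h \<in> carrier H"
  show "HA.um h \<one>\<^bsub>H\<^esub> = h" "HA.um \<one>\<^bsub>H\<^esub> h = h" by (simp_all add: lin HA.mult_one HA.ti_tw)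
  show "tlift R H H H (\<lambda>a. (\<odot>\<^bsub>H\<^esub>) (counit H a)) (HC.uD h) = h"
    using left_counit[of "twist H h"] by (simp add: lin HA.ti_tw)
  show "tlift R H H H (\<lambda>a. HA.um (S a)) (HC.uD h) = counit H h \<odot>\<^bsub>H\<^esub> \<one>\<^bsub>H\<^esub>"
    "tlift R H H H (\<lambda>a b. HA.um a (S b)) (HC.uD h) = counit H h \<odot>\<^bsub>H\<^esub> \<one>\<^bsub>H\<^esub>"
    by (simp_all add: tws lin push S_left S_right cong: tlift_cong_simp)
  show "S (S' h) = h" "S' (S h) = h" using S_bij h by (auto simp: bij_betw_def f_inv_into_f)
  show "AC.ur (\<phi> h) = tlift R H H (tensor R A H) (\<lambda>a. tens R A H (\<phi> a)) (HC.uD h)"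
    by (simp add: tws lin push phi_colin cong: tlift_cong_simp)
  show "tlift R A A (tensor R A H) (\<lambda>r l. tlift R A H (tensor R A H) (\<lambda>x. tens R A H (AA.um r x))
      (AC.ur l)) (\<sigma> h) = tens R A H \<one>\<^bsub>A\<^esub> h"
    unfolding sigma[OF h, symmetric]
    by (simp add: lin tws push linear_on_closed[OF sigma_lin] cong: tlift_cong_simp)
next
  fix x y assume x [lin]: "x \<in> carrier A" and y [lin]: "y \<in> carrier A"
  show "AC.ur (AA.um x y) = tlift R A H (tensor R A H)
      (\<lambda>a b. tlift R A H (tensor R A H) (\<lambda>c d. tens R A H (AA.um a c) (HA.um b d)) (AC.ur y))
      (AC.ur x)"
    by (simp add: A_mult AA.tw_ti lin tws push cong: tlift_cong_simp)
next
  fix x assume x [lin]: "x \<in> carrier A"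
  show "AA.um x \<one>\<^bsub>A\<^esub> = x" "AA.um \<one>\<^bsub>A\<^esub> x = x" by (simp_all add: lin AA.mult_one AA.ti_tw)
next
  show "HC.uD \<one>\<^bsub>H\<^esub> = tens R H H \<one>\<^bsub>H\<^esub> \<one>\<^bsub>H\<^esub>" by (simp add: HA.tw_one D_one)
  show "AC.ur \<one>\<^bsub>A\<^esub> = tens R A H \<one>\<^bsub>A\<^esub> \<one>\<^bsub>H\<^esub>" by (simp add: AA.tw_one A_one)
qed

end

section \<open>Hom-Hopf modules and the adjunction\<close>

text \<open>\<open>functor_F\<close>, \<open>functor_G\<close> and \<open>coinv_alg\<close> rebuild
  records, so one linear structure occurs inside several records. Results are transported between
  them through the fields that linear algebra reads.\<close>

lemma module_fields_cong:
  assumes "module R M" "carrier M' = carrier M" "add M' = add M" "zero M' = zero M" "smult M' =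
      smult M"
  shows "module R M'"
proof -
  interpret M: module R M by fact
  have "abelian_group M'"
    by (rule abelian_groupI) (auto simp: assms M.a_ac intro: bexI[of _ "\<ominus>\<^bsub>M\<^esub> _"] M.l_neg)
  then show ?thesis
    by (rule moduleI[OF M.is_cring]) (auto simp: assms M.smult_l_distr M.smult_r_distr
        M.smult_assoc1)
qed

lemma linear_on_fields_cong:
  assumes "carrier M' = carrier M" "add M' = add M" "smult M' = smult M"
  shows "linear_on R M' N f = linear_on R M N f" "linear_on R N M' g = linear_on R N M g"
  by (simp_all add: linear_on_def assms)

lemma tensor_fields_cong:
  assumes "carrier M' = carrier M" "add M' = add M" "smult M' = smult M"
  shows "tensor R M' N = tensor R M N" "tens R M' N = tens R M N"
proof -
  have "tensor_ker R M' N = tensor_ker R M N" by (simp add: tensor_ker_def tensor_rels_def assms)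
  then show "tensor R M' N = tensor R M N" "tens R M' N = tens R M N"
    by (auto simp: tensor_def tens_def assms intro!: ext)
qed

lemma tlift_fields_cong:
  "tlift R M' N P f t = tlift R M N P f t"
  "carrier P' = carrier P \<Longrightarrow> add P' = add P \<Longrightarrow> zero P' = zero P \<Longrightarrow> smult P' = smult P \<Longrightarrow>
    tlift R M N P' f t = tlift R M N P f t"
  by (simp_all add: tlift_def finsum_def finprod_def Let_def cong: if_cong)

section \<open>Bijective morphisms are isomorphisms\<close>

lemma bij_betw_inv_intoD:
  assumes "bij_betw f X Y" "y \<in> Y"
  shows "inv_into X f y \<in> X" "f (inv_into X f y) = y"
  using assms by (auto simp: bij_betw_def inv_into_into f_inv_into_f)

lemma hom_morphism_inverse:
  assumes f: "hom_morphism R M N f" and bij: "bij_betw f (carrier M) (carrier N)"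
    and M: "is_hom_space R M"
  shows "hom_morphism R N M (inv_into (carrier M) f)"
proof -
  interpret M: hom_object R M by unfold_locales fact
  let ?g = "inv_into (carrier M) f"
  note g = bij_betw_inv_intoD[OF bij]
  have gf: "?g (f x) = x" if "x \<in> carrier M" for x using that bij by (auto simp: bij_betw_def)
  have "twist M (?g n) = ?g (twist N n)" if n: "n \<in> carrier N" for n
  proof -
    have "twist N (f (?g n)) = f (twist M (?g n))"
      using f g(1)[OF n] by (simp add: hom_morphism_def del: g(2))
    then have "?g (f (twist M (?g n))) = ?g (twist N n)"
      using g(2)[OF n] by simp
    then show ?thesis using g n by (simp add: gf lin)
  qed
  then show ?thesis using f M.mod bij by (simp add: hom_morphism_def linear_on_inverse)
qed

lemma rmod_mor_inverse:
  assumes f: "rmod_mor R B M N f" and bij: "bij_betw f (carrier M) (carrier N)"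
  shows "rmod_mor R B N M (inv_into (carrier M) f)"
proof -
  let ?g = "inv_into (carrier M) f"
  note g = bij_betw_inv_intoD[OF bij]
  have gf: "?g (f x) = x" if "x \<in> carrier M" for x using that bij by (auto simp: bij_betw_def)
  have act: "act M m b \<in> carrier M" if "m \<in> carrier M" "b \<in> carrier B" for m b
    using f that unfolding rmod_mor_def rmod_obj_def right_hom_module_def
    by (blast intro: bilinear_on_closed)
  have "?g (act N n b) = act M (?g n) b" if "n \<in> carrier N" "b \<in> carrier B" for n b
  proof -
    have "?g (f (act M (?g n) b)) = ?g (act N n b)"
      using f that g by (simp add: rmod_mor_def)
    then show ?thesis using g that act by (simp add: gf)
  qed
  moreover have "hom_morphism R N M ?g"
    using f by (intro hom_morphism_inverse bij)
        (auto simp: rmod_mor_def rmod_obj_def right_hom_module_def)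
  ultimately show ?thesis using f by (simp add: rmod_mor_def)
qed

lemma rmod_isoI:
  assumes "rmod_mor R B M N f" "bij_betw f (carrier M) (carrier N)"
  shows "rmod_iso R B M N f"
  using assms rmod_mor_inverse[OF assms] bij_betw_inv_intoD[OF assms(2)]
  unfolding rmod_iso_def by (auto simp: bij_betw_def intro!: exI[of _ "inv_into (carrier M) f"])

text \<open>Colinearity of the inverse \<open>g\<close> comes from applying
  \<open>g \<otimes> id\<close> to the colinearity of \<open>f\<close> at \<open>m\<close>;
  surjectivity of \<open>f\<close> then covers all of \<open>N\<close>.\<close>

lemma hopf_mod_isoI:
  assumes f: "hopf_mod_mor R H A M N f" and bij: "bij_betw f (carrier M) (carrier N)"
    and H: "module R H"
  shows "hopf_mod_iso R H A M N f"
proof -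
  let ?g = "inv_into (carrier M) f"
  note g = bij_betw_inv_intoD[OF bij]
  have gf: "?g (f x) = x" if "x \<in> carrier M" for x using that bij by (auto simp: bij_betw_def)
  have mor: "rmod_mor R A M N f" and col: "hom_colinear R H M (coact M) N (coact N) f"
    and com: "right_hom_comodule R H M (coact M)"
    using f by (auto simp: hopf_mod_mor_def hopf_mod_obj_def)
  note gm = rmod_mor_inverse[OF mor bij]
  have M [lin]: "module R M" and N [lin]: "module R N"
    using mor by (auto simp: rmod_mor_def rmod_obj_def right_hom_module_def is_hom_space_def)
  have fl: "linear_on R M N f" and gl: "linear_on R N M ?g"
    using mor gm by (auto simp: rmod_mor_def hom_morphism_def)
  note [lin] = H linear_on_comp[OF fl] linear_on_comp[OF gl] fl gl linear_on_closed[OF fl]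
      linear_on_closed[OF gl]
  have cM: "coact M m \<in> carrier (tensor R M H)" if "m \<in> carrier M" for m
    using com that by (auto simp: right_hom_comodule_def intro: linear_on_closed)
  have "tlift R N H (tensor R M H) (\<lambda>n0 n1. tens R M H (?g n0) n1) (coact N (f m)) = coact M m"
    if m: "m \<in> carrier M" for m
    using col cM[OF m] m unfolding hom_colinear_def
    by (simp add: lin push gf tensor_expand cong: tlift_cong_simp)
  then have "coact M (?g n) = tlift R N H (tensor R M H) (\<lambda>n0 n1. tens R M H (?g n0) n1)
      (coact N n)"
    if "n \<in> carrier N" for n
    using g[OF that] by metis
  then have "hom_colinear R H N (coact N) M (coact M) ?g"
    using gm by (auto simp: hom_colinear_def rmod_mor_def)
  then have "hopf_mod_mor R H A N M ?g"
    using f gm by (auto simp: hopf_mod_mor_def)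
  then show ?thesis using f g gf unfolding hopf_mod_iso_def by (auto intro!: exI[of _ ?g])
qed

text \<open>\<open>twist_inv\<close> is an \<open>inv_into\<close> on the carrier, so it has to be
  compared when the carrier shrinks. Stability of \<open>K\<close> under the inverse twist makes the
  twist a bijection of \<open>K\<close>, and the two inverses agree there.\<close>

lemma submodule_hom_space:
  assumes M: "is_hom_space R M" and K: "submodule K R M"
    and tw: "\<And>x. x \<in> K \<Longrightarrow> twist M x \<in> K" and ti: "\<And>x. x \<in> K \<Longrightarrow> twist_inv M x \<in> K"
    and M': "carrier M' = K" "add M' = add M" "zero M' = zero M" "smult M' = smult M" "twist M' =
        twist M"
  shows "is_hom_space R M'" and "x \<in> K \<Longrightarrow> twist_inv M' x = twist_inv M x"
proof -
  interpret M: hom_object R M by unfold_locales fact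
  interpret MM: module R M by (rule M.mod)
  have KM: "x \<in> carrier M" if "x \<in> K" for x using MM.submoduleE(1)[OF K] that by auto
  have "module R (M\<lparr>carrier := K\<rparr>)" by (rule submodule.submodule_is_module[OF K M.mod])
  then have "module R M'" by (rule module_fields_cong) (simp_all add: M')
  moreover have bij: "bij_betw (twist M) K K"
    by (rule bij_betw_byWitness[of _ "twist_inv M"]) (auto simp: tw ti M.tw_ti M.ti_tw KM)
  moreover have "linear_on R M' M' (twist M)"
    using M.tw_lin0 tw KM by (auto simp: linear_on_def M')
  ultimately show "is_hom_space R M'" by (simp add: is_hom_space_def M')
  show "twist_inv M' x = twist_inv M x" if x: "x \<in> K"
  proof -
    have "inv_into K (twist M) (twist M (twist_inv M x)) = twist_inv M x"
      using bij ti[OF x] by (auto simp: bij_betw_def)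
    then show ?thesis using x KM by (simp add: twist_inv_def[of M'] M' M.tw_ti)
  qed
qed

section \<open>Coinvariants and the Hom-algebra \<open>B\<close>\<close>

context hom_galois begin

text \<open>Twisting both legs is invertible and turns \<rho>(x) into \<rho>(\<mu>(x)). Hence the
  Hom-coinvariants are the ordinary coinvariants of the untwisted coaction, which lets
  \<open>tr_coinv\<close> of the untwisted model speak about them.\<close>

lemma coinv_iff:
  assumes "hom_comodule R H M \<rho>"
  shows "x \<in> coinvariants R H M \<rho> \<longleftrightarrow> x \<in> carrier M \<and> \<rho> (twist M x) = tens R M H x \<one>\<^bsub>H\<^esub>"
proof -
  interpret MC: hom_comodule R H M \<rho> by fact
  have "\<rho> (twist M x) = tens R M H x \<one>\<^bsub>H\<^esub>"
    if "x \<in> carrier M" and eq: "\<rho> x = tens R M H (twist_inv M x) \<one>\<^bsub>H\<^esub>"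
    using that(1) by (simp add: eq lin tws push)
  moreover have "\<rho> x = tens R M H (twist_inv M x) \<one>\<^bsub>H\<^esub>"
    if "x \<in> carrier M" and eq: "\<rho> (twist M x) = tens R M H x \<one>\<^bsub>H\<^esub>"
  proof -
    let ?g = "tlift R M H (tensor R M H) (\<lambda>a b. tens R M H (twist_inv M a) (twist_inv H b))"
    have "\<rho> x = ?g (\<rho> (twist M x))"
      using that(1) by (simp add: lin tws push tensor_expand cong: tlift_cong_simp)
    then show ?thesis unfolding eq using that(1) by (simp add: lin push tws)
  qed
  ultimately show ?thesis unfolding coinvariants_def mem_Collect_eq by metis
qed

lemma
  assumes "hom_comodule R H M \<rho>"
  shows coinv_submodule: "submodule (coinvariants R H M \<rho>) R M"
    and coinv_tw: "x \<in> coinvariants R H M \<rho> \<Longrightarrow> twist M x \<in> coinvariants R H M \<rho>"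
    and coinv_ti: "x \<in> coinvariants R H M \<rho> \<Longrightarrow> twist_inv M x \<in> coinvariants R H M \<rho>"
proof -
  interpret MC: hom_comodule R H M \<rho> by fact
  interpret M: module R M by (rule MC.M.mod)
  define f where "f x = tens R M H (twist_inv M x) \<one>\<^bsub>H\<^esub>" for x
  have f: "linear_on R M (tensor R M H) f" by (simp add: f_def[abs_def] lin)
  have MH: "module R (tensor R M H)" by (simp add: lin)
  show "submodule (coinvariants R H M \<rho>) R M" unfolding coinvariants_def f_def[symmetric]
    by (rule M.submoduleI) (auto simp: linear_on_zero[OF M.module_axioms MH]
        linear_on_neg[OF M.module_axioms MH]
        linear_on_add linear_on_scale f MC.r_lin0
      linear_on_add[OF f] linear_on_add[OF MC.r_lin0] linear_on_scale[OF f]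
          linear_on_scale[OF MC.r_lin0])
  show "twist M x \<in> coinvariants R H M \<rho>" if "x \<in> coinvariants R H M \<rho>"
    using that unfolding coinv_iff[OF assms]
    by (simp add: MC.r_tw[of "twist M x"] lin tws push del: MC.r_tw)
  show "twist_inv M x \<in> coinvariants R H M \<rho>" if "x \<in> coinvariants R H M \<rho>"
    using that[unfolded coinvariants_def] unfolding coinv_iff[OF assms] by (simp add: lin tws)
qed

lemma B_simps [simp]: "carrier B = coinvariants R H A \<rho>\<^sub>A" "mult B = mult A" "one B =
    one A" "add B = add A"
  "zero B = zero A" "smult B = smult A" "twist B = twist A"
  by (simp_all add: coinv_alg_def hom_space.defs)

lemma B_A [lin]: "b \<in> coinvariants R H A \<rho>\<^sub>A \<Longrightarrow> b \<in> carrier A"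
  by (simp add: coinvariants_def)

lemma B_coact: "b \<in> coinvariants R H A \<rho>\<^sub>A \<Longrightarrow> \<rho>\<^sub>A b = tens R A H (twist_inv A b) \<one>\<^bsub>H\<^esub>"
  by (simp add: coinvariants_def)

lemmas [lin] = coinv_tw[OF AC.hom_comodule_axioms] coinv_ti[OF AC.hom_comodule_axioms]

lemma linear_on_B [lin]: "linear_on R A P f \<Longrightarrow> linear_on R B P f"
  by (auto simp: linear_on_def lin)

lemma tr_e_B [lin]: "a \<in> carrier A \<Longrightarrow> U.AA.tr a \<one>\<^bsub>A\<^esub> \<in> coinvariants R H A \<rho>\<^sub>A"
  using U.AA.tr_coinv[of a "\<one>\<^bsub>A\<^esub>"] U.AA.tr_closed[of a "\<one>\<^bsub>A\<^esub>"] by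
      (simp add: coinv_iff[OF AC.hom_comodule_axioms] lin)

end

section \<open>Hom-Hopf modules and the functor \<open>G\<close>\<close>

locale hom_hopf_module = hom_galois R H A \<phi> for R :: "'k ring" and H :: "('k, 'h) hom_hopf"
  and A :: "('k, 'a, 'h) comod_alg" and \<phi> :: "'h \<Rightarrow> 'a" +
  fixes N :: "('k, 'n, 'a, 'h, 'z) hopf_mod_scheme"
  assumes N: "hopf_mod_obj R H A N"
begin

sublocale NC: hom_comodule R H N "coact N"
  using N HC.hcoalg by unfold_locales (auto simp: hopf_mod_obj_def)

lemma ac_bil: "bilinear_on R N A N (act N)"
  and ac_assoc: "n \<in> carrier N \<Longrightarrow> x \<in> carrier A \<Longrightarrow> y \<in> carrier A \<Longrightarrow>
    act N (act N n x) (twist A y) = act N (twist N n) (x \<otimes>\<^bsub>A\<^esub> y)"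
  and ac_one [tws]: "n \<in> carrier N \<Longrightarrow> act N n \<one>\<^bsub>A\<^esub> = twist N n"
  and tw_ac [tws]: "n \<in> carrier N \<Longrightarrow> x \<in> carrier A \<Longrightarrow> twist N (act N n x) =
      act N (twist N n) (twist A x)"
  and N_mult: "n \<in> carrier N \<Longrightarrow> x \<in> carrier A \<Longrightarrow> coact N (act N n x) =
    tlift R N H (tensor R N H) (\<lambda>a b. tlift R A H (tensor R N H)
        (\<lambda>c d. tens R N H (act N a c) (b \<otimes>\<^bsub>H\<^esub> d)) (\<rho>\<^sub>A x)) (coact N n)"
  using N by (auto simp: hopf_mod_obj_def rmod_obj_def right_hom_module_def)

lemma ac_closed [lin]: "x \<in> carrier N \<Longrightarrow> y \<in> carrier A \<Longrightarrow> act N x y \<in> carrier N"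
  by (rule bilinear_on_closed[OF ac_bil])

lemmas [lin] = linear_on_comp[OF bilinear_on_left[OF ac_bil]]
    linear_on_comp[OF bilinear_on_right[OF ac_bil]]
  bilinear_on_left[OF ac_bil] bilinear_on_right[OF ac_bil]

lemma ti_ac [tws]: "x \<in> carrier N \<Longrightarrow> y \<in> carrier A \<Longrightarrow> twist_inv N (act N x y) =
    act N (twist_inv N x) (twist_inv A y)"
  using NC.M.ti_tw[of "act N (twist_inv N x) (twist_inv A y)"] by
      (simp add: lin tw_ac NC.M.tw_ti AA.tw_ti)

abbreviation "uac n x \<equiv> twist_inv N (act N n x)"

sublocale UN: hopf_module R H HC.uD "counit H" HA.um "\<one>\<^bsub>H\<^esub>" S S' A AC.ur AA.um "\<one>\<^bsub>A\<^esub>" \<phi> \<sigma> N NC.ur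
    uac
proof (intro hopf_module.intro U.comodule_algebra_axioms NC.untwist hopf_module_axioms.intro)
  show "bilinear_on R N A N uac" by (simp add: lin)
  fix n assume n [lin]: "n \<in> carrier N"
  show "uac n \<one>\<^bsub>A\<^esub> = n" by (simp add: lin ac_one NC.M.ti_tw)
  fix x assume x [lin]: "x \<in> carrier A"
  show "NC.ur (uac n x) = tlift R N H (tensor R N H)
      (\<lambda>a b. tlift R A H (tensor R N H) (\<lambda>c d. tens R N H (uac a c) (HA.um b d)) (AC.ur x))
      (NC.ur n)"
    by (simp add: N_mult NC.M.tw_ti lin tws push cong: tlift_cong_simp)
  fix y assume y [lin]: "y \<in> carrier A"
  show "uac (uac n x) y = uac n (AA.um x y)"
    using ac_assoc[of "twist_inv N n" "twist_inv A x" "twist_inv A y"]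
    using ac_assoc[of "twist_inv N (twist_inv N n)" "twist_inv A (twist_inv A x)" "twist_inv A y"]
    by (simp add: lin tws)
qed

abbreviation "G \<equiv> functor_G R H N"

lemma G_simps [simp]: "carrier G = coinvariants R H N (coact N)" "add G = add N" "zero G = zero N"
  "smult G = smult N" "twist G = twist N"
  and G_act: "act G = act N"
  by (simp_all add: functor_G_def hom_rmod.defs)

lemma G_N [lin]: "n \<in> coinvariants R H N (coact N) \<Longrightarrow> n \<in> carrier N"
  by (simp add: coinvariants_def)

lemma G_coact: "n \<in> coinvariants R H N (coact N) \<Longrightarrow> coact N n = tens R N H (twist_inv N n) \<one>\<^bsub>H\<^esub>"
  by (simp add: coinvariants_def)

lemma G_ur: "n \<in> coinvariants R H N (coact N) \<Longrightarrow> NC.ur n = tens R N H n \<one>\<^bsub>H\<^esub>"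
  by (simp add: coinv_iff[OF NC.hom_comodule_axioms])

lemmas [lin] = coinv_tw[OF NC.hom_comodule_axioms] coinv_ti[OF NC.hom_comodule_axioms]

lemma G_hom_space: "is_hom_space R G"
  and G_ti [simp]: "n \<in> coinvariants R H N (coact N) \<Longrightarrow> twist_inv G n = twist_inv N n"
  by (rule submodule_hom_space[OF NC.M.hom_object coinv_submodule[OF NC.hom_comodule_axioms]];
      simp add: lin)+

lemma linear_on_G [lin]: "linear_on R N P f \<Longrightarrow> linear_on R G P f"
  by (auto simp: linear_on_def lin)

lemma linear_on_into_G: "linear_on R X N f \<Longrightarrow> (\<And>x. x \<in> carrier X
    \<Longrightarrow> f x \<in> coinvariants R H N (coact N)) \<Longrightarrow> linear_on R X G f"
  by (auto simp: linear_on_def lin)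

lemma ac_coinv [lin]:
  assumes "n \<in> coinvariants R H N (coact N)" "b \<in> coinvariants R H A \<rho>\<^sub>A"
  shows "act N n b \<in> coinvariants R H N (coact N)"
proof -
  have [lin]: "n \<in> carrier N" "b \<in> carrier A" using assms by (simp_all add: lin)
  have "coact N (act N n b) = tens R N H (twist_inv N (act N n b)) \<one>\<^bsub>H\<^esub>"
    by (simp add: N_mult G_coact[OF assms(1)] B_coact[OF assms(2)] lin push tws)
  then show ?thesis unfolding coinvariants_def by (simp add: lin)
qed

lemma G_obj: "rmod_obj R B G"
  unfolding rmod_obj_def right_hom_module_def
proof (intro conjI ballI)
  show "bilinear_on R G B G (act G)"
    by (rule bilinear_onI; rule linear_on_into_G) (simp_all add: G_act lin)
qed (simp_all add: G_hom_space G_act lin ac_assoc tws)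

lemma tr_coinv [lin]: "n \<in> carrier N \<Longrightarrow> a \<in> carrier A \<Longrightarrow> UN.tr n a \<in> coinvariants R H N (coact N)"
  using UN.tr_coinv[of n a] UN.tr_closed[of n a] by (simp add: coinv_iff[OF NC.hom_comodule_axioms])

end

section \<open>The induced module \<open>M \<otimes>\<^sub>B A\<close>\<close>

locale coinv_module = hom_galois R H A \<phi> for R :: "'k ring" and H :: "('k, 'h) hom_hopf"
  and A :: "('k, 'a, 'h) comod_alg" and \<phi> :: "'h \<Rightarrow> 'a" +
  fixes M :: "('k, 'm, 'a, 'z) hom_rmod_scheme"
  assumes M: "rmod_obj R B M"
begin

sublocale M: hom_object R M using M by unfold_locales (simp add: rmod_obj_def right_hom_module_def)

lemma ra_bil: "bilinear_on R M B M (act M)"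
  and ra_assoc: "m \<in> carrier M \<Longrightarrow> x \<in> coinvariants R H A \<rho>\<^sub>A \<Longrightarrow> y \<in> coinvariants R H A \<rho>\<^sub>A \<Longrightarrow>
    act M (act M m x) (twist A y) = act M (twist M m) (x \<otimes>\<^bsub>A\<^esub> y)"
  and ra_one [tws]: "m \<in> carrier M \<Longrightarrow> act M m \<one>\<^bsub>A\<^esub> = twist M m"
  and tw_ra [tws]: "m \<in> carrier M \<Longrightarrow> x \<in> coinvariants R H A \<rho>\<^sub>A \<Longrightarrow> twist M (act M m x) =
      act M (twist M m) (twist A x)"
  using M by (auto simp: rmod_obj_def right_hom_module_def)

lemma ra_closed [lin]: "x \<in> carrier M \<Longrightarrow> y \<in> coinvariants R H A \<rho>\<^sub>A \<Longrightarrow> act M x y \<in> carrier M"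
  using bilinear_on_closed[OF ra_bil] by simp

lemma ra_lin [lin]: "y \<in> coinvariants R H A \<rho>\<^sub>A \<Longrightarrow> linear_on R X M f
    \<Longrightarrow> linear_on R X M (\<lambda>x. act M (f x) y)"
  "m \<in> carrier M \<Longrightarrow> linear_on R X B g \<Longrightarrow> linear_on R X M (\<lambda>x. act M m (g x))"
  by (simp_all add: linear_on_comp[OF bilinear_on_left[OF ra_bil]]
      linear_on_comp[OF bilinear_on_right[OF ra_bil]])

lemma ti_ra [tws]: "x \<in> carrier M \<Longrightarrow> y \<in> coinvariants R H A \<rho>\<^sub>A \<Longrightarrow> twist_inv M (act M x y) =
    act M (twist_inv M x) (twist_inv A y)"
  using M.ti_tw[of "act M (twist_inv M x) (twist_inv A y)"] by
      (simp add: lin tw_ra M.tw_ti AA.tw_ti)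

sublocale BT: balanced_tensor R B M "act M" A "mult A"
  by (rule balanced_tensor.intro) (simp_all add: lin)

abbreviation "Q \<equiv> BT.Q"
abbreviation "bt \<equiv> BT.bt"
abbreviation "QH \<equiv> tensor R Q H"

lemma Q_mod [lin]: "module R Q" by (rule BT.Q_module)
lemma bt_closed [lin]: "m \<in> carrier M \<Longrightarrow> a \<in> carrier A \<Longrightarrow> bt m a \<in> carrier Q"
  by (rule bilinear_on_closed[OF BT.bt_bilinear])
lemmas [lin] = linear_on_comp[OF bilinear_on_left[OF BT.bt_bilinear]]
    linear_on_comp[OF bilinear_on_right[OF BT.bt_bilinear]]
  bilinear_on_left[OF BT.bt_bilinear] bilinear_on_right[OF BT.bt_bilinear]

lemma bt_push [push]:
  assumes "module R K" "module R L" "t \<in> carrier (tensor R K L)"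
  shows "(\<And>a b. a \<in> carrier K \<Longrightarrow> b \<in> carrier L \<Longrightarrow> f a b \<in> carrier M) \<Longrightarrow> x \<in> carrier A \<Longrightarrow>
      bt (tlift R K L M f t) x = tlift R K L Q (\<lambda>a b. bt (f a b) x) t"
    and "(\<And>a b. a \<in> carrier K \<Longrightarrow> b \<in> carrier L \<Longrightarrow> g a b \<in> carrier A) \<Longrightarrow> n \<in> carrier M \<Longrightarrow>
      bt n (tlift R K L A g t) = tlift R K L Q (\<lambda>a b. bt n (g a b)) t"
  by (rule linear_tlift; simp add: assms lin)+

lemma bt_bal: "m \<in> carrier M \<Longrightarrow> b \<in> coinvariants R H A \<rho>\<^sub>A \<Longrightarrow> a \<in> carrier A \<Longrightarrow>
    bt (act M m b) (twist A a) = bt (twist M m) (b \<otimes>\<^bsub>A\<^esub> a)"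
  using BT.bt_balanced[of m b a] by simp

text \<open>The shift by inverse twists frees \<open>m\<close> and \<open>a\<close> from their
  twists: in untwisted notation this is the usual relation
  \<open>m b \<otimes> a = m \<otimes> b a\<close>.\<close>

lemma bt_bal': "m \<in> carrier M \<Longrightarrow> b \<in> coinvariants R H A \<rho>\<^sub>A \<Longrightarrow> a \<in> carrier A \<Longrightarrow>
    bt (act M (twist_inv M m) (twist_inv A b)) a = bt m (twist_inv A b \<otimes>\<^bsub>A\<^esub> twist_inv A a)"
  using bt_bal[of "twist_inv M m" "twist_inv A b" "twist_inv A a"] by (simp add: lin tws)

abbreviation "F \<equiv> functor_F R H A M"

lemma F_carrier [simp]: "carrier F = carrier Q" "add F = add Q" "zero F = zero Q" "smult F =
    smult Q"
  by (simp_all add: functor_F_def Let_def)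

lemma F_cong [simp]: "linear_on R F X f = linear_on R Q X f" "linear_on R X F g = linear_on R X Q g"
  "tensor R F X = tensor R Q X" "tens R F X = tens R Q X" "tlift R F X = tlift R Q X"
  "tlift R X Y F = tlift R X Y Q"
  by (rule linear_on_fields_cong tensor_fields_cong ext tlift_fields_cong F_carrier)+

lemma twist_F [simp]: "m \<in> carrier M \<Longrightarrow> a \<in> carrier A \<Longrightarrow> twist F (bt m a) =
    bt (twist M m) (twist A a)"
  and twist_F_lin: "linear_on R Q Q (twist F)"
proof -
  have *: "twist F = blift R M A Q (\<lambda>m a. bt (twist M m) (twist A a))"
    by (simp add: functor_F_def Let_def)
  have bil: "bilinear_on R M A Q (\<lambda>m a. bt (twist M m) (twist A a))" by (simp add: lin)
  have bal: "bt (twist M (act M m b)) (twist A (twist A a)) =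
      bt (twist M (twist M m)) (twist A (b \<otimes>\<^bsub>A\<^esub> a))"
    if "m \<in> carrier M" "b \<in> carrier B" "a \<in> carrier A" for m b a
    using that by (simp add: lin tws bt_bal)
  show "m \<in> carrier M \<Longrightarrow> a \<in> carrier A \<Longrightarrow> twist F (bt m a) = bt (twist M m) (twist A a)"
    "linear_on R Q Q (twist F)"
    unfolding * by (rule BT.blift_balanced[OF Q_mod bil bal]; assumption)+
qed

text \<open>The inverse twist is induced by \<open>twist_inv\<close> on both factors; it descends to
  the quotient because \<open>bt_bal'\<close> is the balancing relation shifted by inverse
  twists.\<close>

lemma F_hom_object: "is_hom_space R F" and ti_F [simp]: "m \<in> carrier M \<Longrightarrow> a \<in> carrier A
    \<Longrightarrow> twist_inv F (bt m a) = bt (twist_inv M m) (twist_inv A a)"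
proof -
  let ?g = "blift R M A Q (\<lambda>m a. bt (twist_inv M m) (twist_inv A a))"
  have bil: "bilinear_on R M A Q (\<lambda>m a. bt (twist_inv M m) (twist_inv A a))" by (simp add: lin)
  have bal: "bt (twist_inv M (act M m b)) (twist_inv A (twist A a)) =
      bt (twist_inv M (twist M m)) (twist_inv A (b \<otimes>\<^bsub>A\<^esub> a))"
    if "m \<in> carrier M" "b \<in> carrier B" "a \<in> carrier A" for m b a
    using that by (simp add: lin tws bt_bal')
  have g: "linear_on R Q Q ?g" and gb: "m \<in> carrier M \<Longrightarrow> a \<in> carrier A \<Longrightarrow> ?g (bt m a) =
      bt (twist_inv M m) (twist_inv A a)" for m a
    by (rule BT.blift_balanced[OF Q_mod bil bal]; assumption)+
  note l [lin] = linear_on_comp[OF g] linear_on_comp[OF twist_F_lin] linear_on_closed[OF g]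
      linear_on_closed[OF twist_F_lin]
  have 1: "?g (twist F u) = u" if "u \<in> carrier Q" for u
    by (rule BT.Q_ext[OF Q_mod _ _ _ that, where f="\<lambda>u. ?g (twist F u)"]) (simp_all add: lin gb tws)
  have 2: "twist F (?g u) = u" if "u \<in> carrier Q" for u
    by (rule BT.Q_ext[OF Q_mod _ _ _ that, where f="\<lambda>u. twist F (?g u)"]) (simp_all add: lin gb tws)
  have bij: "bij_betw (twist F) (carrier Q) (carrier Q)"
    by (rule bij_betw_byWitness[of _ ?g]) (auto simp: 1 2 lin)
  then show "is_hom_space R F"
    using module_fields_cong[OF Q_mod, of F] by (simp add: is_hom_space_def twist_F_lin)
  show "twist_inv F (bt m a) = bt (twist_inv M m) (twist_inv A a)" if "m \<in> carrier M" "a \<in> carrier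
      A"
  proof -
    have u: "bt m a \<in> carrier Q" using that by (simp add: lin)
    then have "inv_into (carrier Q) (twist F) (twist F (?g (bt m a))) = ?g (bt m a)"
      using bij by (simp add: bij_betw_def lin)
    then have "inv_into (carrier Q) (twist F) (bt m a) = ?g (bt m a)"
      by (simp only: 2[OF u])
    then show ?thesis using gb[OF that] by (simp add: twist_inv_def[of F])
  qed
qed

sublocale F: hom_object R F by unfold_locales (rule F_hom_object)

lemmas [lin] = F.tw_lin0[simplified] F.ti_lin0[simplified]
    linear_on_comp[OF F.tw_lin0[simplified]] linear_on_comp[OF F.ti_lin0[simplified]]
  linear_on_closed[OF F.tw_lin0[simplified]] linear_on_closed[OF F.ti_lin0[simplified]]

lemma act_F [simp]: "m \<in> carrier M \<Longrightarrow> a \<in> carrier A \<Longrightarrow> c \<in> carrier A \<Longrightarrow> act F (bt m a) c =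
    bt (twist M m) (a \<otimes>\<^bsub>A\<^esub> twist_inv A c)"
  and act_F_bil: "bilinear_on R Q A Q (act F)"
proof -
  have *: "act F u c = blift R M A Q (\<lambda>m a. bt (twist M m) (a \<otimes>\<^bsub>A\<^esub> twist_inv A c)) u" for u c
    by (simp add: functor_F_def Let_def)
  have bil: "bilinear_on R M A Q (\<lambda>m a. bt (twist M m) (a \<otimes>\<^bsub>A\<^esub> twist_inv A c))" if "c \<in> carrier A"
      for c
    by (simp add: lin that)
  have bal: "bt (twist M (act M m b)) (twist A a \<otimes>\<^bsub>A\<^esub> twist_inv A c) =
      bt (twist M (twist M m)) ((b \<otimes>\<^bsub>A\<^esub> a) \<otimes>\<^bsub>A\<^esub> twist_inv A c)"
    if [lin]: "c \<in> carrier A" "m \<in> carrier M" "b \<in> carrier B" "a \<in> carrier A" for c m b a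
    \<comment> \<open>Since \<open>\<beta>(a) \<beta>\<^sup>-\<^sup>1(c) = \<beta>(a
      \<beta>\<^sup>-\<^sup>2(c))\<close>, the balancing relation applies and gives
      \<open>\<beta>(b) (a \<beta>\<^sup>-\<^sup>2(c))\<close> on the right, which Hom-associativity
      turns into \<open>(b a) \<beta>\<^sup>-\<^sup>1(c)\<close>.\<close>
    using that(3) bt_bal[of "twist M m" "twist A b" "a \<otimes>\<^bsub>A\<^esub> twist_inv A (twist_inv A c)"]
      AA.mult_assoc[of b a "twist_inv A (twist_inv A c)"]
    by (simp add: lin tws)
  show "m \<in> carrier M \<Longrightarrow> a \<in> carrier A \<Longrightarrow> c \<in> carrier A \<Longrightarrow> act F (bt m a) c =
      bt (twist M m) (a \<otimes>\<^bsub>A\<^esub> twist_inv A c)"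
    unfolding * by (rule BT.blift_bt[OF Q_mod bil bal]; assumption)
  show "bilinear_on R Q A Q (act F)"
  proof
    fix u assume "u \<in> carrier Q"
    then show "linear_on R A Q (act F u)" unfolding *
      by (intro BT.linear_on_blift_param) (simp_all add: lin)
  next
    fix c assume "c \<in> carrier A"
    then show "linear_on R Q Q (\<lambda>u. act F u c)"
      unfolding * by (intro BT.blift_linear bil bal) (simp_all add: lin)
  qed
qed

lemmas [lin] = bilinear_on_closed[OF act_F_bil] linear_on_comp[OF bilinear_on_left[OF act_F_bil]]
    linear_on_comp[OF bilinear_on_right[OF act_F_bil]]
  bilinear_on_left[OF act_F_bil] bilinear_on_right[OF act_F_bil]

lemma coact_F [simp]: "m \<in> carrier M \<Longrightarrow> a \<in> carrier A \<Longrightarrow>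
    coact F (bt m a) = tlift R A H QH (\<lambda>a0 a1. tens R Q H (bt (twist_inv M m) a0) (twist H a1))
        (\<rho>\<^sub>A a)"
  and coact_F_lin: "linear_on R Q QH (coact F)"
proof -
  let ?f = "\<lambda>m a. tlift R A H QH (\<lambda>a0 a1. tens R Q H (bt (twist_inv M m) a0) (twist H a1)) (\<rho>\<^sub>A a)"
  have *: "coact F = blift R M A QH ?f"
    by (simp add: functor_F_def Let_def)
  have QH: "module R QH" by (simp add: lin)
  have bil: "bilinear_on R M A QH ?f" by (simp add: lin)
  have bal: "?f (act M m b) (twist A a) = ?f (twist M m) (b \<otimes>\<^bsub>A\<^esub> a)"
    if [lin]: "m \<in> carrier M" "b \<in> carrier B" "a \<in> carrier A" for m b a
    using that(2)
    by (simp add: lin tws push A_mult B_coact bt_bal[of "twist_inv M m" "twist_inv A b"] cong: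
        tlift_cong_simp)
  show "m \<in> carrier M \<Longrightarrow> a \<in> carrier A \<Longrightarrow> coact F (bt m a) = ?f m a"
    "linear_on R Q QH (coact F)"
    unfolding * by (rule BT.blift_balanced[OF QH bil bal]; assumption)+
qed

lemmas [lin] = coact_F_lin linear_on_comp[OF coact_F_lin] linear_on_closed[OF coact_F_lin]

end

lemma (in hom_comodule) r_ti: "m \<in> carrier M \<Longrightarrow>
    \<rho> (twist_inv M m) = tlift R M H (tensor R M H)
        (\<lambda>a b. tens R M H (twist_inv M a) (twist_inv H b)) (\<rho> m)"
proof -
  assume m [lin]: "m \<in> carrier M"
  have "\<rho> (twist_inv M m) = tlift R M H (tensor R M H)
      (\<lambda>a b. tens R M H (twist_inv M a) (twist_inv H b)) (\<rho> (twist M (twist_inv M m)))"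
    by (subst r_tw) (simp_all add: lin push M.ti_tw H.ti_tw tensor_expand cong: tlift_cong_simp)
  then show ?thesis by (simp add: M.tw_ti m)
qed

section \<open>\<open>F(M)\<close> as a Hom-Hopf module, and the unit\<close>

context coinv_module begin

text \<open>Each axiom is an equation between maps linear in \<open>u\<close>, so
  \<open>Q_ext\<close> reduces it to pure tensors \<open>m \<otimes> a\<close>, where it follows
  from the corresponding property of \<open>A\<close>.\<close>

lemma F_obj: "hopf_mod_obj R H A F"
  unfolding hopf_mod_obj_def rmod_obj_def right_hom_module_def right_hom_comodule_def
proof (intro conjI ballI F_hom_object)
  let ?T = "tensor R Q (tensor R H H)"
  show "bilinear_on R F A F (act F)"
    using act_F_bil by (simp add: bilinear_on_def)
  show "linear_on R F (tensor R F H) (coact F)" by (simp add: lin)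
  fix u assume "u \<in> carrier F"
  then have u: "u \<in> carrier Q" by simp
  show "act F u \<one>\<^bsub>A\<^esub> = twist F u"
    by (rule BT.Q_ext[OF Q_mod _ _ _ u, where f="\<lambda>u. act F u \<one>\<^bsub>A\<^esub>"]) (simp_all add: lin tws)
  have "tlift R Q H ?T (\<lambda>m0 m1. tens R Q (tensor R H H) (twist_inv F m0) (comul H m1)) (coact F u) =
     tlift R Q H ?T (\<lambda>m0 m1. tlift R Q H ?T (\<lambda>m00 m01. tens R Q (tensor R H H) m00
         (tens R H H m01 (twist_inv H m1))) (coact F m0)) (coact F u)"
    (is "?L u = ?R u")
  proof (rule BT.Q_ext[OF _ _ _ _ u, where P="?T" and f="?L"])
    fix m a assume [lin]: "m \<in> carrier M" "a \<in> carrier A"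
    show "?L (bt m a) = ?R (bt m a)"
      using AC.hcoassoc[where m = a and P = ?T and f="\<lambda>b x y. tens R Q (tensor R H H)
          (bt (twist_inv M (twist_inv M m)) b) (tens R H H (twist H x) (twist H y))"]
      by (simp add: lin tws push cong: tlift_cong_simp)
  qed (simp_all add: lin)
  then show "tlift R F H (tensor R F (tensor R H H))
      (\<lambda>m0 m1. tens R F (tensor R H H) (twist_inv F m0) (comul H m1)) (coact F u) =
     tlift R F H (tensor R F (tensor R H H)) (\<lambda>m0 m1. tlift R F H (tensor R F (tensor R H H))
       (\<lambda>m00 m01. tens R F (tensor R H H) m00 (tens R H H m01 (twist_inv H m1))) (coact F m0))
           (coact F u)"
    by simp
  have "tlift R Q H Q (\<lambda>m0 m1. counit H m1 \<odot>\<^bsub>Q\<^esub> m0) (coact F u) = twist_inv F u" (is "?L u = _")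
  proof (rule BT.Q_ext[OF Q_mod _ _ _ u, where f="?L"])
    fix m a assume [lin]: "m \<in> carrier M" "a \<in> carrier A"
    have "bt (twist_inv M m) (tlift R A H A (\<lambda>m0 m1. counit H m1 \<odot>\<^bsub>A\<^esub> m0) (\<rho>\<^sub>A a)) = ?L (bt m a)"
      by (simp add: lin tws push linear_on_scale[OF bilinear_on_right[OF BT.bt_bilinear]] cong:
          tlift_cong_simp)
    then show "?L (bt m a) = twist_inv F (bt m a)" by (simp add: AC.r_counit lin)
  qed (simp_all add: lin)
  then show "tlift R F H F (\<lambda>m0 m1. counit H m1 \<odot>\<^bsub>F\<^esub> m0) (coact F u) = twist_inv F u" by simp
  have "coact F (twist F u) = tlift R Q H QH (\<lambda>m0 m1. tens R Q H (twist F m0) (twist H m1))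
      (coact F u)"
    by (rule BT.Q_ext[OF _ _ _ _ u, where P=QH and f="\<lambda>u. coact F (twist F u)"])
      (simp_all add: lin tws push cong: tlift_cong_simp)
  then show "coact F (twist F u) = tlift R F H (tensor R F H)
      (\<lambda>m0 m1. tens R F H (twist F m0) (twist H m1)) (coact F u)"
    by simp
  fix a assume a [lin]: "a \<in> carrier A"
  show "twist F (act F u a) = act F (twist F u) (twist A a)"
    by (rule BT.Q_ext[OF Q_mod _ _ _ u, where f="\<lambda>u. twist F (act F u a)"]) (simp_all add: lin tws)
  have "coact F (act F u a) = tlift R Q H QH
          (\<lambda>m0 m1. tlift R A H QH (\<lambda>a0 a1. tens R Q H (act F m0 a0) (m1 \<otimes>\<^bsub>H\<^esub> a1)) (\<rho>\<^sub>A a))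
              (coact F u)"
    by (rule BT.Q_ext[OF _ _ _ _ u, where P=QH and f="\<lambda>u. coact F (act F u a)"])
      (simp_all add: lin tws push A_mult AC.r_ti cong: tlift_cong_simp)
  then show "coact F (act F u a) = tlift R F H (tensor R F H)
          (\<lambda>m0 m1. tlift R A H (tensor R F H) (\<lambda>a0 a1. tens R F H (act F m0 a0) (m1 \<otimes>\<^bsub>H\<^esub> a1))
              (\<rho>\<^sub>A a)) (coact F u)"
    by simp
  fix b assume b [lin]: "b \<in> carrier A"
  show "act F (act F u a) (twist A b) = act F (twist F u) (a \<otimes>\<^bsub>A\<^esub> b)"
  proof (rule BT.Q_ext[OF Q_mod _ _ _ u, where f="\<lambda>u. act F (act F u a) (twist A b)"])
    fix m c assume [lin]: "m \<in> carrier M" "c \<in> carrier A"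
    show "act F (act F (bt m c) a) (twist A b) = act F (twist F (bt m c)) (a \<otimes>\<^bsub>A\<^esub> b)"
      using AA.mult_assoc[of c "twist_inv A a" "twist_inv A b"] by (simp add: lin tws)
  qed (simp_all add: lin)
qed

interpretation FF: hom_hopf_module R H A \<phi> F
  by unfold_locales (rule F_obj)

abbreviation "\<eta> \<equiv> adj_unit R H A M"

lemma eta: "\<eta> m = bt (twist_inv M m) \<one>\<^bsub>A\<^esub>"
  by (simp add: adj_unit_def)

lemma eta_coinv:
  assumes [lin]: "m \<in> carrier M"
  shows "\<eta> m \<in> coinvariants R H F (coact F)"
  unfolding coinvariants_def by (simp add: eta lin A_one push tws)

lemma eta_mor: "rmod_mor R B M FF.G \<eta>"
  unfolding rmod_mor_def hom_morphism_def
proof (intro conjI ballI M FF.G_obj)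
  show "linear_on R M FF.G \<eta>"
    by (rule FF.linear_on_into_G) (simp_all add: eta_coinv, simp add: eta[abs_def] lin)
  fix m assume [lin]: "m \<in> carrier M"
  show "twist FF.G (\<eta> m) = \<eta> (twist M m)"
    by (simp add: eta lin tws)
  fix b assume "b \<in> carrier B"
  then have [lin]: "b \<in> coinvariants R H A \<rho>\<^sub>A" by simp
  show "\<eta> (act M m b) = act FF.G (\<eta> m) b"
    using bt_bal[of "twist_inv M m" "twist_inv A b" "\<one>\<^bsub>A\<^esub>"]
    by (simp add: eta lin tws FF.G_act)
qed

text \<open>The averaging map \<open>u \<mapsto> u\<^sub>0 \<phi>(S(u\<^sub>1))\<close>, which is
  \<Theta> after the coaction, is the identity on coinvariants and sends
  \<open>m \<otimes> a\<close> to \<open>m \<otimes> tr(a, 1)\<close>. The trace lies in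
  \<open>B\<close> and moves to the left factor, so the result is
  \<open>\<eta> (L (m \<otimes> a))\<close>; hence \<eta> after \<open>L\<close> is the identity on
  coinvariants.\<close>

lemma eta_iso: "rmod_iso R B M FF.G \<eta>"
proof (rule rmod_isoI[OF eta_mor])
  define L where "L = blift R M A M (\<lambda>m a. act M m (U.AA.tr a \<one>\<^bsub>A\<^esub>))"
  define \<Theta> where "\<Theta> = tlift R Q H Q (\<lambda>u h. act F u (\<phi> (S h)))"
  have lin_tr: "linear_on R A B (\<lambda>a. U.AA.tr a \<one>\<^bsub>A\<^esub>)"
    using U.AA.tr_lin(1)[OF linear_on_id AA.one_closed] by (auto simp: linear_on_def lin)
  have bil: "bilinear_on R M A M (\<lambda>m a. act M m (U.AA.tr a \<one>\<^bsub>A\<^esub>))"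
    by (simp add: lin lin_tr)
  have bal: "act M (act M m b) (U.AA.tr (twist A a) \<one>\<^bsub>A\<^esub>) = act M (twist M m)
      (U.AA.tr (b \<otimes>\<^bsub>A\<^esub> a) \<one>\<^bsub>A\<^esub>)"
    if "m \<in> carrier M" "b \<in> carrier B" "a \<in> carrier A" for m b a
  proof -
    note [lin] = that(1,3)
    have b [lin]: "b \<in> coinvariants R H A \<rho>\<^sub>A" using that(2) by simp
    let ?t = "U.AA.tr (twist A a) \<one>\<^bsub>A\<^esub>"
    \<comment> \<open>The Hom-product of \<open>b\<close> and \<open>a\<close> is the untwisted
      product of \<open>twist A b\<close> and \<open>twist A a\<close>, so the coinvariant factor to
      be pulled out of the trace is \<open>twist A b\<close>.\<close>
    have "AC.ur (twist A b) = tens R A H (twist A b) \<one>\<^bsub>H\<^esub>"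
      using coinv_tw[OF AC.hom_comodule_axioms b] by
          (simp add: coinv_iff[OF AC.hom_comodule_axioms])
    then have "U.AA.tr (AA.um (twist A b) (twist A a)) \<one>\<^bsub>A\<^esub> = AA.um (twist A b) ?t"
      by (intro U.AA.tr_left_coinv) (simp_all add: lin)
    then have "U.AA.tr (b \<otimes>\<^bsub>A\<^esub> a) \<one>\<^bsub>A\<^esub> = b \<otimes>\<^bsub>A\<^esub> twist_inv A ?t"
      by (simp add: lin tws)
    then show ?thesis
      using ra_assoc[of m b "twist_inv A ?t"] by (simp add: lin AA.tw_ti)
  qed
  have L: "linear_on R Q M L" and Lb: "m \<in> carrier M \<Longrightarrow> a \<in> carrier A \<Longrightarrow> L (bt m a) =
      act M m (U.AA.tr a \<one>\<^bsub>A\<^esub>)" for m a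
    unfolding L_def by (rule BT.blift_balanced[OF M.mod bil bal]; assumption)+
  note [lin] = linear_on_comp[OF L] linear_on_closed[OF L]
  have "L (\<eta> m) = m" if [lin]: "m \<in> carrier M" for m
    by (simp add: eta Lb lin U.tr_e_e tws)
  moreover have "\<eta> (L u) = u" if u: "u \<in> coinvariants R H F (coact F)" for u
  proof -
    have uQ: "u \<in> carrier Q" using u by (simp add: coinvariants_def)
    have "\<Theta> (coact F u) = \<eta> (L u)"
    proof (rule BT.Q_ext[OF Q_mod _ _ _ uQ, where f="\<lambda>u. \<Theta> (coact F u)"])
      show "linear_on R Q Q (\<lambda>u. \<Theta> (coact F u))" by (simp add: \<Theta>_def lin)
      show "linear_on R Q Q (\<lambda>u. \<eta> (L u))" by (simp add: eta lin)
      fix m a assume [lin]: "m \<in> carrier M" "a \<in> carrier A"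
      have "\<Theta> (coact F (bt m a)) = bt m (U.AA.tr a \<one>\<^bsub>A\<^esub>)"
        by (simp add: \<Theta>_def U.tr_e lin tws push cong: tlift_cong_simp)
      also have "\<dots> = \<eta> (L (bt m a))"
        using bt_bal[of "twist_inv M m" "twist_inv A (U.AA.tr a \<one>\<^bsub>A\<^esub>)" "\<one>\<^bsub>A\<^esub>"]
        by (simp add: Lb eta lin tws)
      finally show "\<Theta> (coact F (bt m a)) = \<eta> (L (bt m a))" .
    qed
    moreover have "\<Theta> (coact F u) = u"
      using FF.G_coact[OF u] uQ
      by (simp add: \<Theta>_def lin push U.S_u phi_one FF.ac_one F.tw_ti)
    ultimately show ?thesis by simp
  qed
  moreover have "L u \<in> carrier M" if "u \<in> coinvariants R H F (coact F)" for u
    using FF.G_N[OF that] by (simp add: lin)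
  ultimately show "bij_betw \<eta> (carrier M) (carrier FF.G)"
    by (intro bij_betw_byWitness[of _ L]) (auto simp: eta_coinv)
qed

end

section \<open>The counit\<close>

context hom_hopf_module begin

sublocale GG: coinv_module R H A \<phi> G
  by unfold_locales (rule G_obj)

abbreviation "\<epsilon> \<equiv> adj_counit R H A N"

lemma eps: "n \<in> carrier G \<Longrightarrow> a \<in> carrier A \<Longrightarrow> \<epsilon> (GG.bt n a) = act N n a"
  and eps_lin: "linear_on R GG.Q N \<epsilon>"
proof -
  have *: "\<epsilon> = blift R G A N (act N)" by (simp add: adj_counit_def)
  have bil: "bilinear_on R G A N (act N)" by (simp add: lin)
  have bal: "act N (act G n b) (twist A a) = act N (twist G n) (b \<otimes>\<^bsub>A\<^esub> a)"
    if "n \<in> carrier G" "b \<in> carrier B" "a \<in> carrier A" for n b a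
    using that by (simp add: lin G_act ac_assoc)
  show "n \<in> carrier G \<Longrightarrow> a \<in> carrier A \<Longrightarrow> \<epsilon> (GG.bt n a) = act N n a" "linear_on R GG.Q N \<epsilon>"
    unfolding * by (rule GG.BT.blift_balanced[OF NC.M.mod bil bal]; assumption)+
qed

lemmas [lin] = eps_lin linear_on_comp[OF eps_lin] linear_on_closed[OF eps_lin]

lemma eps_push [push]:
  assumes "module R K" "module R L" "t \<in> carrier (tensor R K L)"
    and "\<And>a b. a \<in> carrier K \<Longrightarrow> b \<in> carrier L \<Longrightarrow> f a b \<in> carrier GG.Q"
  shows "\<epsilon> (tlift R K L GG.Q f t) = tlift R K L N (\<lambda>a b. \<epsilon> (f a b)) t"
  by (rule linear_tlift; simp add: assms lin)

text \<open>The balancing relation in terms of the untwisted action and product, the form in which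
  \<open>eps_iso\<close> moves traces across the tensor sign.\<close>

lemma uac_bal:
  assumes n: "n \<in> coinvariants R H N (coact N)" and t: "t \<in> coinvariants R H A \<rho>\<^sub>A" and l: "l \<in>
      carrier A"
  shows "GG.bt (uac n t) l = GG.bt n (AA.um t l)"
proof -
  have eq: "act G (twist_inv G n) (twist_inv A t) = uac n t" using n t by (simp add: G_act tws lin)
  show ?thesis using GG.bt_bal'[of n t l] n t l unfolding eq by (simp add: lin tws)
qed

lemma eps_mor: "hopf_mod_mor R H A GG.F N \<epsilon>"
  unfolding hopf_mod_mor_def rmod_mor_def hom_colinear_def hom_morphism_def
proof (intro conjI ballI GG.F_obj N)
  show "rmod_obj R A GG.F" "rmod_obj R A N" using GG.F_obj N by (simp_all add: hopf_mod_obj_def)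
  \<comment> \<open>\<open>hom_morphism\<close> is a conjunct of both \<open>rmod_mor\<close> and
    \<open>hom_colinear\<close>, so linearity and compatibility with the twists are asked for
    twice.\<close>
  show "linear_on R GG.F N \<epsilon>" "linear_on R GG.F N \<epsilon>" by (simp_all add: lin)
  fix u assume "u \<in> carrier GG.F"
  then have u: "u \<in> carrier GG.Q" by simp
  show 1: "twist N (\<epsilon> u) = \<epsilon> (twist GG.F u)"
    by (rule GG.BT.Q_ext[OF NC.M.mod _ _ _ u, where f="\<lambda>u. twist N (\<epsilon> u)"])
        (simp_all add: lin eps tws)
  show "twist N (\<epsilon> u) = \<epsilon> (twist GG.F u)" by (rule 1)
  have "coact N (\<epsilon> u) = tlift R GG.Q H (tensor R N H) (\<lambda>m0 m1. tens R N H (\<epsilon> m0) m1) (coact GG.F u)"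
    by (rule GG.BT.Q_ext[OF _ _ _ _ u, where P="tensor R N H" and f="\<lambda>u. coact N (\<epsilon> u)"])
      (simp_all add: lin eps tws N_mult G_coact push cong: tlift_cong_simp)
  then show "coact N (\<epsilon> u) = tlift R GG.F H (tensor R N H) (\<lambda>m0 m1. tens R N H (\<epsilon> m0) m1)
      (coact GG.F u)"
    by simp
  fix a assume [lin]: "a \<in> carrier A"
  show "\<epsilon> (act GG.F u a) = act N (\<epsilon> u) a"
  proof (rule GG.BT.Q_ext[OF NC.M.mod _ _ _ u, where f="\<lambda>u. \<epsilon> (act GG.F u a)"])
    fix n x assume n: "n \<in> carrier G" and [lin]: "x \<in> carrier A"
    show "\<epsilon> (act GG.F (GG.bt n x) a) = act N (\<epsilon> (GG.bt n x)) a"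
      using n ac_assoc[of n x "twist_inv A a"] by (simp add: lin eps tws)
  qed (simp_all add: lin)
qed

text \<open>\<open>I\<close> is the inverse of the untwisted counit. Since \<open>act N n a\<close>
  is \<mu> of the untwisted action, the counit itself is inverted by \<open>I\<close> after
  \<open>twist_inv N\<close>.\<close>

lemma eps_iso: "hopf_mod_iso R H A GG.F N \<epsilon>"
proof (rule hopf_mod_isoI[OF eps_mor _ HA.mod])
  define I where "I n = tlift R N H GG.Q (\<lambda>n0 n1. tlift R A A GG.Q (\<lambda>r l. GG.bt (UN.tr n0 r) l)
      (\<sigma> n1)) (NC.ur n)" for n
  have tr_lin: "a \<in> carrier A \<Longrightarrow> linear_on R N G (\<lambda>n. UN.tr n a)"
    "n \<in> carrier N \<Longrightarrow> linear_on R A G (UN.tr n)" for n a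
    by (rule linear_on_into_G; simp add: lin UN.tr_lin(2)[OF linear_on_id])+
  note [lin] = linear_on_closed[OF sigma_lin]
  have I_lin: "linear_on R N GG.Q I" by (simp add: I_def[abs_def] lin tr_lin)
  note [lin] = I_lin linear_on_comp[OF I_lin] linear_on_closed[OF I_lin]
  have 1: "\<epsilon> (I (twist_inv N n)) = n" if [lin]: "n \<in> carrier N" for n
  proof -
    have "\<epsilon> (I (twist_inv N n)) = twist N (tlift R N H N
        (\<lambda>n0 n1. U.sig N (\<lambda>r l. uac (UN.tr n0 r) l) n1) (NC.ur (twist_inv N n)))"
      by (simp add: I_def lin push eps tws cong: tlift_cong_simp)
    also have "\<dots> = n"
      using UN.tr_reconstruct[of "twist_inv N n"] by (simp add: lin tws)
    finally show ?thesis .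
  qed
  have 2: "I (twist_inv N (\<epsilon> u)) = u" if u: "u \<in> carrier GG.Q" for u
  proof (rule GG.BT.Q_ext[OF GG.Q_mod _ _ _ u, where f="\<lambda>u. I (twist_inv N (\<epsilon> u))"])
    fix n a assume "n \<in> carrier G" and [lin]: "a \<in> carrier A"
    then have n [lin]: "n \<in> coinvariants R H N (coact N)" by simp
    have trB [lin]: "U.AA.tr x y \<in> coinvariants R H A \<rho>\<^sub>A" if "x \<in> carrier A" "y \<in> carrier A" for
        x y
      using U.AA.tr_coinv[OF that] U.AA.tr_closed[OF that] by
          (simp add: coinv_iff[OF AC.hom_comodule_axioms])
    have "I (twist_inv N (\<epsilon> (GG.bt n a))) =
      tlift R A H GG.Q (\<lambda>a0 a1. tlift R A A GG.Q (\<lambda>r l. GG.bt (UN.tr (uac n a0) r) l) (\<sigma> a1))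
          (AC.ur a)"
      by (simp add: eps lin I_def UN.N_mult G_ur tr_lin push U.hm_unit cong: tlift_cong_simp)
    \<comment> \<open>Coinvariance of \<open>n\<close> pulls it out of the trace. What is left,
      \<open>U.AA.tr a0 r\<close>, lies in \<open>B\<close> and crosses the tensor sign, so the
      right factor becomes the reconstruction formula for \<open>A\<close> as a Hopf module over
      itself.\<close>
    also have "\<dots> = tlift R A H GG.Q (\<lambda>a0 a1. tlift R A A GG.Q
        (\<lambda>r l. GG.bt n (AA.um (U.AA.tr a0 r) l)) (\<sigma> a1)) (AC.ur a)"
      by (intro tlift_cong_pointwise; simp add: lin UN.tr_left_coinv G_ur uac_bal)
    also have "\<dots> = GG.bt n (tlift R A H A (\<lambda>a0 a1. U.sig A (\<lambda>r l. AA.um (U.AA.tr a0 r) l) a1)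
        (AC.ur a))"
      by (simp add: lin push cong: tlift_cong_simp)
    also have "\<dots> = GG.bt n a" by (simp only: U.AA.tr_reconstruct[OF \<open>a \<in> carrier A\<close>])
    finally show "I (twist_inv N (\<epsilon> (GG.bt n a))) = GG.bt n a" .
  qed (simp_all add: lin)
  show "bij_betw \<epsilon> (carrier GG.F) (carrier N)"
    by (rule bij_betw_byWitness[of _ "\<lambda>n. I (twist_inv N n)"]) (auto simp: 1 2 lin)
qed

end

theorem theorem4p7:
  fixes R :: "'k ring" and H :: "('k, 'h) hom_hopf" and A :: "('k, 'a, 'h) comod_alg"
  assumes "field R"
    and "hom_hopf_algebra R H"
    and "bij_betw (antipode H) (carrier H) (carrier H)"
    and "hom_comodule_algebra R H A"
    and "can R H A ` carrier (btensor R (coinv_alg R H A) A (mult A) A (mult A)) =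
         carrier (tensor R A H)"
    and "\<exists>\<phi>. total_integral R H A \<phi>"
  shows "(\<forall>M :: ('k, 'm, 'a) hom_rmod.
            rmod_obj R (coinv_alg R H A) M \<longrightarrow>
            rmod_iso R (coinv_alg R H A) M
              (functor_G R H (functor_F R H A M)) (adj_unit R H A M)) \<and>
         (\<forall>N :: ('k, 'n, 'a, 'h) hopf_mod.
            hopf_mod_obj R H A N \<longrightarrow>
            hopf_mod_iso R H A (functor_F R H A (functor_G R H N)) N (adj_counit R H A N))"
proof -
  from assms(6) obtain \<phi> where "total_integral R H A \<phi>" by blast
  then have g: "hom_galois R H A \<phi>" using assms(1-5) by (intro hom_galois.intro)
  show ?thesis
  proof (intro conjI allI impI)
    fix M :: "('k, 'm, 'a) hom_rmod" assume "rmod_obj R (coinv_alg R H A) M"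
    then have "coinv_module R H A \<phi> M" using g by
        (intro coinv_module.intro coinv_module_axioms.intro)
    then show "rmod_iso R (coinv_alg R H A) M (functor_G R H (functor_F R H A M))
        (adj_unit R H A M)"
      by (rule coinv_module.eta_iso)
  next
    fix N :: "('k, 'n, 'a, 'h) hopf_mod" assume "hopf_mod_obj R H A N"
    then have "hom_hopf_module R H A \<phi> N" using g by
        (intro hom_hopf_module.intro hom_hopf_module_axioms.intro)
    then show "hopf_mod_iso R H A (functor_F R H A (functor_G R H N)) N (adj_counit R H A N)"
      by (rule hom_hopf_module.eps_iso)
  qed
qed

end
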